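(* Let $N\in\mathbb N$, $f\in C^{2N}_p(\mathbb R)$, and let $c=(c_I)_{|I|\le M}$ be a finite family of ($\mathcal F_0$-measurable) coefficients indexed by words. Then, as $t\downarrow 0$, $$\mathbb E_0\big[f(\langle c,\widehat{\mathbb W}_t\rangle)\big]=f(c_\emptyset)+\sum_{n=1}^N\frac{1}{n!}\bigg(\sum_{k_1,\ldots,k_n=0}^2f^{(k_1+\cdots+k_n)}(c_\emptyset)\,\langle\emptyset,\mathcal G_{c,k_1,\ldots,k_n}(\emptyset)\rangle\bigg)t^n+o(t^N).$$
   Context: Setting: a filtered probability space carrying a $d$-dimensional standard Brownian motion $W=(W^1,\ldots,W^d)$; $\mathbb E_0$ is conditional expectation given $\mathcal F_0$. $\widehat W^0_t:=t$, $\widehat W^i_t:=W^i_t$. Words: $I=(i_1,\ldots,i_k)\in\{0,\ldots,d\}^k$, $k\ge 0$, $\emptyset$ empty word, $|I|=k$, $I'=(i_1,\ldots,i_{k-1})$ for $I\ne\emptyset$, $\emptyset':=0$ (zero vector). Finite linear combinations $x=\sum_Hx_HH$ of words form a vector space; $xa:=\sum_Hx_H(H,a)$ appends letter $a$; $\langle\emptyset,x\rangle:=x_\emptyset$. Signature: $\langle\emptyset,\widehat{\mathbb W}_t\rangle=1$, $\langle I,\widehat{\mathbb W}_t\rangle=\int_0^t\int_0^{t_k}\cdots\int_0^{t_2}1\,d\widehat W^{i_1}_{t_1}\cdots d\widehat W^{i_k}_{t_k}$ (iterated Itô integrals); $\langle c,\widehat{\mathbb W}_t\rangle:=\sum_Ic_I\langle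 I,\widehat{\mathbb W}_t\rangle$; $c_\emptyset$ is the coefficient of $\emptyset$. Star product: $\rho_{ij}:=1_{\{i=j>0\}}$; $\emptyset\star I=I\star\emptyset=I$ and for nonempty $I,J$: $I\star J=(I'\star J)i_{|I|}+(I\star J')j_{|J|}+\rho_{i_{|I|}j_{|J|}}(I'\star J')(0)$ (last term appends the letter $0$); extended bilinearly. Operators, for linear combination $d=\sum_Hd_HH$: $\mathcal G_{c,0}(d)=\sum_Hd_H1_{\{h_{|H|}=0\}}H'$; $\mathcal G_{c,1}(d)=\sum_{I,H}c_Id_H\,I'\star(H1_{\{i_{|I|}=0\}}+\rho_{i_{|I|},h_{|H|}}H')$; $\mathcal G_{c,2}(d)=\sum_{I,J,H}c_Ic_Jd_H\frac{\rho_{i_{|I|},j_{|J|}}}{2}I'\star J'\star H$ (terms referring to the last letter of the empty word vanish); $\mathcal G_{c,k_1,\ldots,k_n}:=\mathcal G_{c,k_n}\circ\mathcal G_{c,k_1,\ldots,k_{n-1}}$. $C^k_p(\mathbb R):=\{f\in C^k(\mathbb R):|f^{(j)}(x)|\le C(1+|x|^p)$ for some $C>0$, $p\in\mathbb N$, all $j\le k\}$. *)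

theory Defs
  imports "HOL-Probability.Probability"
begin

definition is_filtration :: "'a measure \<Rightarrow> (real \<Rightarrow> 'a measure) \<Rightarrow> bool" where
  "is_filtration M F \<longleftrightarrow>
     (\<forall>t. subalgebra M (F t)) \<and> (\<forall>s t. s \<le> t \<longrightarrow> sets (F s) \<subseteq> sets (F t))"

definition is_std_BM ::
  "'a measure \<Rightarrow> (real \<Rightarrow> 'a measure) \<Rightarrow> nat \<Rightarrow> (nat \<Rightarrow> real \<Rightarrow> 'a \<Rightarrow> real) \<Rightarrow> bool" where
  "is_std_BM M F d W \<longleftrightarrow>
     (\<forall>i\<in>{1..d}. \<forall>t\<ge>0. W i t \<in> borel_measurable (F t)) \<and>
     (\<forall>i\<in>{1..d}. \<forall>\<omega>\<in>space M. W i 0 \<omega> = 0 \<and> continuous_on {0..} (\<lambda>t. W i t \<omega>)) \<and>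
     (\<forall>s t. 0 \<le> s \<longrightarrow> s < t \<longrightarrow>
        (\<forall>A\<in>sets (F s). \<forall>B::nat \<Rightarrow> real set. (\<forall>i. B i \<in> sets borel) \<longrightarrow>
           measure M (A \<inter> {\<omega>\<in>space M. \<forall>i\<in>{1..d}. W i t \<omega> - W i s \<omega> \<in> B i})
           = measure M A *
             (\<Prod>i=1..d. measure (density lborel (normal_density 0 (sqrt (t - s)))) (B i))))"

definition hatW :: "(nat \<Rightarrow> real \<Rightarrow> 'a \<Rightarrow> real) \<Rightarrow> nat \<Rightarrow> real \<Rightarrow> 'a \<Rightarrow> real" where
  "hatW W a t \<omega> = (if a = 0 then t else W a t \<omega>)"

definition conv_in_prob :: "'a measure \<Rightarrow> (nat \<Rightarrow> 'a \<Rightarrow> real) \<Rightarrow> ('a \<Rightarrow> real) \<Rightarrow> bool" where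
  "conv_in_prob M X Y \<longleftrightarrow>
     (\<forall>\<epsilon>>0. (\<lambda>n. measure M {\<omega>\<in>space M. \<epsilon> < \<bar>X n \<omega> - Y \<omega>\<bar>}) \<longlonglongrightarrow> 0)"

text \<open>Words are lists of letters in {0..d}, written in order (i_1,...,i_k), last letter at the end.
  S I t is (a continuous version of) the iterated Ito integral; the Ito integral of a
  continuous adapted integrand is the limit in probability of left-point Riemann sums
  along dyadic partitions of [0,t].\<close>
definition is_signature ::
  "'a measure \<Rightarrow> nat \<Rightarrow> (nat \<Rightarrow> real \<Rightarrow> 'a \<Rightarrow> real) \<Rightarrow> (nat list \<Rightarrow> real \<Rightarrow> 'a \<Rightarrow> real) \<Rightarrow> bool" where
  "is_signature M d W S \<longleftrightarrow>
     (\<forall>t \<omega>. S [] t \<omega> = 1) \<and>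
     (\<forall>I. set I \<subseteq> {0..d} \<longrightarrow>
        (\<forall>\<omega>\<in>space M. continuous_on {0..} (\<lambda>t. S I t \<omega>)) \<and>
        (\<forall>t\<ge>0. S I t \<in> borel_measurable M)) \<and>
     (\<forall>I a t. set I \<subseteq> {0..d} \<longrightarrow> a \<le> d \<longrightarrow> 0 \<le> t \<longrightarrow>
        conv_in_prob M
          (\<lambda>n \<omega>. \<Sum>k<2^n. S I (t * real k / 2^n) \<omega> *
                   (hatW W a (t * real (Suc k) / 2^n) \<omega> - hatW W a (t * real k / 2^n) \<omega>))
          (S (I @ [a]) t))"

definition words :: "nat \<Rightarrow> nat \<Rightarrow> nat list list" where
  "words d L = concat (map (\<lambda>k. List.n_lists k [0..<Suc d]) [0..<Suc L])"

definition sigval :: "nat \<Rightarrow> nat \<Rightarrow> (nat list \<Rightarrow> 'a \<Rightarrow> real) \<Rightarrow> (nat list \<Rightarrow> real \<Rightarrow> 'a \<Rightarrow> real)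
    \<Rightarrow> real \<Rightarrow> 'a \<Rightarrow> real" where
  "sigval d L c S t \<omega> = (\<Sum>I\<leftarrow>words d L. c I \<omega> * S I t \<omega>)"

text \<open>A linear combination of words is represented as a formal sum: a finite list of
  (coefficient, word) pairs.  All operations below are linear, hence well defined.\<close>
type_synonym lc = "(real \<times> nat list) list"

definition emptycoef :: "lc \<Rightarrow> real" where
  "emptycoef x = (\<Sum>(r,w)\<leftarrow>x. if w = [] then r else 0)"

definition rho :: "nat \<Rightarrow> nat \<Rightarrow> bool" where
  "rho i j \<longleftrightarrow> i = j \<and> 0 < i"

definition lscale :: "real \<Rightarrow> lc \<Rightarrow> lc" where
  "lscale a x = map (\<lambda>(r,w). (a * r, w)) x"

definition lprep :: "nat \<Rightarrow> lc \<Rightarrow> lc" where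
  "lprep a x = map (\<lambda>(r,w). (r, a # w)) x"

text \<open>Star product on reversed words (last letter first).\<close>
fun rstar :: "nat list \<Rightarrow> nat list \<Rightarrow> lc" where
  "rstar [] J = [(1, J)]"
| "rstar (i # I) [] = [(1, i # I)]"
| "rstar (i # I) (j # J) =
     lprep i (rstar I (j # J)) @ lprep j (rstar (i # I) J) @
     (if rho i j then lprep 0 (rstar I J) else [])"

definition wstar :: "nat list \<Rightarrow> nat list \<Rightarrow> lc" where
  "wstar I J = map (\<lambda>(r,w). (r, rev w)) (rstar (rev I) (rev J))"

definition lstar :: "lc \<Rightarrow> lc \<Rightarrow> lc" where
  "lstar x y = concat (map (\<lambda>(a,u). concat (map (\<lambda>(b,v). lscale (a * b) (wstar u v)) y)) x)"

definition G0 :: "lc \<Rightarrow> lc" where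
  "G0 x = concat (map (\<lambda>(r,h). if h \<noteq> [] \<and> last h = 0 then [(r, butlast h)] else []) x)"

definition G1 :: "nat \<Rightarrow> nat \<Rightarrow> (nat list \<Rightarrow> real) \<Rightarrow> lc \<Rightarrow> lc" where
  "G1 d L cf x = concat (map (\<lambda>(r,h). concat (map (\<lambda>I.
      if I = [] then []
      else lstar [(cf I * r, butlast I)]
             ((if last I = 0 then [(1, h)] else []) @
              (if h \<noteq> [] \<and> rho (last I) (last h) then [(1, butlast h)] else [])))
      (words d L))) x)"

definition G2 :: "nat \<Rightarrow> nat \<Rightarrow> (nat list \<Rightarrow> real) \<Rightarrow> lc \<Rightarrow> lc" where
  "G2 d L cf x = concat (map (\<lambda>(r,h). concat (map (\<lambda>I. concat (map (\<lambda>J.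
      if I \<noteq> [] \<and> J \<noteq> [] \<and> rho (last I) (last J)
      then lstar (lstar [(cf I * cf J * r / 2, butlast I)] [(1, butlast J)]) [(1, h)]
      else [])
      (words d L))) (words d L))) x)"

definition Gk :: "nat \<Rightarrow> nat \<Rightarrow> (nat list \<Rightarrow> real) \<Rightarrow> nat \<Rightarrow> lc \<Rightarrow> lc" where
  "Gk d L cf k x = (if k = 0 then G0 x else if k = 1 then G1 d L cf x else G2 d L cf x)"

text \<open>G_{c,k_1,...,k_n} = G_{c,k_n} o ... o G_{c,k_1}: k_1 is applied first.\<close>
definition Gseq :: "nat \<Rightarrow> nat \<Rightarrow> (nat list \<Rightarrow> real) \<Rightarrow> nat list \<Rightarrow> lc \<Rightarrow> lc" where
  "Gseq d L cf ks x = fold (Gk d L cf) ks x"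

definition Ckp :: "nat \<Rightarrow> (real \<Rightarrow> real) \<Rightarrow> bool" where
  "Ckp k f \<longleftrightarrow>
     (\<forall>j<k. \<forall>x. ((deriv ^^ j) f has_real_derivative (deriv ^^ Suc j) f x) (at x)) \<and>
     continuous_on UNIV ((deriv ^^ k) f) \<and>
     (\<exists>C>0. \<exists>p::nat. \<forall>j\<le>k. \<forall>x. \<bar>(deriv ^^ j) f x\<bar> \<le> C * (1 + \<bar>x\<bar> ^ p))"

text \<open>Y is a version of the (generalized) conditional expectation of X given the
  sub-sigma-algebra G (X need only be integrable on a G-measurable exhausting sequence).\<close>
definition is_cond_exp :: "'a measure \<Rightarrow> 'a measure \<Rightarrow> ('a \<Rightarrow> real) \<Rightarrow> ('a \<Rightarrow> real) \<Rightarrow> bool" where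
  "is_cond_exp M G X Y \<longleftrightarrow>
     Y \<in> borel_measurable G \<and>
     (\<exists>A::nat \<Rightarrow> 'a set. (\<forall>n. A n \<in> sets G) \<and> incseq A \<and> (\<Union>n. A n) = space M \<and>
        (\<forall>n. integrable M (\<lambda>\<omega>. indicator (A n) \<omega> * X \<omega>)) \<and>
        (\<forall>n. integrable M (\<lambda>\<omega>. indicator (A n) \<omega> * Y \<omega>)) \<and>
        (\<forall>n. \<forall>B\<in>sets G. (\<integral>\<omega>. indicator (A n \<inter> B) \<omega> * X \<omega> \<partial>M)
                        = (\<integral>\<omega>. indicator (A n \<inter> B) \<omega> * Y \<omega> \<partial>M)))"

definition expansion ::
  "nat \<Rightarrow> nat \<Rightarrow> nat \<Rightarrow> (real \<Rightarrow> real) \<Rightarrow> (nat list \<Rightarrow> real) \<Rightarrow> real \<Rightarrow> real" where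
  "expansion d L N f cf t =
     f (cf []) + (\<Sum>n=1..N. (1 / fact n) *
        (\<Sum>ks\<in>{ks. length ks = n \<and> set ks \<subseteq> {0..2}}.
            (deriv ^^ sum_list ks) f (cf []) * emptycoef (Gseq d L cf ks [(1, [])])) * t ^ n)"

end

theory Submission
  imports Defs "HOL-Library.Landau_Symbols"
begin

text \<open>
  No stochastic calculus is used. On a grid of mesh \<open>h\<close> the iterated integrals are replaced by
  iterated left-point sums. Because Brownian increments are centred and independent of the past,
  these sums satisfy \<open>L\<^sup>2\<close> estimates of order \<open>h\<close>: they are Cauchy under refinement, they converge
  to the iterated Ito integrals, and they satisfy the product rule of the star product up to an
  error that vanishes with \<open>h\<close>. Hence, at a fixed time, the signature is almost surely a character
  of the star algebra. So powers of \<open>Y = \<langle>c, W\<rangle> - c\<^sub>\<emptyset>\<close> are again linear in the signature, all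
  moments are finite, and \<open>E \<langle>x, W\<^sub>t\<rangle>\<close> is a polynomial in \<open>t\<close> with derivative \<open>E \<langle>G\<^sub>0 x, W\<^sub>t\<rangle>\<close>.
  Deleting a last letter acts on star products like a derivation, with an Ito correction for the
  letter \<open>0\<close>, so \<open>G\<^sub>0\<close> applied to \<open>Y\<^sup>m \<star> x\<close> produces exactly the operators \<open>G\<^sub>1\<close> and \<open>G\<^sub>2\<close>. This
  identifies the moments of \<open>Y\<close> and gives \<open>E Y\<^bsup>2m\<^esup> = O(t\<^sup>m)\<close>; the expansion is then the Taylor
  expansion of \<open>f\<close> at \<open>c\<^sub>\<emptyset>\<close> to order \<open>2N\<close>. Finally, the signature at time \<open>t\<close> is a limit of
  functions of increments independent of \<open>F\<^sub>0\<close>, so the conditional expectation is the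
  unconditional one with the coefficients frozen.
\<close>

subsection \<open>Limits of integrals\<close>

lemma AE_tendsto_0_if_summable_integral:
  fixes U :: "nat \<Rightarrow> 'a \<Rightarrow> real"
  assumes int: "\<And>n. integrable M (U n)"
    and bound: "\<And>n. (\<integral>\<omega>. \<bar>U n \<omega>\<bar> \<partial>M) \<le> b n" and "summable b"
  shows "AE \<omega> in M. (\<lambda>n. U n \<omega>) \<longlonglongrightarrow> 0"
proof -
  have [measurable]: "U n \<in> borel_measurable M" for n using int[of n] by auto
  have b_nonneg: "0 \<le> b n" for n
    using order_trans[OF _ bound[of n]] by (simp add: integral_nonneg_AE)
  have "(\<integral>\<^sup>+\<omega>. (\<Sum>n. ennreal \<bar>U n \<omega>\<bar>) \<partial>M) = (\<Sum>n. \<integral>\<^sup>+\<omega>. ennreal \<bar>U n \<omega>\<bar> \<partial>M)"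
    by (rule nn_integral_suminf) auto
  also have "\<dots> = (\<Sum>n. ennreal (\<integral>\<omega>. \<bar>U n \<omega>\<bar> \<partial>M))"
    using int by (subst nn_integral_eq_integral) auto
  also have "\<dots> \<le> (\<Sum>n. ennreal (b n))"
    by (intro suminf_le ennreal_leI bound) auto
  also have "\<dots> = ennreal (suminf b)"
    using b_nonneg \<open>summable b\<close> by (intro suminf_ennreal_eq summable_sums) auto
  also have "\<dots> < \<infinity>" by simp
  finally have "AE \<omega> in M. (\<Sum>n. ennreal \<bar>U n \<omega>\<bar>) \<noteq> \<infinity>"
    by (intro nn_integral_PInf_AE) (auto simp: less_top)
  then show ?thesis
  proof eventually_elim
    case (elim \<omega>)
    then have "summable (\<lambda>n. \<bar>U n \<omega>\<bar>)" by (intro summable_suminf_not_top) auto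
    then show ?case using summable_LIMSEQ_zero tendsto_rabs_zero_iff by blast
  qed
qed

lemma AE_tendsto_0_if_summable_integral_square:
  fixes U :: "nat \<Rightarrow> 'a \<Rightarrow> real"
  assumes "\<And>n. integrable M (\<lambda>\<omega>. (U n \<omega>)\<^sup>2)"
    and "\<And>n. (\<integral>\<omega>. (U n \<omega>)\<^sup>2 \<partial>M) \<le> b n" and "summable b"
  shows "AE \<omega> in M. (\<lambda>n. U n \<omega>) \<longlonglongrightarrow> 0"
proof -
  have "AE \<omega> in M. (\<lambda>n. (U n \<omega>)\<^sup>2) \<longlonglongrightarrow> 0"
    by (rule AE_tendsto_0_if_summable_integral) (use assms in auto)
  then show ?thesis
    by eventually_elim (auto dest!: tendsto_real_sqrt simp: tendsto_rabs_zero_iff)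
qed

lemma
  fixes f :: "nat \<Rightarrow> 'a \<Rightarrow> real"
  assumes int: "\<And>n. integrable M (f n)" and nonneg: "\<And>n \<omega>. 0 \<le> f n \<omega>"
    and bound: "\<And>n. (\<integral>\<omega>. f n \<omega> \<partial>M) \<le> K"
    and [measurable]: "g \<in> borel_measurable M" and lim: "AE \<omega> in M. (\<lambda>n. f n \<omega>) \<longlonglongrightarrow> g \<omega>"
  shows integrable_limit_of_bounded_integrals: "integrable M g"
    and integral_limit_le_of_bounded_integrals: "(\<integral>\<omega>. g \<omega> \<partial>M) \<le> K"
proof -
  have [measurable]: "f n \<in> borel_measurable M" for n using int[of n] by auto
  have K: "0 \<le> K" using order_trans[OF _ bound[of 0]] nonneg by (simp add: integral_nonneg_AE)
  have g_nonneg: "AE \<omega> in M. 0 \<le> g \<omega>"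
    using lim by eventually_elim (auto intro: LIMSEQ_le_const nonneg)
  have "(\<integral>\<^sup>+\<omega>. ennreal (g \<omega>) \<partial>M) = (\<integral>\<^sup>+\<omega>. liminf (\<lambda>n. ennreal (f n \<omega>)) \<partial>M)"
    using lim by (intro nn_integral_cong_AE, eventually_elim)
      (auto intro!: lim_imp_Liminf[symmetric] tendsto_intros)
  also have "\<dots> \<le> liminf (\<lambda>n. \<integral>\<^sup>+\<omega>. ennreal (f n \<omega>) \<partial>M)"
    by (rule nn_integral_liminf) auto
  also have "\<dots> \<le> ennreal K"
  proof (rule order_trans[OF Liminf_mono Liminf_const[THEN order_eq_refl]])
    show "\<forall>\<^sub>F n in sequentially. (\<integral>\<^sup>+\<omega>. ennreal (f n \<omega>) \<partial>M) \<le> ennreal K"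
      using nonneg bound
      by (intro always_eventually allI) 
        (subst nn_integral_eq_integral[OF int], auto intro: ennreal_leI)
  qed auto
  finally have nn_bound: "(\<integral>\<^sup>+\<omega>. ennreal (g \<omega>) \<partial>M) \<le> ennreal K" .
  then show "integrable M g"
    using g_nonneg by (intro integrableI_nonneg) (auto simp: order.strict_trans1)
  then show "(\<integral>\<omega>. g \<omega> \<partial>M) \<le> K"
    using nn_bound nn_integral_eq_integral[OF _ g_nonneg] K by simp
qed

lemma
  fixes X Y :: "'a \<Rightarrow> real"
  assumes [measurable]: "X \<in> borel_measurable M" "Y \<in> borel_measurable M"
    and sq: "integrable M (\<lambda>\<omega>. (X \<omega>)\<^sup>2)" "integrable M (\<lambda>\<omega>. (Y \<omega>)\<^sup>2)" and "0 < (r::real)"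
  shows integrable_mult_if_square_integrable: "integrable M (\<lambda>\<omega>. X \<omega> * Y \<omega>)"
    and integral_abs_mult_le_weighted_squares:
      "(\<integral>\<omega>. \<bar>X \<omega> * Y \<omega>\<bar> \<partial>M) \<le> r * (\<integral>\<omega>. (X \<omega>)\<^sup>2 \<partial>M) + (\<integral>\<omega>. (Y \<omega>)\<^sup>2 \<partial>M) / r"
proof -
  have pointwise: "\<bar>x * y\<bar> \<le> r * x\<^sup>2 + y\<^sup>2 / r" for x y :: real
  proof -
    have "0 \<le> (r * \<bar>x\<bar> - \<bar>y\<bar>)\<^sup>2 + r * \<bar>x * y\<bar>" using \<open>0 < r\<close> by (intro add_nonneg_nonneg) auto
    also have "\<dots> = r * (r * x\<^sup>2 + y\<^sup>2 / r - \<bar>x * y\<bar>)"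
      using \<open>0 < r\<close>
      by (simp add: power2_diff power_mult_distrib abs_mult algebra_simps power2_eq_square)
    finally show ?thesis using \<open>0 < r\<close> by (simp add: zero_le_mult_iff)
  qed
  show int: "integrable M (\<lambda>\<omega>. X \<omega> * Y \<omega>)"
  proof (rule Bochner_Integration.integrable_bound)
    show "integrable M (\<lambda>\<omega>. r * (X \<omega>)\<^sup>2 + (Y \<omega>)\<^sup>2 / r)" using sq by auto
    show "AE \<omega> in M. norm (X \<omega> * Y \<omega>) \<le> norm (r * (X \<omega>)\<^sup>2 + (Y \<omega>)\<^sup>2 / r)"
      using order_trans[OF pointwise abs_ge_self] by simp
  qed measurable
  have "(\<integral>\<omega>. \<bar>X \<omega> * Y \<omega>\<bar> \<partial>M) \<le> (\<integral>\<omega>. r * (X \<omega>)\<^sup>2 + (Y \<omega>)\<^sup>2 / r \<partial>M)"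
    using sq int pointwise by (intro integral_mono) auto
  then show "(\<integral>\<omega>. \<bar>X \<omega> * Y \<omega>\<bar> \<partial>M) \<le> r * (\<integral>\<omega>. (X \<omega>)\<^sup>2 \<partial>M) + (\<integral>\<omega>. (Y \<omega>)\<^sup>2 \<partial>M) / r"
    using sq by simp
qed

lemma integrable_square_add:
  fixes X Y :: "'a \<Rightarrow> real"
  assumes "X \<in> borel_measurable M" "Y \<in> borel_measurable M"
    and "integrable M (\<lambda>\<omega>. (X \<omega>)\<^sup>2)" "integrable M (\<lambda>\<omega>. (Y \<omega>)\<^sup>2)"
  shows "integrable M (\<lambda>\<omega>. (X \<omega> + Y \<omega>)\<^sup>2)"
  using integrable_mult_if_square_integrable[OF assms, of 1] assms(3,4)
  by (simp add: power2_sum mult.assoc)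

context prob_space begin

lemma expectation_power2_le:
  fixes X :: "'a \<Rightarrow> real"
  assumes "X \<in> borel_measurable M" "integrable M (\<lambda>\<omega>. (X \<omega>)\<^sup>2)"
  shows "(expectation X)\<^sup>2 \<le> expectation (\<lambda>\<omega>. (X \<omega>)\<^sup>2)"
  using variance_eq[OF square_integrable_imp_integrable[OF assms] assms(2)] variance_positive[of X]
  by simp

lemma conv_in_prob_imp_truncated_L1:
  assumes [measurable]: "\<And>n. X n \<in> borel_measurable M" "Y \<in> borel_measurable M"
    and conv: "conv_in_prob M X Y"
  shows "(\<lambda>n. expectation (\<lambda>\<omega>. min 1 \<bar>X n \<omega> - Y \<omega>\<bar>)) \<longlonglongrightarrow> 0"
proof (rule LIMSEQ_I)
  fix e :: real assume e: "0 < e"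
  define A where "A n = {\<omega> \<in> space M. e/2 < \<bar>X n \<omega> - Y \<omega>\<bar>}" for n
  have [measurable]: "A n \<in> sets M" for n unfolding A_def by measurable
  have "(\<lambda>n. prob (A n)) \<longlonglongrightarrow> 0"
    using conv[unfolded conv_in_prob_def, rule_format, of "e/2"] e unfolding A_def by simp
  then obtain n0 where n0: "\<And>n. n \<ge> n0 \<Longrightarrow> prob (A n) < e/2"
    using LIMSEQ_D[of "\<lambda>n. prob (A n)" 0 "e/2"] e by auto
  have "expectation (\<lambda>\<omega>. min 1 \<bar>X n \<omega> - Y \<omega>\<bar>) < e" if "n \<ge> n0" for n
  proof -
    have "expectation (\<lambda>\<omega>. min 1 \<bar>X n \<omega> - Y \<omega>\<bar>) \<le> expectation (\<lambda>\<omega>. e/2 + indicator (A n) \<omega>)"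
    proof (rule integral_mono)
      show "integrable M (\<lambda>\<omega>. min 1 \<bar>X n \<omega> - Y \<omega>\<bar>)"
        by (rule integrable_const_bound[where B=1]) auto
      show "integrable M (\<lambda>\<omega>. e/2 + indicator (A n) \<omega> :: real)"
        by (intro Bochner_Integration.integrable_add integrable_real_indicator)
          (auto simp: emeasure_eq_measure)
    qed (use e in \<open>auto simp: A_def indicator_def min_def\<close>)
    also have "\<dots> = e/2 + prob (A n)"
      by (subst Bochner_Integration.integral_add)
        (auto simp: prob_space emeasure_eq_measure intro!: integrable_real_indicator)
    also have "\<dots> < e" using n0[OF that] by simp
    finally show ?thesis .
  qed
  then show "\<exists>n0. \<forall>n\<ge>n0. norm (expectation (\<lambda>\<omega>. min 1 \<bar>X n \<omega> - Y \<omega>\<bar>) - 0) < e"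
    by (intro exI[of _ n0] allI impI) (simp add: integral_nonneg_AE)
qed

lemma conv_in_prob_imp_AE_subseq:
  assumes [measurable]: "\<And>n. X n \<in> borel_measurable M" "Y \<in> borel_measurable M"
    and "conv_in_prob M X Y"
  shows "\<exists>r. strict_mono r \<and> (AE \<omega> in M. (\<lambda>n. X (r n) \<omega>) \<longlonglongrightarrow> Y \<omega>)"
proof -
  define u where "u n \<omega> = min 1 \<bar>X n \<omega> - Y \<omega>\<bar>" for n \<omega>
  have "integrable M (u n)" for n
    unfolding u_def by (rule integrable_const_bound[where B=1]) auto
  moreover have "(\<lambda>n. expectation (\<lambda>\<omega>. norm (u n \<omega>))) \<longlonglongrightarrow> 0"
    using conv_in_prob_imp_truncated_L1[OF assms] by (simp add: u_def)
  ultimately obtain r where r: "strict_mono r" "AE \<omega> in M. (\<lambda>n. u (r n) \<omega>) \<longlonglongrightarrow> 0"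
    using tendsto_L1_AE_subseq by blast
  from r(2) have "AE \<omega> in M. (\<lambda>n. X (r n) \<omega>) \<longlonglongrightarrow> Y \<omega>"
  proof eventually_elim
    case (elim \<omega>)
    have "\<forall>\<^sub>F n in sequentially. u (r n) \<omega> < 1" using order_tendstoD(2)[OF elim] by auto
    then have "\<forall>\<^sub>F n in sequentially. u (r n) \<omega> = \<bar>X (r n) \<omega> - Y \<omega>\<bar>"
      by eventually_elim (auto simp: u_def)
    with elim have "(\<lambda>n. \<bar>X (r n) \<omega> - Y \<omega>\<bar>) \<longlonglongrightarrow> 0" by (simp add: tendsto_cong)
    then show ?case using LIM_zero_iff tendsto_rabs_zero_iff by blast
  qed
  with r(1) show ?thesis by auto
qed

end

subsection \<open>Random variables with finite moments\<close>

lemma abs_add_power_le: "\<bar>a + b\<bar> ^ p \<le> 2 ^ p * (\<bar>a\<bar> ^ p + \<bar>b\<bar> ^ p)" for a b :: real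
proof -
  have "\<bar>a + b\<bar> ^ p \<le> (2 * max \<bar>a\<bar> \<bar>b\<bar>) ^ p" by (intro power_mono) auto
  also have "\<dots> \<le> 2 ^ p * (\<bar>a\<bar> ^ p + \<bar>b\<bar> ^ p)" by (auto simp: power_mult_distrib max_def)
  finally show ?thesis .
qed

lemma abs_power_le_one_plus_even_power: "\<bar>x\<bar> ^ p \<le> 1 + x ^ (2 * p)" for x :: real
proof -
  have "\<bar>x\<bar> ^ p \<le> 1 + (\<bar>x\<bar> ^ p)\<^sup>2"
    using sum_squares_bound[of 1 "\<bar>x\<bar> ^ p"] zero_le_power[of "\<bar>x\<bar>" p, OF abs_ge_zero]
    unfolding power_one by linarith
  then show ?thesis by (simp add: power_mult[symmetric] mult.commute power_even_abs)
qed

context prob_space begin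

definition finite_moments :: "('a \<Rightarrow> real) \<Rightarrow> bool" where
  "finite_moments X \<longleftrightarrow> X \<in> borel_measurable M \<and> (\<forall>p::nat. integrable M (\<lambda>\<omega>. \<bar>X \<omega>\<bar> ^ p))"

abbreviation mean_square :: "('a \<Rightarrow> real) \<Rightarrow> real" where
  "mean_square X \<equiv> expectation (\<lambda>\<omega>. (X \<omega>)\<^sup>2)"

lemma finite_moments_measurable: "finite_moments X \<Longrightarrow> X \<in> borel_measurable M"
  by (simp add: finite_moments_def)

lemma finite_moments_integrable:
  assumes "finite_moments X" shows "integrable M X"
proof -
  have "integrable M (\<lambda>\<omega>. \<bar>X \<omega>\<bar> ^ 1)" using assms unfolding finite_moments_def by blast
  then have "integrable M (\<lambda>\<omega>. \<bar>X \<omega>\<bar>)" by simp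
  then show ?thesis by (rule integrable_abs_cancel) (use assms in \<open>simp add: finite_moments_def\<close>)
qed

lemma finite_moments_const: "finite_moments (\<lambda>\<omega>. a)"
  by (auto simp: finite_moments_def)

lemma finite_moments_abs: "finite_moments X \<Longrightarrow> finite_moments (\<lambda>\<omega>. \<bar>X \<omega>\<bar>)"
  by (simp add: finite_moments_def borel_measurable_abs)

lemma finite_moments_mult:
  assumes "finite_moments X" "finite_moments Y" shows "finite_moments (\<lambda>\<omega>. X \<omega> * Y \<omega>)"
  unfolding finite_moments_def
proof (intro conjI allI)
  have [measurable]: "X \<in> borel_measurable M" "Y \<in> borel_measurable M"
    using assms finite_moments_measurable by auto
  show "(\<lambda>\<omega>. X \<omega> * Y \<omega>) \<in> borel_measurable M" by measurable
  fix p :: nat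
  have "integrable M (\<lambda>\<omega>. (\<bar>X \<omega>\<bar> ^ p)\<^sup>2)" "integrable M (\<lambda>\<omega>. (\<bar>Y \<omega>\<bar> ^ p)\<^sup>2)"
    using assms unfolding finite_moments_def power_mult[symmetric] by blast+
  then show "integrable M (\<lambda>\<omega>. \<bar>X \<omega> * Y \<omega>\<bar> ^ p)"
    unfolding abs_mult power_mult_distrib
    by (intro integrable_mult_if_square_integrable[where r=1]) auto
qed

lemma finite_moments_add:
  assumes "finite_moments X" "finite_moments Y" shows "finite_moments (\<lambda>\<omega>. X \<omega> + Y \<omega>)"
  unfolding finite_moments_def
proof (intro conjI allI)
  have [measurable]: "X \<in> borel_measurable M" "Y \<in> borel_measurable M"
    using assms finite_moments_measurable by auto
  show "(\<lambda>\<omega>. X \<omega> + Y \<omega>) \<in> borel_measurable M" by measurable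
  fix p :: nat
  show "integrable M (\<lambda>\<omega>. \<bar>X \<omega> + Y \<omega>\<bar> ^ p)"
  proof (rule Bochner_Integration.integrable_bound)
    show "integrable M (\<lambda>\<omega>. 2 ^ p * (\<bar>X \<omega>\<bar> ^ p + \<bar>Y \<omega>\<bar> ^ p))"
      using assms by (auto simp: finite_moments_def)
  qed (auto simp: abs_add_power_le)
qed

lemma finite_moments_minus: "finite_moments X \<Longrightarrow> finite_moments (\<lambda>\<omega>. - X \<omega>)"
  using finite_moments_mult[OF finite_moments_const[of "-1"], of X] by simp

lemma finite_moments_diff:
  "finite_moments X \<Longrightarrow> finite_moments Y \<Longrightarrow> finite_moments (\<lambda>\<omega>. X \<omega> - Y \<omega>)"
  using finite_moments_add[OF _ finite_moments_minus, of X Y] by simp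

lemma finite_moments_power: "finite_moments X \<Longrightarrow> finite_moments (\<lambda>\<omega>. X \<omega> ^ n)"
  by (induction n) (simp_all add: finite_moments_const finite_moments_mult)

lemma finite_moments_sum:
  "(\<And>i. i \<in> A \<Longrightarrow> finite_moments (X i)) \<Longrightarrow> finite_moments (\<lambda>\<omega>. \<Sum>i\<in>A. X i \<omega>)"
  by (induction A rule: infinite_finite_induct)
    (simp_all add: finite_moments_const finite_moments_add)

lemma finite_moments_sum_list:
  "(\<And>i. i \<in> set is \<Longrightarrow> finite_moments (X i)) \<Longrightarrow> finite_moments (\<lambda>\<omega>. \<Sum>i\<leftarrow>is. X i \<omega>)"
  by (induction "is") (simp_all add: finite_moments_const finite_moments_add)

lemmas finite_moments_intros = finite_moments_const finite_moments_mult finite_moments_add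
  finite_moments_diff finite_moments_power finite_moments_sum

lemma finite_moments_if_even_powers_integrable:
  assumes [measurable]: "X \<in> borel_measurable M" and "\<And>n. integrable M (\<lambda>\<omega>. X \<omega> ^ (2 * n))"
  shows "finite_moments X"
  unfolding finite_moments_def
proof (intro conjI allI)
  fix p :: nat
  show "integrable M (\<lambda>\<omega>. \<bar>X \<omega>\<bar> ^ p)"
  proof (rule Bochner_Integration.integrable_bound)
    show "integrable M (\<lambda>\<omega>. 1 + X \<omega> ^ (2 * p))" using assms by auto
    show "AE \<omega> in M. norm (\<bar>X \<omega>\<bar> ^ p) \<le> norm (1 + X \<omega> ^ (2 * p))"
      using abs_power_le_one_plus_even_power by (auto intro: order_trans)
  qed measurable
qed fact

lemma integrable_if_polynomial_growth:
  fixes f :: "real \<Rightarrow> real"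
  assumes "finite_moments X" and [measurable]: "f \<in> borel_measurable borel"
    and growth: "\<And>x. \<bar>f x\<bar> \<le> C * (1 + \<bar>x\<bar> ^ p)"
  shows "integrable M (\<lambda>\<omega>. f (X \<omega>))"
proof (rule Bochner_Integration.integrable_bound)
  have [measurable]: "X \<in> borel_measurable M" using assms finite_moments_measurable by auto
  show "(\<lambda>\<omega>. f (X \<omega>)) \<in> borel_measurable M" by measurable
  show "integrable M (\<lambda>\<omega>. C * (1 + \<bar>X \<omega>\<bar> ^ p))" using assms(1) by (auto simp: finite_moments_def)
  show "AE \<omega> in M. norm (f (X \<omega>)) \<le> norm (C * (1 + \<bar>X \<omega>\<bar> ^ p))"
    using order_trans[OF growth abs_ge_self] by simp
qed

lemma mean_square_add_le:
  assumes "finite_moments X" "finite_moments Y"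
  shows "mean_square (\<lambda>\<omega>. X \<omega> + Y \<omega>) \<le> 2 * mean_square X + 2 * mean_square Y"
proof -
  have int: "integrable M (\<lambda>\<omega>. (X \<omega>)\<^sup>2)" "integrable M (\<lambda>\<omega>. (Y \<omega>)\<^sup>2)"
    "integrable M (\<lambda>\<omega>. (X \<omega> + Y \<omega>)\<^sup>2)"
    by (intro finite_moments_integrable finite_moments_intros assms)+
  have "(x + y)\<^sup>2 \<le> 2 * x\<^sup>2 + 2 * y\<^sup>2" for x y :: real
    using zero_le_power2[of "x - y"] unfolding power2_diff power2_sum by linarith
  then have "mean_square (\<lambda>\<omega>. X \<omega> + Y \<omega>) \<le> expectation (\<lambda>\<omega>. 2 * (X \<omega>)\<^sup>2 + 2 * (Y \<omega>)\<^sup>2)"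
    using int by (intro integral_mono) auto
  then show ?thesis using int by simp
qed

lemma finite_moments_square_integrable: "finite_moments X \<Longrightarrow> integrable M (\<lambda>\<omega>. (X \<omega>)\<^sup>2)"
  by (intro finite_moments_integrable finite_moments_power)

end

subsection \<open>Linear combinations of words\<close>

definition pairing :: "(nat list \<Rightarrow> real) \<Rightarrow> lc \<Rightarrow> real" where
  "pairing s x = (\<Sum>(r, w)\<leftarrow>x. r * s w)"

lemma pairing_Nil [simp]: "pairing s [] = 0"
  by (simp add: pairing_def)

lemma pairing_Cons [simp]: "pairing s ((r, w) # x) = r * s w + pairing s x"
  by (simp add: pairing_def)

lemma pairing_append [simp]: "pairing s (x @ y) = pairing s x + pairing s y"
  by (simp add: pairing_def)

lemma pairing_concat_map: "pairing s (concat (map f xs)) = (\<Sum>p\<leftarrow>xs. pairing s (f p))"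
  by (induction xs) auto

lemma pairing_map: "pairing s (map (\<lambda>(r, w). (r, g w)) x) = pairing (\<lambda>w. s (g w)) x"
  by (induction x) auto

lemma pairing_lprep: "pairing s (lprep a x) = pairing (\<lambda>w. s (a # w)) x"
  by (simp add: lprep_def pairing_map)

lemma pairing_lscale: "pairing s (lscale c x) = c * pairing s x"
  by (induction x) (auto simp: lscale_def algebra_simps)

lemma pairing_zero: "pairing (\<lambda>w. 0) x = 0"
  by (induction x) auto

lemma pairing_add: "pairing (\<lambda>w. s w + s' w) x = pairing s x + pairing s' x"
  by (induction x) (auto simp: algebra_simps)

lemma pairing_mult_left: "pairing (\<lambda>w. c * s w) x = c * pairing s x"
  by (induction x) (auto simp: algebra_simps)

lemma pairing_mult_right: "pairing (\<lambda>w. s w * c) x = pairing s x * c"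
  by (induction x) (auto simp: algebra_simps)

lemma pairing_divide: "pairing (\<lambda>w. s w / c) x = pairing s x / c"
  by (induction x) (auto simp: add_divide_distrib)

lemma pairing_sum: "pairing (\<lambda>w. \<Sum>b\<in>B. s b w) x = (\<Sum>b\<in>B. pairing (s b) x)"
  by (induction x) (auto simp: sum.distrib sum_distrib_left)

lemmas pairing_linear = pairing_zero pairing_add pairing_mult_left pairing_mult_right
  pairing_divide pairing_sum

lemma emptycoef_eq_pairing: "emptycoef x = pairing (\<lambda>w. of_bool (w = [])) x"
  unfolding emptycoef_def pairing_def by (intro arg_cong[where f=sum_list] map_cong) auto

definition lc_over :: "nat set \<Rightarrow> lc \<Rightarrow> bool" where
  "lc_over A x \<longleftrightarrow> (\<forall>(r, w)\<in>set x. set w \<subseteq> A)"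

lemma lc_over_Nil [simp]: "lc_over A []"
  by (simp add: lc_over_def)

lemma lc_over_Cons [simp]: "lc_over A ((r, w) # x) \<longleftrightarrow> set w \<subseteq> A \<and> lc_over A x"
  by (simp add: lc_over_def)

lemma lc_over_append [simp]: "lc_over A (x @ y) \<longleftrightarrow> lc_over A x \<and> lc_over A y"
  by (auto simp: lc_over_def)

lemma lc_overD: "lc_over A x \<Longrightarrow> (r, w) \<in> set x \<Longrightarrow> a \<in> set w \<Longrightarrow> a \<in> A"
  by (auto simp: lc_over_def)

lemma lc_over_concat_map: "lc_over A (concat (map f xs)) \<longleftrightarrow> (\<forall>p\<in>set xs. lc_over A (f p))"
  by (induction xs) auto

lemma lc_over_lprep: "a \<in> A \<Longrightarrow> lc_over A x \<Longrightarrow> lc_over A (lprep a x)"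
  by (induction x) (auto simp: lprep_def)

lemma lc_over_lscale: "lc_over A x \<Longrightarrow> lc_over A (lscale c x)"
  by (auto simp: lc_over_def lscale_def)

lemma lc_over_rstar:
  "0 \<in> A \<Longrightarrow> set u \<subseteq> A \<Longrightarrow> set v \<subseteq> A \<Longrightarrow> lc_over A (rstar u v)"
  by (induction u v rule: rstar.induct) (auto intro!: lc_over_lprep)

lemma lc_over_wstar:
  "0 \<in> A \<Longrightarrow> set u \<subseteq> A \<Longrightarrow> set v \<subseteq> A \<Longrightarrow> lc_over A (wstar u v)"
  using lc_over_rstar[of A "rev u" "rev v"] by (force simp: lc_over_def wstar_def)

lemma lc_over_lstar:
  assumes "0 \<in> A" "lc_over A x" "lc_over A y" shows "lc_over A (lstar x y)"
  using assms unfolding lstar_def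
  by (auto simp: lc_over_concat_map intro!: lc_over_lscale lc_over_wstar dest: lc_overD)

lemma lc_over_G0: "lc_over A x \<Longrightarrow> lc_over A (G0 x)"
  unfolding G0_def by (auto simp: lc_over_concat_map dest!: in_set_butlastD dest: lc_overD)

lemma pairing_cong:
  assumes "lc_over A x" "\<And>w. set w \<subseteq> A \<Longrightarrow> s w = s' w"
  shows "pairing s x = pairing s' x"
  using assms by (induction x) auto

lemma tendsto_pairing:
  assumes "lc_over A x" "\<And>w. set w \<subseteq> A \<Longrightarrow> ((\<lambda>n. s n w) \<longlongrightarrow> s' w) F"
  shows "((\<lambda>n. pairing (s n) x) \<longlongrightarrow> pairing s' x) F"
  using assms by (induction x) (auto intro!: tendsto_intros)

lemma set_words_subset: "I \<in> set (words d L) \<Longrightarrow> set I \<subseteq> {0..d}"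
  by (auto simp: words_def set_n_lists)

lemma letter_of_words_le: "I \<in> set (words d L) \<Longrightarrow> a \<in> set I \<Longrightarrow> a \<le> d"
  using set_words_subset by fastforce

lemma words_eq_Nil_Cons:
  "words d L = [] # concat (map (\<lambda>k. List.n_lists k [0..<Suc d]) [1..<Suc L])"
  unfolding words_def upt_conv_Cons[of 0 "Suc L", OF zero_less_Suc] by simp

subsection \<open>Characters of the star algebra\<close>

definition letter_deriv :: "nat \<Rightarrow> (nat list \<Rightarrow> real) \<Rightarrow> nat list \<Rightarrow> real" where
  "letter_deriv a s w = (if w \<noteq> [] \<and> last w = a then s (butlast w) else 0)"

lemma letter_deriv_Nil [simp]: "letter_deriv a s [] = 0"
  by (simp add: letter_deriv_def)

lemma letter_deriv_snoc [simp]: "letter_deriv a s (w @ [b]) = (if b = a then s w else 0)"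
  by (simp add: letter_deriv_def)

lemma pairing_G0: "pairing s (G0 x) = pairing (letter_deriv 0 s) x"
  unfolding G0_def by (induction x) (auto simp: letter_deriv_def)

lemma sum_letter_deriv_mult:
  assumes "set u \<subseteq> {0..d}"
  shows "(\<Sum>b\<in>{1..d}. letter_deriv b s u * letter_deriv b s v) =
    (if u \<noteq> [] \<and> v \<noteq> [] \<and> rho (last u) (last v) then s (butlast u) * s (butlast v) else 0)"
proof (cases "u \<noteq> [] \<and> 0 < last u")
  case True
  then have "last u \<in> {1..d}" using assms last_in_set[of u] by fastforce
  moreover have "(\<Sum>b\<in>{1..d}. letter_deriv b s u * letter_deriv b s v) =
      (\<Sum>b\<in>{1..d}. if b = last u then s (butlast u) * letter_deriv b s v else 0)"
    using True by (intro sum.cong) (auto simp: letter_deriv_def)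
  ultimately show ?thesis using True by (auto simp: rho_def letter_deriv_def)
next
  case False
  then have "(\<Sum>b\<in>{1..d}. letter_deriv b s u * letter_deriv b s v) = 0"
    by (intro sum.neutral) (auto simp: letter_deriv_def)
  then show ?thesis using False by (auto simp: rho_def)
qed

lemma rstar_Nil_right [simp]: "rstar u [] = [(1, u)]"
  by (cases u) auto

lemma wstar_Nil [simp]: "wstar [] v = [(1, v)]" "wstar u [] = [(1, u)]"
  by (simp_all add: wstar_def)

lemma pairing_letter_deriv_wstar_snoc:
  "pairing (letter_deriv a s) (wstar (u @ [i]) (v @ [j])) =
    (if i = a then pairing s (wstar u (v @ [j])) else 0)
    + (if j = a then pairing s (wstar (u @ [i]) v) else 0)
    + (if rho i j \<and> a = 0 then pairing s (wstar u v) else 0)"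
  by (auto simp: wstar_def pairing_map pairing_lprep pairing_zero)

definition star_character :: "nat \<Rightarrow> (nat list \<Rightarrow> real) \<Rightarrow> bool" where
  "star_character d s \<longleftrightarrow> s [] = 1 \<and>
     (\<forall>u v. set u \<subseteq> {0..d} \<longrightarrow> set v \<subseteq> {0..d} \<longrightarrow> pairing s (wstar u v) = s u * s v)"

lemma star_character_Nil: "star_character d s \<Longrightarrow> s [] = 1"
  by (simp add: star_character_def)

lemma star_character_wstar:
  "star_character d s \<Longrightarrow> set u \<subseteq> {0..d} \<Longrightarrow> set v \<subseteq> {0..d} \<Longrightarrow> pairing s (wstar u v) = s u * s v"
  by (simp add: star_character_def)

lemma star_character_emptycoef: "star_character d (\<lambda>w. of_bool (w = []))"
proof -
  have "pairing (\<lambda>w. of_bool (w = [])) (wstar u v) = of_bool (u = []) * of_bool (v = [])" for u v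
  proof (cases "u = [] \<or> v = []")
    case False
    then obtain i I j J where "rev u = i # I" "rev v = j # J"
      by (metis list.exhaust rev_is_Nil_conv)
    then show ?thesis using False by (simp add: wstar_def pairing_map pairing_lprep pairing_zero)
  qed auto
  then show ?thesis by (simp add: star_character_def)
qed

lemma pairing_lstar:
  "pairing s (lstar x y) = pairing (\<lambda>u. pairing (\<lambda>v. pairing s (wstar u v)) y) x"
proof -
  have "pairing s (lscale (a * b) (wstar u v)) = a * (b * pairing s (wstar u v))" for a b u v
    by (simp add: pairing_lscale)
  then show ?thesis
    by (simp add: lstar_def pairing_concat_map case_prod_unfold pairing_def[of _ x]
        pairing_def[of _ y] sum_list_const_mult)
qed

lemma pairing_lstar_character:
  assumes "star_character d s" "lc_over {0..d} x" "lc_over {0..d} y"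
  shows "pairing s (lstar x y) = pairing s x * pairing s y"
proof -
  have "pairing s (lstar x y) = pairing (\<lambda>u. pairing (\<lambda>v. s u * s v) y) x"
    unfolding pairing_lstar using assms
    by (intro pairing_cong[where A="{0..d}"] star_character_wstar) auto
  then show ?thesis by (simp add: pairing_linear)
qed

lemma pairing_letter_deriv_wstar:
  assumes s: "star_character d s" and u: "set u \<subseteq> {0..d}" and v: "set v \<subseteq> {0..d}"
  shows "pairing (letter_deriv a s) (wstar u v) =
      letter_deriv a s u * s v + s u * letter_deriv a s v
    + of_bool (a = 0) * (\<Sum>b\<in>{1..d}. letter_deriv b s u * letter_deriv b s v)"
proof (cases "u = [] \<or> v = []")
  case True
  then show ?thesis using star_character_Nil[OF s] by auto
next
  case False
  then obtain u' i v' j where uv: "u = u' @ [i]" "v = v' @ [j]" by (metis rev_exhaust)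
  then have over: "set u' \<subseteq> {0..d}" "set v' \<subseteq> {0..d}" "set (u' @ [i]) \<subseteq> {0..d}"
      "set (v' @ [j]) \<subseteq> {0..d}"
    using u v by auto
  show ?thesis
    unfolding uv sum_letter_deriv_mult[OF over(3)] pairing_letter_deriv_wstar_snoc
    using over by (auto simp: star_character_wstar[OF s])
qed

lemma pairing_letter_deriv_lstar:
  assumes s: "star_character d s" and x: "lc_over {0..d} x" and y: "lc_over {0..d} y"
  shows "pairing (letter_deriv a s) (lstar x y) =
    pairing (letter_deriv a s) x * pairing s y + pairing s x * pairing (letter_deriv a s) y
    + of_bool (a = 0) * (\<Sum>b\<in>{1..d}. pairing (letter_deriv b s) x * pairing (letter_deriv b s) y)"
proof -
  have "pairing (letter_deriv a s) (lstar x y) = pairing (\<lambda>u. pairing (\<lambda>v.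
      letter_deriv a s u * s v + s u * letter_deriv a s v
      + of_bool (a = 0) * (\<Sum>b\<in>{1..d}. letter_deriv b s u * letter_deriv b s v)) y) x"
    unfolding pairing_lstar using x y
    by (intro pairing_cong[where A="{0..d}"] pairing_letter_deriv_wstar[OF s]) auto
  then show ?thesis by (simp add: pairing_linear)
qed

subsection \<open>Ito's formula for star powers\<close>

definition star_power_mult :: "lc \<Rightarrow> nat \<Rightarrow> lc \<Rightarrow> lc" where
  "star_power_mult y m x = (lstar y ^^ m) x"

lemma star_power_mult_0 [simp]: "star_power_mult y 0 x = x"
  by (simp add: star_power_mult_def)

lemma star_power_mult_Suc: "star_power_mult y (Suc m) x = lstar y (star_power_mult y m x)"
  by (simp add: star_power_mult_def)

lemma lc_over_star_power_mult:
  "0 \<in> A \<Longrightarrow> lc_over A y \<Longrightarrow> lc_over A x \<Longrightarrow> lc_over A (star_power_mult y m x)"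
  by (induction m) (auto simp: star_power_mult_Suc intro: lc_over_lstar)

context
  fixes d :: nat and s :: "nat list \<Rightarrow> real" and x y :: lc
  assumes s: "star_character d s" and x: "lc_over {0..d} x" and y: "lc_over {0..d} y"
begin

lemma pairing_star_power_mult: "pairing s (star_power_mult y m x) = pairing s y ^ m * pairing s x"
  by (induction m)
    (simp_all add: star_power_mult_Suc pairing_lstar_character[OF s y
        lc_over_star_power_mult[OF _ y x]])

lemma pairing_letter_deriv_star_power_mult:
  assumes "a \<noteq> 0"
  shows "pairing (letter_deriv a s) (star_power_mult y m x) =
    real m * pairing s y ^ (m - 1) * pairing (letter_deriv a s) y * pairing s x
    + pairing s y ^ m * pairing (letter_deriv a s) x"
proof (induction m)
  case (Suc m)
  have "pairing (letter_deriv a s) (star_power_mult y (Suc m) x) =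
      pairing (letter_deriv a s) y * (pairing s y ^ m * pairing s x)
      + pairing s y * pairing (letter_deriv a s) (star_power_mult y m x)"
    using assms
    by (simp add: star_power_mult_Suc pairing_letter_deriv_lstar[OF s y
        lc_over_star_power_mult[OF _ y x]] pairing_star_power_mult)
  then show ?case unfolding Suc.IH by (cases m) (simp_all add: algebra_simps)
qed simp

lemma pairing_G0_star_power_mult:
  "pairing s (G0 (star_power_mult y m x)) =
    pairing s y ^ m * pairing s (G0 x)
    + real m * pairing s y ^ (m - 1) * (pairing (letter_deriv 0 s) y * pairing s x
        + (\<Sum>b\<in>{1..d}. pairing (letter_deriv b s) y * pairing (letter_deriv b s) x))
    + real m * real (m - 1) * pairing s y ^ (m - 2)
        * ((\<Sum>b\<in>{1..d}. (pairing (letter_deriv b s) y)\<^sup>2) / 2 * pairing s x)"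
  unfolding pairing_G0
proof (induction m)
  case (Suc m)
  let ?D = "\<lambda>a. pairing (letter_deriv a s)" and ?q = "pairing s y"
  let ?first = "?D 0 y * pairing s x + (\<Sum>b\<in>{1..d}. ?D b y * ?D b x)"
  let ?second = "(\<Sum>b\<in>{1..d}. (?D b y)\<^sup>2) / 2 * pairing s x"
  have "(\<Sum>b\<in>{1..d}. ?D b y * ?D b (star_power_mult y m x)) =
      (\<Sum>b\<in>{1..d}. real m * ?q ^ (m - 1) * pairing s x * (?D b y)\<^sup>2 + ?q ^ m * (?D b y * ?D b x))"
    by (intro sum.cong)
        (auto simp: pairing_letter_deriv_star_power_mult power2_eq_square algebra_simps)
  then have bracket: "(\<Sum>b\<in>{1..d}. ?D b y * ?D b (star_power_mult y m x)) =
      2 * real m * ?q ^ (m - 1) * ?second + ?q ^ m * (?first - ?D 0 y * pairing s x)"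
    by (simp add: sum.distrib sum_distrib_left[symmetric])
  have "?D 0 (star_power_mult y (Suc m) x) =
      ?D 0 y * (?q ^ m * pairing s x) + ?q * ?D 0 (star_power_mult y m x)
      + (\<Sum>b\<in>{1..d}. ?D b y * ?D b (star_power_mult y m x))"
    by (simp add: star_power_mult_Suc pairing_letter_deriv_lstar[OF s y
        lc_over_star_power_mult[OF _ y x]] pairing_star_power_mult)
  also have "\<dots> = ?q * ?D 0 (star_power_mult y m x) + 2 * real m * ?q ^ (m - 1) * ?second
      + ?q ^ m * ?first"
    unfolding bracket by (simp add: algebra_simps)
  also have "\<dots> = ?q ^ Suc m * ?D 0 x + real (Suc m) * ?q ^ (Suc m - 1) * ?first
      + real (Suc m) * real (Suc m - 1) * ?q ^ (Suc m - 2) * ?second"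
  proof (cases m)
    case (Suc k)
    then show ?thesis unfolding Suc.IH by (cases k) (simp_all add: algebra_simps)
  qed (simp add: Suc.IH)
  finally show ?case .
qed simp

end

subsection \<open>The operators of the expansion\<close>

definition coeff_lc :: "nat \<Rightarrow> nat \<Rightarrow> (nat list \<Rightarrow> real) \<Rightarrow> lc" where
  "coeff_lc d L cf = map (\<lambda>I. (cf I, I)) (words d L)"

definition centred_lc :: "nat \<Rightarrow> nat \<Rightarrow> (nat list \<Rightarrow> real) \<Rightarrow> lc" where
  "centred_lc d L cf = (- cf [], []) # coeff_lc d L cf"

lemma pairing_coeff_lc: "pairing s (coeff_lc d L cf) = (\<Sum>I\<leftarrow>words d L. cf I * s I)"
  by (simp add: coeff_lc_def pairing_def comp_def)

lemma pairing_centred_lc: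
  "pairing s (centred_lc d L cf) = pairing s (coeff_lc d L cf) - cf [] * s []"
  by (simp add: centred_lc_def)

lemma lc_over_coeff_lc: "lc_over {0..d} (coeff_lc d L cf)"
  using set_words_subset by (auto simp: lc_over_def coeff_lc_def)

lemma lc_over_centred_lc: "lc_over {0..d} (centred_lc d L cf)"
  by (simp add: centred_lc_def lc_over_coeff_lc)

lemma emptycoef_centred_lc: "emptycoef (centred_lc d L cf) = 0"
proof -
  have "I \<noteq> []" if "I \<in> set (concat (map (\<lambda>k. List.n_lists k [0..<Suc d]) [1..<Suc L]))" for I
    using that by (auto dest!: length_n_lists_elem)
  then have "(\<Sum>I\<leftarrow>words d L. cf I * of_bool (I = [])) = cf []"
    by (auto simp: words_eq_Nil_Cons simp del: upt_Suc
        intro!: sum_list_nonpos antisym sum_list_nonneg)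
  then show ?thesis by (simp add: emptycoef_eq_pairing pairing_centred_lc pairing_coeff_lc)
qed

lemma set_butlast_subset: "set w \<subseteq> A \<Longrightarrow> set (butlast w) \<subseteq> A"
  by (auto dest: in_set_butlastD)

lemma lc_over_G1:
  assumes "lc_over {0..d} x" shows "lc_over {0..d} (G1 d L cf x)"
proof -
  have "a \<le> d" if "(r, h) \<in> set x" "a \<in> set h" for r h a
    using lc_overD[OF assms that] by simp
  then show ?thesis
    unfolding G1_def using letter_of_words_le
    by (fastforce simp: lc_over_concat_map intro!: lc_over_lstar dest!: in_set_butlastD)
qed

lemma lc_over_G2:
  assumes "lc_over {0..d} x" shows "lc_over {0..d} (G2 d L cf x)"
proof -
  have "a \<le> d" if "(r, h) \<in> set x" "a \<in> set h" for r h a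
    using lc_overD[OF assms that] by simp
  then show ?thesis
    unfolding G2_def using letter_of_words_le
    by (fastforce simp: lc_over_concat_map intro!: lc_over_lstar dest!: in_set_butlastD)
qed

lemma sum_list_map_cong: "(\<And>i. i \<in> set is \<Longrightarrow> f i = g i) \<Longrightarrow> (\<Sum>i\<leftarrow>is. f i) = (\<Sum>i\<leftarrow>is. g i)"
  by (simp cong: map_cong)

lemma pairing_G1:
  assumes s: "star_character d s" and x: "lc_over {0..d} x"
  shows "pairing s (G1 d L cf x) =
    pairing (letter_deriv 0 s) (centred_lc d L cf) * pairing s x
    + (\<Sum>b\<in>{1..d}. pairing (letter_deriv b s) (centred_lc d L cf) * pairing (letter_deriv b s) x)"
proof -
  define summand where "summand r h I = (if I = [] then [] else lstar [(cf I * r, butlast I)]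
      ((if last I = 0 then [(1, h)] else [])
       @ (if h \<noteq> [] \<and> rho (last I) (last h) then [(1, butlast h)] else [])))" for r h I
  have summand: "pairing s (summand r h I) = r * (cf I * (letter_deriv 0 s I * s h
      + (\<Sum>b\<in>{1..d}. letter_deriv b s I * letter_deriv b s h)))"
    if I: "set I \<subseteq> {0..d}" and h: "set h \<subseteq> {0..d}" for r h I
  proof (cases "I = []")
    case False
    have "pairing s (summand r h I) = cf I * r * s (butlast I)
        * (of_bool (last I = 0) * s h + of_bool (h \<noteq> [] \<and> rho (last I) (last h)) * s (butlast h))"
      using False h set_butlast_subset[OF I] set_butlast_subset[OF h]
      by (simp add: summand_def pairing_lstar_character[OF s])
    then show ?thesis
      unfolding sum_letter_deriv_mult[OF I] using False
      by (auto simp: letter_deriv_def algebra_simps)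
  qed (simp add: summand_def)
  have "pairing s (G1 d L cf x) = (\<Sum>p\<leftarrow>x. \<Sum>I\<leftarrow>words d L. pairing s (summand (fst p) (snd p) I))"
    unfolding G1_def pairing_concat_map summand_def[symmetric]
    by (simp add: case_prod_unfold pairing_concat_map)
  also have "\<dots> = (\<Sum>p\<leftarrow>x. fst p * (\<Sum>I\<leftarrow>words d L. cf I * (letter_deriv 0 s I * s (snd p)
      + (\<Sum>b\<in>{1..d}. letter_deriv b s I * letter_deriv b s (snd p)))))"
  proof (rule sum_list_map_cong)
    fix p assume "p \<in> set x"
    then have "set (snd p) \<subseteq> {0..d}" using x unfolding lc_over_def case_prod_unfold by blast
    then show "(\<Sum>I\<leftarrow>words d L. pairing s (summand (fst p) (snd p) I)) =
        fst p * (\<Sum>I\<leftarrow>words d L. cf I * (letter_deriv 0 s I * s (snd p)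
          + (\<Sum>b\<in>{1..d}. letter_deriv b s I * letter_deriv b s (snd p))))"
      unfolding sum_list_const_mult[symmetric]
      by (intro sum_list_map_cong summand[OF set_words_subset])
  qed
  also have "\<dots> = pairing (\<lambda>h. pairing (\<lambda>I. letter_deriv 0 s I * s h
      + (\<Sum>b\<in>{1..d}. letter_deriv b s I * letter_deriv b s h)) (coeff_lc d L cf)) x"
    by (simp add: pairing_coeff_lc pairing_def[of _ x] case_prod_unfold)
  finally show ?thesis by (simp add: pairing_linear pairing_centred_lc)
qed

lemma pairing_G2:
  assumes s: "star_character d s" and x: "lc_over {0..d} x"
  shows "pairing s (G2 d L cf x) =
    (\<Sum>b\<in>{1..d}. (pairing (letter_deriv b s) (centred_lc d L cf))\<^sup>2) / 2 * pairing s x"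
proof -
  define summand where "summand r h I J = (if I \<noteq> [] \<and> J \<noteq> [] \<and> rho (last I) (last J)
      then lstar (lstar [(cf I * cf J * r / 2, butlast I)] [(1, butlast J)]) [(1, h)]
      else [])" for r h I J
  have summand: "pairing s (summand r h I J) =
      r * (cf I * (cf J * ((\<Sum>b\<in>{1..d}. letter_deriv b s I * letter_deriv b s J) * (s h / 2))))"
    if "set I \<subseteq> {0..d}" "set J \<subseteq> {0..d}" "set h \<subseteq> {0..d}" for r h I J
    using that set_butlast_subset[OF that(1)] set_butlast_subset[OF that(2)]
    unfolding sum_letter_deriv_mult[OF that(1)]
    by (simp add: summand_def pairing_lstar_character[OF s] lc_over_lstar)
  have "pairing s (G2 d L cf x) =
      (\<Sum>p\<leftarrow>x. \<Sum>I\<leftarrow>words d L. \<Sum>J\<leftarrow>words d L. pairing s (summand (fst p) (snd p) I J))"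
    unfolding G2_def pairing_concat_map summand_def[symmetric]
    by (simp add: case_prod_unfold pairing_concat_map)
  also have "\<dots> = (\<Sum>p\<leftarrow>x. fst p * (\<Sum>I\<leftarrow>words d L. cf I * (\<Sum>J\<leftarrow>words d L. cf J *
      ((\<Sum>b\<in>{1..d}. letter_deriv b s I * letter_deriv b s J) * (s (snd p) / 2)))))"
  proof (rule sum_list_map_cong)
    fix p assume "p \<in> set x"
    then have "set (snd p) \<subseteq> {0..d}" using x unfolding lc_over_def case_prod_unfold by blast
    then show "(\<Sum>I\<leftarrow>words d L. \<Sum>J\<leftarrow>words d L. pairing s (summand (fst p) (snd p) I J)) =
        fst p * (\<Sum>I\<leftarrow>words d L. cf I * (\<Sum>J\<leftarrow>words d L. cf J *
          ((\<Sum>b\<in>{1..d}. letter_deriv b s I * letter_deriv b s J) * (s (snd p) / 2))))"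
      unfolding sum_list_const_mult[symmetric]
      by (intro sum_list_map_cong summand[OF set_words_subset set_words_subset])
  qed
  also have "\<dots> = pairing (\<lambda>h. pairing (\<lambda>I. pairing (\<lambda>J.
      (\<Sum>b\<in>{1..d}. letter_deriv b s I * letter_deriv b s J) * (s h / 2))
        (coeff_lc d L cf)) (coeff_lc d L cf)) x"
    by (simp add: pairing_coeff_lc pairing_def[of _ x] case_prod_unfold)
  also have "\<dots> = (\<Sum>b\<in>{1..d}. (pairing (letter_deriv b s) (coeff_lc d L cf))\<^sup>2) * (pairing s x / 2)"
    by (simp add: pairing_linear power2_eq_square)
  finally show ?thesis by (simp add: pairing_centred_lc)
qed

lemma pairing_G0_star_power_mult_centred_lc:
  assumes s: "star_character d s" and x: "lc_over {0..d} x"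
  shows "pairing s (G0 (star_power_mult (centred_lc d L cf) m x)) =
    pairing s (centred_lc d L cf) ^ m * pairing s (G0 x)
    + real m * pairing s (centred_lc d L cf) ^ (m - 1) * pairing s (G1 d L cf x)
    + real m * real (m - 1) * pairing s (centred_lc d L cf) ^ (m - 2) * pairing s (G2 d L cf x)"
  unfolding pairing_G0_star_power_mult[OF s x lc_over_centred_lc] pairing_G1[OF s x]
      pairing_G2[OF s x] ..

subsection \<open>The polynomial of a linear combination in the time letter\<close>

definition mean_poly :: "lc \<Rightarrow> real poly" where
  "mean_poly x = (\<Sum>(r, w)\<leftarrow>x. if set w \<subseteq> {0} then monom (r / fact (length w)) (length w) else 0)"

lemma mean_poly_Nil [simp]: "mean_poly [] = 0"
  by (simp add: mean_poly_def)

lemma mean_poly_Cons: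
  "mean_poly ((r, w) # x) = (if set w \<subseteq> {0} then monom (r / fact (length w)) (length w) else 0)
      + mean_poly x"
  by (simp add: mean_poly_def)

lemma mean_poly_append: "mean_poly (x @ y) = mean_poly x + mean_poly y"
  by (simp add: mean_poly_def)

lemma mean_poly_lscale: "mean_poly (lscale c x) = Polynomial.smult c (mean_poly x)"
  by (induction x) (auto simp: lscale_def mean_poly_Cons smult_add_right smult_monom)

lemma poly_mean_poly:
  "poly (mean_poly x) t = pairing (\<lambda>w. if set w \<subseteq> {0} then t ^ length w / fact (length w) else 0) x"
  by (induction x) (auto simp: mean_poly_Cons poly_monom)

lemma poly_mean_poly_0: "poly (mean_poly x) 0 = emptycoef x"
  unfolding poly_mean_poly emptycoef_eq_pairing
  by (rule pairing_cong[where A=UNIV]) (auto simp: lc_over_def power_0_left)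

lemma pderiv_mean_poly: "pderiv (mean_poly x) = mean_poly (G0 x)"
proof (induction x)
  case Nil
  show ?case by (simp add: G0_def)
next
  case (Cons p x)
  obtain r w where p: "p = (r, w)" by (cases p)
  have "pderiv (mean_poly [(r, w)]) = mean_poly (G0 [(r, w)])"
  proof (cases w rule: rev_exhaust)
    case (snoc v b)
    have "real (Suc n) * (r / fact (Suc n)) = r / fact n" for n by (simp add: divide_simps)
    then show ?thesis using snoc
      by (auto simp: mean_poly_Cons G0_def pderiv_monom simp del: fact_Suc of_nat_Suc)
  qed (simp add: mean_poly_Cons G0_def pderiv_monom)
  then show ?case using Cons by (simp add: p mean_poly_Cons pderiv_add G0_def mean_poly_append)
qed

subsection \<open>Brownian increments\<close>

locale brownian_motion = prob_space M
  for M :: "'a measure" +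
  fixes F :: "real \<Rightarrow> 'a measure" and d :: nat and W :: "nat \<Rightarrow> real \<Rightarrow> 'a \<Rightarrow> real"
  assumes filtration: "is_filtration M F" and brownian: "is_std_BM M F d W"
begin

lemma space_F: "space (F s) = space M"
  using filtration by (auto simp: is_filtration_def subalgebra_def)

lemma sets_F_subset: "sets (F s) \<subseteq> events"
  using filtration by (auto simp: is_filtration_def subalgebra_def)

lemma sets_F_mono: "s \<le> t \<Longrightarrow> sets (F s) \<subseteq> sets (F t)"
  using filtration by (simp add: is_filtration_def)

lemma measurable_F: "X \<in> measurable (F s) N \<Longrightarrow> X \<in> measurable M N"
  using filtration by (auto simp: is_filtration_def intro: measurable_from_subalg)

lemma measurable_F_mono: "X \<in> measurable (F s) N \<Longrightarrow> s \<le> t \<Longrightarrow> X \<in> measurable (F t) N"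
  using sets_F_mono[of s t] unfolding measurable_def space_F by blast

definition increment :: "nat \<Rightarrow> real \<Rightarrow> real \<Rightarrow> 'a \<Rightarrow> real" where
  "increment a s t \<omega> = hatW W a t \<omega> - hatW W a s \<omega>"

lemma increment_time: "increment 0 s t \<omega> = t - s"
  by (simp add: increment_def hatW_def)

lemma increment_measurable:
  assumes "a \<le> d" "0 \<le> s" "s \<le> t" shows "increment a s t \<in> borel_measurable (F t)"
proof (cases "a = 0")
  case True
  then have "increment a s t = (\<lambda>\<omega>. t - s)" by (simp add: fun_eq_iff increment_time)
  then show ?thesis by simp
next
  case False
  then have "W a u \<in> borel_measurable (F u)" if "0 \<le> u" for u
    using brownian assms(1) that unfolding is_std_BM_def by simp
  then have "W a s \<in> borel_measurable (F t)" "W a t \<in> borel_measurable (F t)"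
    using assms measurable_F_mono[of "W a s" s borel t] by auto
  moreover have "increment a s t = (\<lambda>\<omega>. W a t \<omega> - W a s \<omega>)"
    using False by (simp add: fun_eq_iff increment_def hatW_def)
  ultimately show ?thesis by simp
qed

abbreviation increment_law :: "real \<Rightarrow> real measure" where
  "increment_law h \<equiv> density lborel (normal_density 0 (sqrt h))"

lemma prob_space_increment_law: "0 < h \<Longrightarrow> prob_space (increment_law h)"
  by (rule prob_space_normal_density) simp

lemma prob_Int_increments:
  assumes "0 \<le> s" "s < t" "A \<in> sets (F s)" "\<And>i. i \<in> {1..d} \<Longrightarrow> B i \<in> sets borel"
  shows "prob (A \<inter> {\<omega>\<in>space M. \<forall>i\<in>{1..d}. increment i s t \<omega> \<in> B i}) =
    prob A * (\<Prod>i=1..d. measure (increment_law (t - s)) (B i))"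
proof -
  define C where "C i = (if i \<in> {1..d} then B i else UNIV)" for i
  have C: "C i \<in> sets borel" for i using assms(4) by (simp add: C_def)
  have "prob (A \<inter> {\<omega>\<in>space M. \<forall>i\<in>{1..d}. W i t \<omega> - W i s \<omega> \<in> C i}) =
      prob A * (\<Prod>i=1..d. measure (increment_law (t - s)) (C i))"
    using brownian assms(1-3) C unfolding is_std_BM_def by blast
  moreover have "{\<omega>\<in>space M. \<forall>i\<in>{1..d}. W i t \<omega> - W i s \<omega> \<in> C i} =
      {\<omega>\<in>space M. \<forall>i\<in>{1..d}. increment i s t \<omega> \<in> B i}"
    by (auto simp: C_def increment_def hatW_def)
  ultimately show ?thesis by (simp add: C_def)
qed

lemma prob_increment:
  assumes "0 \<le> s" "s < t" "i \<in> {1..d}" "B \<in> sets borel"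
  shows "prob {\<omega>\<in>space M. increment i s t \<omega> \<in> B} = measure (increment_law (t - s)) B"
proof -
  interpret law: prob_space "increment_law (t - s)"
    using assms by (intro prob_space_increment_law) simp
  define C where "C j = (if j = i then B else UNIV)" for j
  have "{\<omega>\<in>space M. increment i s t \<omega> \<in> B} =
      space M \<inter> {\<omega>\<in>space M. \<forall>j\<in>{1..d}. increment j s t \<omega> \<in> C j}"
    using assms(3) by (auto simp: C_def)
  also have "prob \<dots> = prob (space M) * (\<Prod>j=1..d. measure (increment_law (t - s)) (C j))"
    using sets.top[of "F s"] assms(4)
    by (intro prob_Int_increments[OF assms(1,2)]) (auto simp: C_def space_F)
  also have "\<dots> = (\<Prod>j=1..d. measure (increment_law (t - s)) (C j))"
    by (simp add: prob_space)
  also have "\<dots> = (\<Prod>j=1..d. if j = i then measure (increment_law (t - s)) B else 1)"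
    using law.prob_space by (intro prod.cong) (auto simp: C_def)
  also have "\<dots> = measure (increment_law (t - s)) B"
    using assms(3) by (subst prod.delta) auto
  finally show ?thesis .
qed

lemma distr_increment:
  assumes "0 \<le> s" "s < t" "i \<in> {1..d}"
  shows "distr M borel (increment i s t) = increment_law (t - s)"
proof (rule measure_eqI)
  interpret law: prob_space "increment_law (t - s)"
    using assms by (intro prob_space_increment_law) simp
  have [measurable]: "increment i s t \<in> borel_measurable M"
    using increment_measurable[of i s t] assms measurable_F by auto
  fix B assume "B \<in> sets (distr M borel (increment i s t))"
  then have B: "B \<in> sets borel" by simp
  then show "emeasure (distr M borel (increment i s t)) B = emeasure (increment_law (t - s)) B"
    using prob_increment[OF assms B]
    by (simp add: emeasure_distr emeasure_eq_measure law.emeasure_eq_measure vimage_def Int_def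
        conj_commute)
qed simp

text \<open>The letter \<open>0\<close> serves as the index of the random variable from the past.\<close>

lemma indep_vars_past_increments:
  assumes "0 \<le> s" "s < t" and Z: "Z \<in> borel_measurable (F s)"
  shows "indep_vars (\<lambda>_. borel) (\<lambda>i. if i = 0 then Z else increment i s t) {0..d}"
proof -
  define X where "X = (\<lambda>i. if i = 0 then Z else increment i s t)"
  have "X i \<in> borel_measurable M" if "i \<in> {0..d}" for i
    using that measurable_F[OF Z] measurable_F[OF increment_measurable, of i s t] assms(1,2)
    by (auto simp: X_def)
  moreover have "prob (\<Inter>i\<in>{0..d}. X i -` A i \<inter> space M) = (\<Prod>i\<in>{0..d}. prob (X i -` A i \<inter> space M))"
    if A: "A \<in> (\<Pi> i\<in>{0..d}. sets borel)" for A
  proof -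
    have inc: "X i -` A i \<inter> space M = {\<omega>\<in>space M. increment i s t \<omega> \<in> A i}" if "i \<in> {1..d}" for i
      using that by (auto simp: X_def)
    have past: "X 0 -` A 0 \<inter> space M \<in> sets (F s)"
      using measurable_sets[OF Z Pi_mem[OF A, of 0]] by (simp add: X_def space_F)
    have "(\<Inter>i\<in>{0..d}. X i -` A i \<inter> space M) =
        (X 0 -` A 0 \<inter> space M) \<inter> {\<omega>\<in>space M. \<forall>i\<in>{1..d}. increment i s t \<omega> \<in> A i}"
    proof -
      have "{0..d} = insert 0 {1..d}" by auto
      then show ?thesis using inc by auto
    qed
    also have "prob \<dots> =
        prob (X 0 -` A 0 \<inter> space M) * (\<Prod>i=1..d. measure (increment_law (t - s)) (A i))"
      by (intro prob_Int_increments[OF assms(1,2) past] Pi_mem[OF A]) auto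
    also have "(\<Prod>i=1..d. measure (increment_law (t - s)) (A i)) =
        (\<Prod>i=1..d. prob (X i -` A i \<inter> space M))"
    proof (intro prod.cong refl)
      fix i assume i: "i \<in> {1..d}"
      then show "measure (increment_law (t - s)) (A i) = prob (X i -` A i \<inter> space M)"
        using prob_increment[OF assms(1,2) i, of "A i"] Pi_mem[OF A, of i] by (simp add: inc)
    qed
    also have "prob (X 0 -` A 0 \<inter> space M) * \<dots> = (\<Prod>i\<in>{0..d}. prob (X i -` A i \<inter> space M))"
      by (simp add: prod.atLeast_Suc_atMost)
    finally show ?thesis .
  qed
  ultimately have "indep_vars (\<lambda>_. borel) X {0..d}"
    by (subst indep_vars_finite[where E="\<lambda>_. sets borel"])
      (use sets.sigma_sets_eq[of "borel :: real measure"] in \<open>simp_all add: sets.Int_stable\<close>)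
  then show ?thesis unfolding X_def .
qed

lemma expectation_mult_function_of_increments:
  fixes Z :: "'a \<Rightarrow> real"
  assumes "0 \<le> s" "s < t" "Z \<in> borel_measurable (F s)" "integrable M Z"
    and g: "g \<in> borel_measurable (PiM {1..d} (\<lambda>_. borel))"
    and int: "integrable M (\<lambda>\<omega>. g (\<lambda>i\<in>{1..d}. increment i s t \<omega>))"
  shows "expectation (\<lambda>\<omega>. Z \<omega> * g (\<lambda>i\<in>{1..d}. increment i s t \<omega>)) =
    expectation Z * expectation (\<lambda>\<omega>. g (\<lambda>i\<in>{1..d}. increment i s t \<omega>))"
proof -
  let ?X = "\<lambda>i. if i = 0 then Z else increment i s t"
  have "indep_var (PiM {0} (\<lambda>_. borel)) (\<lambda>\<omega>. \<lambda>i\<in>{0}. ?X i \<omega>)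
      (PiM {1..d} (\<lambda>_. borel)) (\<lambda>\<omega>. \<lambda>i\<in>{1..d}. ?X i \<omega>)"
    by (rule indep_var_restrict[OF indep_vars_past_increments[OF assms(1-3)]]) auto
  then have "indep_var borel ((\<lambda>x. x 0) \<circ> (\<lambda>\<omega>. \<lambda>i\<in>{0}. ?X i \<omega>)) borel (g \<circ> (\<lambda>\<omega>. \<lambda>i\<in>{1..d}. ?X i \<omega>))"
    by (rule indep_var_compose) (use g in measurable)
  moreover have "(\<lambda>i\<in>{1..d}. ?X i \<omega>) = (\<lambda>i\<in>{1..d}. increment i s t \<omega>)" for \<omega>
    by (intro restrict_cong) auto
  ultimately have "indep_var borel Z borel (\<lambda>\<omega>. g (\<lambda>i\<in>{1..d}. increment i s t \<omega>))"
    by (simp add: comp_def del: One_nat_def)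
  then show ?thesis by (rule indep_var_lebesgue_integral) fact+
qed

lemma
  assumes "0 \<le> s" "s < t" "i \<in> {1..d}"
    and moment: "has_bochner_integral lborel
      (\<lambda>x. normal_density 0 (sqrt (t - s)) x * g x) (m::real)"
    and [measurable]: "g \<in> borel_measurable borel"
  shows integrable_function_of_increment: "integrable M (\<lambda>\<omega>. g (increment i s t \<omega>))"
    and expectation_function_of_increment: "expectation (\<lambda>\<omega>. g (increment i s t \<omega>)) = m"
proof -
  have [measurable]: "increment i s t \<in> borel_measurable M"
    using increment_measurable[of i s t] assms measurable_F by auto
  have "has_bochner_integral (distr M borel (increment i s t)) g m"
    unfolding distr_increment[OF assms(1-3)]
    using moment by (intro has_bochner_integral_density) auto
  then show "integrable M (\<lambda>\<omega>. g (increment i s t \<omega>))"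
    and "expectation (\<lambda>\<omega>. g (increment i s t \<omega>)) = m"
    using integrable_distr_eq[of "increment i s t" M borel g]
      integral_distr[of "increment i s t" M borel g]
    by (simp_all add: has_bochner_integral_iff)
qed

lemma finite_moments_increment:
  assumes "0 \<le> s" "s < t" "a \<le> d" shows "finite_moments (increment a s t)"
proof (cases "a = 0")
  case True
  then show ?thesis by (simp add: increment_time[abs_def] finite_moments_const)
next
  case False
  have "integrable M (\<lambda>\<omega>. \<bar>increment a s t \<omega>\<bar> ^ p)" for p
  proof (rule integrable_function_of_increment[OF assms(1,2)])
    have "integrable lborel (\<lambda>x. normal_density 0 (sqrt (t - s)) x * \<bar>x - 0\<bar> ^ p)"
      using assms by (intro integrable_normal_moment_abs) auto
    then show "has_bochner_integral lborel (\<lambda>x. normal_density 0 (sqrt (t - s)) x * \<bar>x\<bar> ^ p)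
        (\<integral>x. normal_density 0 (sqrt (t - s)) x * \<bar>x\<bar> ^ p \<partial>lborel)"
      by (simp add: has_bochner_integral_iff)
  qed (use assms False in auto)
  moreover have "increment a s t \<in> borel_measurable M"
    using increment_measurable[of a s t] assms measurable_F by auto
  ultimately show ?thesis by (simp add: finite_moments_def)
qed

lemma
  assumes "0 \<le> s" "s < t" "i \<in> {1..d}"
  shows expectation_increment: "expectation (increment i s t) = 0"
    and mean_square_increment: "mean_square (increment i s t) = t - s"
    and expectation_increment_power4: "expectation (\<lambda>\<omega>. increment i s t \<omega> ^ 4) = 3 * (t - s)\<^sup>2"
proof -
  have pos: "sqrt (t - s) > 0" using assms by simp
  show "expectation (increment i s t) = 0"
    using expectation_function_of_increment[OF assms, of "\<lambda>x. x" 0]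
        normal_moment_odd[OF pos, of 0 0]
    by simp
  show "mean_square (increment i s t) = t - s"
    using expectation_function_of_increment[OF assms, of "\<lambda>x. x\<^sup>2" "t - s"]
      normal_moment_even[OF pos, of 0 1] assms
    by (simp add: fact_numeral diff_divide_distrib)
  show "expectation (\<lambda>\<omega>. increment i s t \<omega> ^ 4) = 3 * (t - s)\<^sup>2"
    using expectation_function_of_increment[OF assms, of "\<lambda>x. x ^ 4" "3 * (t - s)\<^sup>2"]
      normal_moment_even[OF pos, of 0 2] assms
    by (simp add: fact_numeral power_divide field_simps)
qed

lemma expectation_increment_power_mult:
  assumes "0 \<le> s" "s < t" "i \<in> {1..d}" "j \<in> {1..d}" "i \<noteq> j"
  shows "expectation (\<lambda>\<omega>. increment i s t \<omega> ^ p * increment j s t \<omega> ^ p) =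
    expectation (\<lambda>\<omega>. increment i s t \<omega> ^ p) * expectation (\<lambda>\<omega>. increment j s t \<omega> ^ p)"
proof -
  let ?X = "\<lambda>i. if i = 0 then (\<lambda>\<omega>. 0) else increment i s t"
  have "indep_vars (\<lambda>_. borel) ?X {i, j}"
    by (rule indep_vars_subset[OF indep_vars_past_increments[OF assms(1,2)]]) (use assms in auto)
  then have "indep_vars (\<lambda>_. borel) (\<lambda>k \<omega>. ?X k \<omega> ^ p) {i, j}"
    by (rule indep_vars_compose2) auto
  moreover have "integrable M (\<lambda>\<omega>. ?X k \<omega> ^ p)" if "k \<in> {i, j}" for k
    using that assms
    by (intro finite_moments_integrable finite_moments_power) (auto intro: finite_moments_increment)
  ultimately show ?thesis
    using indep_vars_lebesgue_integral[of "{i, j}" "\<lambda>k \<omega>. ?X k \<omega> ^ p"] assms by auto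
qed

subsection \<open>Adapted random variables and martingale sums\<close>

definition adapted :: "real \<Rightarrow> ('a \<Rightarrow> real) \<Rightarrow> bool" where
  "adapted s X \<longleftrightarrow> X \<in> borel_measurable (F s) \<and> finite_moments X"

lemma adapted_finite_moments: "adapted s X \<Longrightarrow> finite_moments X"
  by (simp add: adapted_def)

lemma adapted_mono: "adapted s X \<Longrightarrow> s \<le> t \<Longrightarrow> adapted t X"
  by (auto simp: adapted_def intro: measurable_F_mono)

lemma adapted_const: "adapted s (\<lambda>\<omega>. a)"
  by (simp add: adapted_def finite_moments_const)

lemma adapted_mult: "adapted s X \<Longrightarrow> adapted s Y \<Longrightarrow> adapted s (\<lambda>\<omega>. X \<omega> * Y \<omega>)"
  by (auto simp: adapted_def finite_moments_mult)

lemma adapted_add: "adapted s X \<Longrightarrow> adapted s Y \<Longrightarrow> adapted s (\<lambda>\<omega>. X \<omega> + Y \<omega>)"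
  by (auto simp: adapted_def finite_moments_add)

lemma adapted_diff: "adapted s X \<Longrightarrow> adapted s Y \<Longrightarrow> adapted s (\<lambda>\<omega>. X \<omega> - Y \<omega>)"
  by (auto simp: adapted_def finite_moments_diff)

lemma adapted_power: "adapted s X \<Longrightarrow> adapted s (\<lambda>\<omega>. X \<omega> ^ n)"
  by (auto simp: adapted_def finite_moments_power)

lemma adapted_sum: "(\<And>i. i \<in> A \<Longrightarrow> adapted s (X i)) \<Longrightarrow> adapted s (\<lambda>\<omega>. \<Sum>i\<in>A. X i \<omega>)"
  unfolding adapted_def by (intro conjI borel_measurable_sum finite_moments_sum) blast+

lemma adapted_pairing:
  assumes "lc_over A x" "\<And>w. set w \<subseteq> A \<Longrightarrow> adapted s (X w)"
  shows "adapted s (\<lambda>\<omega>. pairing (\<lambda>w. X w \<omega>) x)"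
  using assms
proof (induction x)
  case (Cons p x)
  obtain r w where p: "p = (r, w)" by (cases p)
  with Cons have "adapted s (\<lambda>\<omega>. r * X w \<omega> + pairing (\<lambda>w. X w \<omega>) x)"
    by (intro adapted_add adapted_mult adapted_const) simp_all
  then show ?case by (simp add: p)
qed (simp add: adapted_const)

lemma adapted_increment: "0 \<le> s \<Longrightarrow> s < t \<Longrightarrow> a \<le> d \<Longrightarrow> adapted t (increment a s t)"
  by (simp add: adapted_def finite_moments_increment increment_measurable)

lemma mean_square_martingale_sum_le:
  assumes Z: "\<And>j::nat. adapted (\<tau> j) (Z j)" and U: "\<And>j. adapted (\<tau> (Suc j)) (U j)"
    and \<tau>: "\<And>j. \<tau> j \<le> \<tau> (Suc j)"
    and centred: "\<And>j Y. adapted (\<tau> j) Y \<Longrightarrow> expectation (\<lambda>\<omega>. Y \<omega> * U j \<omega>) = 0"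
    and variance: "\<And>j Y. adapted (\<tau> j) Y \<Longrightarrow>
      expectation (\<lambda>\<omega>. (Y \<omega>)\<^sup>2 * (U j \<omega>)\<^sup>2) \<le> v * mean_square Y"
  shows "mean_square (\<lambda>\<omega>. \<Sum>j<k. Z j \<omega> * U j \<omega>) \<le> v * (\<Sum>j<k. mean_square (Z j))"
proof -
  let ?P = "\<lambda>k \<omega>. \<Sum>j<k. Z j \<omega> * U j \<omega>"
  have P: "adapted (\<tau> k) (?P k)" for k
  proof (induction k)
    case (Suc k)
    have "adapted (\<tau> (Suc k)) (\<lambda>\<omega>. ?P k \<omega> + Z k \<omega> * U k \<omega>)"
      by (intro adapted_add adapted_mult U adapted_mono[OF Suc] adapted_mono[OF Z] \<tau>)
    then show ?case by simp
  qed (simp add: adapted_const)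
  show ?thesis
  proof (induction k)
    case (Suc k)
    note fm = adapted_finite_moments[OF P] adapted_finite_moments[OF Z] adapted_finite_moments[OF U]
    have int: "integrable M (\<lambda>\<omega>. (?P k \<omega>)\<^sup>2)" "integrable M (\<lambda>\<omega>. (?P k \<omega> * Z k \<omega>) * U k \<omega>)"
       "integrable M (\<lambda>\<omega>. (Z k \<omega>)\<^sup>2 * (U k \<omega>)\<^sup>2)"
      by (intro finite_moments_integrable finite_moments_mult finite_moments_power fm)+
    have "mean_square (?P (Suc k)) =
        expectation (\<lambda>\<omega>. (?P k \<omega>)\<^sup>2 + 2 * ((?P k \<omega> * Z k \<omega>) * U k \<omega>) + (Z k \<omega>)\<^sup>2 * (U k \<omega>)\<^sup>2)"
      by (intro Bochner_Integration.integral_cong) (auto simp: power2_eq_square algebra_simps)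
    also have "\<dots> = mean_square (?P k) + 2 * expectation (\<lambda>\<omega>. (?P k \<omega> * Z k \<omega>) * U k \<omega>)
        + expectation (\<lambda>\<omega>. (Z k \<omega>)\<^sup>2 * (U k \<omega>)\<^sup>2)"
      using int by simp
    also have "expectation (\<lambda>\<omega>. (?P k \<omega> * Z k \<omega>) * U k \<omega>) = 0"
      by (intro centred adapted_mult P Z)
    also have "mean_square (?P k) + 2 * 0 + expectation (\<lambda>\<omega>. (Z k \<omega>)\<^sup>2 * (U k \<omega>)\<^sup>2) \<le>
        v * (\<Sum>j<k. mean_square (Z j)) + v * mean_square (Z k)"
      using Suc variance[OF Z, of k] by simp
    finally show ?case by (simp add: algebra_simps)
  qed simp
qed

end

subsection \<open>Ito sums on a grid\<close>

context brownian_motion begin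

definition step :: "real \<Rightarrow> nat \<Rightarrow> nat \<Rightarrow> 'a \<Rightarrow> real" where
  "step h a j = increment a (h * real j) (h * real (Suc j))"

lemma step_time: "step h 0 j \<omega> = h"
  by (simp add: step_def increment_time algebra_simps)

lemma adapted_step: "0 < h \<Longrightarrow> a \<le> d \<Longrightarrow> adapted (h * real (Suc j)) (step h a j)"
  unfolding step_def by (rule adapted_increment) auto

lemma step_refine:
  assumes "0 < r"
  shows "step h a j \<omega> = (\<Sum>i<r. step (h / real r) a (j * r + i) \<omega>)"
proof -
  let ?f = "\<lambda>i. hatW W a (h / real r * real (j * r + i)) \<omega>"
  have "h / real r * real (j * r + r) = h * real (Suc j)"
    "h / real r * real (j * r + 0) = h * real j"
    using assms by (simp_all add: field_simps)
  then have "step h a j \<omega> = ?f r - ?f 0" by (simp only: step_def increment_def)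
  also have "\<dots> = (\<Sum>i<r. ?f (Suc i) - ?f i)" by (rule sum_lessThan_telescope[symmetric])
  finally show ?thesis by (simp add: step_def increment_def)
qed

lemma
  assumes "0 < h" "i \<in> {1..d}"
  shows expectation_step: "expectation (step h i j) = 0"
    and mean_square_step: "mean_square (step h i j) = h"
    and expectation_step_power4: "expectation (\<lambda>\<omega>. step h i j \<omega> ^ 4) = 3 * h\<^sup>2"
proof -
  have "0 \<le> h * real j" "h * real j < h * real (Suc j)" "h * real (Suc j) - h * real j = h"
    using assms(1) by (auto simp: algebra_simps)
  then show "expectation (step h i j) = 0" "mean_square (step h i j) = h"
    "expectation (\<lambda>\<omega>. step h i j \<omega> ^ 4) = 3 * h\<^sup>2"
    using expectation_increment mean_square_increment expectation_increment_power4 assms(2)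
    by (simp_all add: step_def)
qed

lemma mean_square_step_le:
  assumes "0 < h" "a \<le> d" shows "mean_square (step h a j) \<le> (1 + h) * h"
proof (cases "a = 0")
  case True
  then show ?thesis using assms by (simp add: step_time prob_space power2_eq_square algebra_simps)
next
  case False
  then show ?thesis using assms mean_square_step[of h a j] by (simp add: algebra_simps)
qed

lemma expectation_mult_function_of_steps:
  assumes "0 < h" and Z: "adapted (h * real j) Z"
    and "g \<in> borel_measurable (PiM {1..d} (\<lambda>_. borel))"
    and "integrable M (\<lambda>\<omega>. g (\<lambda>i\<in>{1..d}. step h i j \<omega>))"
  shows "expectation (\<lambda>\<omega>. Z \<omega> * g (\<lambda>i\<in>{1..d}. step h i j \<omega>)) =
    expectation Z * expectation (\<lambda>\<omega>. g (\<lambda>i\<in>{1..d}. step h i j \<omega>))"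
proof -
  have time: "0 \<le> h * real j" "h * real j < h * real (Suc j)" using assms(1) by auto
  have "Z \<in> borel_measurable (F (h * real j))" "integrable M Z"
    using Z by (auto simp: adapted_def intro: finite_moments_integrable)
  from expectation_mult_function_of_increments[OF time this assms(3) assms(4)[unfolded step_def]]
  show ?thesis unfolding step_def .
qed

lemma expectation_mult_step_power:
  assumes "0 < h" "i \<in> {1..d}" and Z: "adapted (h * real j) Z"
  shows "expectation (\<lambda>\<omega>. Z \<omega> * step h i j \<omega> ^ p) =
      expectation Z * expectation (\<lambda>\<omega>. step h i j \<omega> ^ p)"
proof -
  have g: "(\<lambda>x. x i ^ p) \<in> borel_measurable (PiM {1..d} (\<lambda>_. borel :: real measure))"
    using assms(2) by measurable
  have "integrable M (\<lambda>\<omega>. step h i j \<omega> ^ p)"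
    using adapted_finite_moments[OF adapted_step] assms
    by (intro finite_moments_integrable finite_moments_power) auto
  then show ?thesis
    using expectation_mult_function_of_steps[OF assms(1) Z g] assms(2) by simp
qed

lemma expectation_mult_step:
  assumes "0 < h" "a \<le> d" "adapted (h * real j) Z"
  shows "expectation (\<lambda>\<omega>. Z \<omega> * step h a j \<omega>) = (if a = 0 then h * expectation Z else 0)"
  using expectation_mult_step_power[of h a j Z 1] expectation_step[of h a j] assms
  by (cases "a = 0") (simp_all add: step_time mult.commute)

definition ito_sum :: "real \<Rightarrow> nat \<Rightarrow> (nat \<Rightarrow> 'a \<Rightarrow> real) \<Rightarrow> nat \<Rightarrow> 'a \<Rightarrow> real" where
  "ito_sum h a Z k \<omega> = (\<Sum>j<k. Z j \<omega> * step h a j \<omega>)"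

lemma ito_sum_diff:
  "ito_sum h a (\<lambda>j \<omega>. Z j \<omega> - Z' j \<omega>) k \<omega> = ito_sum h a Z k \<omega> - ito_sum h a Z' k \<omega>"
  by (simp add: ito_sum_def sum_subtractf left_diff_distrib)

lemma ito_sum_refine:
  assumes "0 < r"
  shows "ito_sum h a Z k \<omega> = ito_sum (h / real r) a (\<lambda>i. Z (i div r)) (k * r) \<omega>"
proof -
  let ?fine = "\<lambda>i. Z (i div r) \<omega> * step (h / real r) a i \<omega>"
  have "ito_sum (h / real r) a (\<lambda>i. Z (i div r)) (k * r) \<omega> =
      (\<Sum>j<k. \<Sum>i\<in>{j * r..<j * r + r}. ?fine i)"
    unfolding ito_sum_def by (rule sum.nat_group[symmetric])
  also have "\<dots> = (\<Sum>j<k. \<Sum>i<r. ?fine (j * r + i))"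
  proof (rule sum.cong[OF refl])
    fix j
    show "(\<Sum>i\<in>{j * r..<j * r + r}. ?fine i) = (\<Sum>i<r. ?fine (j * r + i))"
      using sum.shift_bounds_nat_ivl[of ?fine 0 "j * r" r]
      by (simp add: lessThan_atLeast0 add.commute)
  qed
  also have "\<dots> = (\<Sum>j<k. \<Sum>i<r. Z j \<omega> * step (h / real r) a (j * r + i) \<omega>)"
    by (intro sum.cong) auto
  also have "\<dots> = ito_sum h a Z k \<omega>"
    by (simp only: ito_sum_def step_refine[OF assms, of h a] sum_distrib_left)
  finally show ?thesis ..
qed

lemma adapted_ito_sum:
  assumes "0 < h" "a \<le> d" and Z: "\<And>j. adapted (h * real j) (Z j)"
  shows "adapted (h * real k) (ito_sum h a Z k)"
  unfolding ito_sum_def[abs_def]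
proof (intro adapted_sum adapted_mult)
  fix j assume "j \<in> {..<k}"
  then have "h * real j \<le> h * real k" "h * real (Suc j) \<le> h * real k" using assms(1) by auto
  then show "adapted (h * real k) (Z j)" "adapted (h * real k) (step h a j)"
    using adapted_mono[OF Z] adapted_mono[OF adapted_step] assms by auto
qed

lemma mean_square_ito_sum_time_le:
  assumes "0 < h" and Z: "\<And>j. finite_moments (Z j)"
  shows "mean_square (ito_sum h 0 Z k) \<le> h * real k * h * (\<Sum>j<k. mean_square (Z j))"
proof -
  have ito: "ito_sum h 0 Z k \<omega> = (\<Sum>j<k. Z j \<omega>) * h" for \<omega>
    by (simp add: ito_sum_def step_time sum_distrib_right)
  have "mean_square (ito_sum h 0 Z k) \<le> expectation (\<lambda>\<omega>. h\<^sup>2 * real k * (\<Sum>j<k. (Z j \<omega>)\<^sup>2))"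
  proof (rule integral_mono)
    show "integrable M (\<lambda>\<omega>. (ito_sum h 0 Z k \<omega>)\<^sup>2)"
      "integrable M (\<lambda>\<omega>. h\<^sup>2 * real k * (\<Sum>j<k. (Z j \<omega>)\<^sup>2))"
      unfolding ito by (intro finite_moments_integrable finite_moments_intros Z)+
    fix \<omega>
    have "(\<Sum>j<k. Z j \<omega> * 1)\<^sup>2 \<le> (\<Sum>j<k. (Z j \<omega>)\<^sup>2) * (\<Sum>j<k. 1\<^sup>2)"
      by (rule Cauchy_Schwarz_ineq_sum)
    from mult_left_mono[OF this, of "h\<^sup>2"]
    show "(ito_sum h 0 Z k \<omega>)\<^sup>2 \<le> h\<^sup>2 * real k * (\<Sum>j<k. (Z j \<omega>)\<^sup>2)"
      unfolding ito by (simp add: power_mult_distrib mult_ac)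
  qed
  also have "\<dots> = h * real k * h * (\<Sum>j<k. mean_square (Z j))"
    using finite_moments_square_integrable[OF Z] by (simp add: power2_eq_square)
  finally show ?thesis .
qed

lemma mean_square_ito_sum_brownian_le:
  assumes "0 < h" "i \<in> {1..d}" and Z: "\<And>j. adapted (h * real j) (Z j)"
  shows "mean_square (ito_sum h i Z k) \<le> h * (\<Sum>j<k. mean_square (Z j))"
  unfolding ito_sum_def
proof (rule mean_square_martingale_sum_le[where \<tau>="\<lambda>j. h * real j"])
  fix j Y assume Y: "adapted (h * real j) Y"
  show "expectation (\<lambda>\<omega>. Y \<omega> * step h i j \<omega>) = 0"
    using expectation_mult_step[OF assms(1) _ Y, of i] assms(2) by simp
  show "expectation (\<lambda>\<omega>. (Y \<omega>)\<^sup>2 * (step h i j \<omega>)\<^sup>2) \<le> h * mean_square Y"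
    using expectation_mult_step_power[OF assms(1,2) adapted_power[OF Y]]
        mean_square_step[OF assms(1,2)]
    by simp
qed (use assms adapted_step in auto)

lemma mean_square_ito_sum_le:
  assumes "0 < h" "a \<le> d" and Z: "\<And>j. adapted (h * real j) (Z j)"
  shows "mean_square (ito_sum h a Z k) \<le> (1 + h * real k) * h * (\<Sum>j<k. mean_square (Z j))"
proof -
  have "0 \<le> h * (\<Sum>j<k. mean_square (Z j))" "0 \<le> h * real k * h * (\<Sum>j<k. mean_square (Z j))"
    using assms(1) by (simp_all add: sum_nonneg)
  then show ?thesis
    using mean_square_ito_sum_time_le[of h Z k, OF assms(1) adapted_finite_moments[OF Z]]
      mean_square_ito_sum_brownian_le[OF assms(1) _ Z, of a k] assms(2)
    by (cases "a = 0") (auto simp: distrib_right)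
qed

lemma mean_square_ito_sum_uniform_le:
  assumes "0 < h" "a \<le> d" "\<And>j. adapted (h * real j) (Z j)"
    and B: "\<And>j. j < k \<Longrightarrow> mean_square (Z j) \<le> B" "0 \<le> B" and T: "h * real k \<le> T"
  shows "mean_square (ito_sum h a Z k) \<le> (1 + T) * T * B"
proof -
  have hk: "0 \<le> h * real k" using assms(1) by simp
  have "mean_square (ito_sum h a Z k) \<le> (1 + h * real k) * h * (\<Sum>j<k. mean_square (Z j))"
    by (rule mean_square_ito_sum_le) (use assms in auto)
  also have "\<dots> \<le> (1 + h * real k) * h * (\<Sum>j<k. B)"
    using assms(1) B hk by (intro mult_left_mono sum_mono) auto
  also have "\<dots> = (1 + h * real k) * (h * real k) * B" by simp
  also have "\<dots> \<le> (1 + T) * T * B"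
    using B T hk by (intro mult_right_mono mult_mono) linarith+
  finally show ?thesis .
qed

lemma mean_square_ito_sum_increment_le:
  assumes "0 < h" "a \<le> d" and Z: "\<And>j. adapted (h * real j) (Z j)"
    and B: "\<And>j. j < k \<Longrightarrow> mean_square (Z j) \<le> B" and "l \<le> k"
  shows "mean_square (\<lambda>\<omega>. ito_sum h a Z k \<omega> - ito_sum h a Z l \<omega>) \<le>
      (1 + h * real k) * h * (real (k - l) * B)"
proof -
  define Z' where "Z' j = (if j < l then (\<lambda>\<omega>. 0) else Z j)" for j
  have split: "{..<k} = {..<l} \<union> {l..<k}" using \<open>l \<le> k\<close> by auto
  have "ito_sum h a Z k \<omega> - ito_sum h a Z l \<omega> = ito_sum h a Z' k \<omega>" for \<omega>
    unfolding ito_sum_def split by (simp add: sum.union_disjoint Z'_def ivl_disj_int)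
  then have "mean_square (\<lambda>\<omega>. ito_sum h a Z k \<omega> - ito_sum h a Z l \<omega>) =
      mean_square (ito_sum h a Z' k)"
    by simp
  also have "\<dots> \<le> (1 + h * real k) * h * (\<Sum>j<k. mean_square (Z' j))"
    by (rule mean_square_ito_sum_le) (use assms adapted_const in \<open>auto simp: Z'_def\<close>)
  also have "(\<Sum>j<k. mean_square (Z' j)) = (\<Sum>j=l..<k. mean_square (Z j))"
    unfolding split by (simp add: sum.union_disjoint Z'_def ivl_disj_int)
  also have "\<dots> \<le> real (k - l) * B"
    using sum_bounded_above[of "{l..<k}" "\<lambda>j. mean_square (Z j)" B] B by simp
  finally show ?thesis
    using assms(1) by (simp add: mult_left_mono)
qed

text \<open>The integrand need not be adapted here, hence only an \<open>L\<^sup>1\<close> bound that grows with the number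
  of summands.\<close>

lemma
  assumes "0 < h" "a \<le> d" "0 < r"
    and Z: "\<And>j. j < k \<Longrightarrow> Z j \<in> borel_measurable M"
      "\<And>j. j < k \<Longrightarrow> integrable M (\<lambda>\<omega>. (Z j \<omega>)\<^sup>2)" "\<And>j. j < k \<Longrightarrow> mean_square (Z j) \<le> B"
  shows integrable_ito_sum: "integrable M (ito_sum h a Z k)"
    and expectation_abs_ito_sum_le:
      "expectation (\<lambda>\<omega>. \<bar>ito_sum h a Z k \<omega>\<bar>) \<le> real k * (r * B + (1 + h) * h / r)"
proof -
  have step: "finite_moments (step h a j)" for j
    using adapted_finite_moments[OF adapted_step] assms(1,2) by blast
  note squares = finite_moments_measurable[OF step] Z(2) finite_moments_square_integrable[OF step]
  have summand: "integrable M (\<lambda>\<omega>. Z j \<omega> * step h a j \<omega>)" if "j < k" for j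
    by (rule integrable_mult_if_square_integrable[OF Z(1) squares \<open>0 < r\<close>]) (rule that)+
  show "integrable M (ito_sum h a Z k)"
    unfolding ito_sum_def[abs_def] using summand by (intro Bochner_Integration.integrable_sum) auto
  then have "expectation (\<lambda>\<omega>. \<bar>ito_sum h a Z k \<omega>\<bar>) \<le> expectation (\<lambda>\<omega>. \<Sum>j<k. \<bar>Z j \<omega> * step h a j \<omega>\<bar>)"
    unfolding ito_sum_def[abs_def] using summand
    by (intro integral_mono integrable_abs Bochner_Integration.integrable_sum sum_abs) auto
  also have "\<dots> = (\<Sum>j<k. expectation (\<lambda>\<omega>. \<bar>Z j \<omega> * step h a j \<omega>\<bar>))"
    using summand by (intro Bochner_Integration.integral_sum integrable_abs) auto
  also have "\<dots> \<le> (\<Sum>j<k. r * B + (1 + h) * h / r)"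
  proof (rule sum_mono)
    fix j assume "j \<in> {..<k}"
    then have j: "j < k" by simp
    have "expectation (\<lambda>\<omega>. \<bar>Z j \<omega> * step h a j \<omega>\<bar>) \<le>
        r * mean_square (Z j) + mean_square (step h a j) / r"
      by (rule integral_abs_mult_le_weighted_squares[OF Z(1) squares \<open>0 < r\<close>]) (rule j)+
    also have "\<dots> \<le> r * B + (1 + h) * h / r"
      using Z(3)[OF j] mean_square_step_le[OF assms(1,2)] \<open>0 < r\<close>
      by (intro add_mono mult_left_mono divide_right_mono) auto
    finally show "expectation (\<lambda>\<omega>. \<bar>Z j \<omega> * step h a j \<omega>\<bar>) \<le> r * B + (1 + h) * h / r" .
  qed
  finally show "expectation (\<lambda>\<omega>. \<bar>ito_sum h a Z k \<omega>\<bar>) \<le> real k * (r * B + (1 + h) * h / r)" by simp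
qed

definition covariation_error :: "real \<Rightarrow> nat \<Rightarrow> nat \<Rightarrow> nat \<Rightarrow> 'a \<Rightarrow> real" where
  "covariation_error h a b j \<omega> = step h a j \<omega> * step h b j \<omega> - (if rho a b then h else 0)"

lemma adapted_covariation_error:
  "0 < h \<Longrightarrow> a \<le> d \<Longrightarrow> b \<le> d \<Longrightarrow> adapted (h * real (Suc j)) (covariation_error h a b j)"
  unfolding covariation_error_def[abs_def]
  by (intro adapted_diff adapted_mult adapted_const adapted_step)

lemma
  assumes "0 < h" and i: "i \<in> {1..d}" and j: "j \<in> {1..d}"
  shows expectation_covariation_error: "expectation (covariation_error h i j l) = 0"
    and mean_square_covariation_error_le: "mean_square (covariation_error h i j l) \<le> 2 * h\<^sup>2"
proof -
  have fm: "finite_moments (step h a l)" if "a \<in> {i, j}" for a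
    using adapted_finite_moments[OF adapted_step] assms that by auto
  note int = fm[THEN finite_moments_power, THEN finite_moments_integrable]
  have "expectation (covariation_error h i j l) = 0
      \<and> mean_square (covariation_error h i j l) \<le> 2 * h\<^sup>2"
  proof (cases "i = j")
    case True
    have "expectation (covariation_error h i j l) = expectation (\<lambda>\<omega>. (step h i l \<omega>)\<^sup>2 - h)"
      using True i by (simp add: covariation_error_def[abs_def] rho_def power2_eq_square)
    moreover have "mean_square (covariation_error h i j l) =
        expectation (\<lambda>\<omega>. step h i l \<omega> ^ 4 - 2 * h * (step h i l \<omega>)\<^sup>2 + h\<^sup>2)"
      using True i by (intro Bochner_Integration.integral_cong)
        (auto simp: covariation_error_def rho_def power2_eq_square power4_eq_xxxx algebra_simps)
    ultimately show ?thesis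
      using int[of i] mean_square_step[OF assms(1) i] expectation_step_power4[OF assms(1) i]
      by (simp add: prob_space power2_eq_square[of h])
  next
    case False
    have time: "0 \<le> h * real l" "h * real l < h * real (Suc l)" using assms(1) by auto
    have product: "expectation (\<lambda>\<omega>. step h i l \<omega> ^ p * step h j l \<omega> ^ p) =
        expectation (\<lambda>\<omega>. step h i l \<omega> ^ p) * expectation (\<lambda>\<omega>. step h j l \<omega> ^ p)" for p
      unfolding step_def by (rule expectation_increment_power_mult[OF time i j False])
    show ?thesis
      using product[of 1] product[of 2] False expectation_step[OF assms(1) i]
          mean_square_step[OF assms(1)] i j
      by (simp add: covariation_error_def[abs_def] rho_def power_mult_distrib
          power2_eq_square[of h])
  qed
  then show "expectation (covariation_error h i j l) = 0"
    and "mean_square (covariation_error h i j l) \<le> 2 * h\<^sup>2" by auto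
qed

lemma expectation_mult_covariation_error_power:
  assumes "0 < h" and i: "i \<in> {1..d}" and j: "j \<in> {1..d}" and Y: "adapted (h * real l) Y"
  shows "expectation (\<lambda>\<omega>. Y \<omega> * covariation_error h i j l \<omega> ^ p) =
    expectation Y * expectation (\<lambda>\<omega>. covariation_error h i j l \<omega> ^ p)"
proof -
  define g where "g x = (x i * x j - (if rho i j then h else 0)) ^ p" for x :: "nat \<Rightarrow> real"
  have "g \<in> borel_measurable (PiM {1..d} (\<lambda>_. borel))"
    unfolding g_def using i j by measurable
  moreover have g: "g (\<lambda>i\<in>{1..d}. step h i l \<omega>) = covariation_error h i j l \<omega> ^ p" for \<omega>
    using i j by (simp add: g_def covariation_error_def)
  moreover have "integrable M (\<lambda>\<omega>. covariation_error h i j l \<omega> ^ p)"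
    using adapted_finite_moments[OF adapted_covariation_error] assms
    by (intro finite_moments_integrable finite_moments_power) auto
  ultimately show ?thesis
    using expectation_mult_function_of_steps[OF assms(1) Y, of g] by simp
qed

lemma mean_square_covariation_sum_le:
  assumes "0 < h" and i: "i \<in> {1..d}" and j: "j \<in> {1..d}" and Z: "\<And>l. adapted (h * real l) (Z l)"
  shows "mean_square (\<lambda>\<omega>. \<Sum>l<k. Z l \<omega> * covariation_error h i j l \<omega>) \<le>
      2 * h\<^sup>2 * (\<Sum>l<k. mean_square (Z l))"
proof (rule mean_square_martingale_sum_le[where \<tau>="\<lambda>l. h * real l"])
  fix l Y assume Y: "adapted (h * real l) Y"
  show "expectation (\<lambda>\<omega>. Y \<omega> * covariation_error h i j l \<omega>) = 0"
    using expectation_mult_covariation_error_power[OF assms(1-3) Y, of 1]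
      expectation_covariation_error[OF assms(1-3)] by simp
  have "expectation (\<lambda>\<omega>. (Y \<omega>)\<^sup>2 * (covariation_error h i j l \<omega>)\<^sup>2) =
      mean_square Y * mean_square (covariation_error h i j l)"
    by (rule expectation_mult_covariation_error_power[OF assms(1-3) adapted_power[OF Y]])
  also have "\<dots> \<le> mean_square Y * (2 * h\<^sup>2)"
    by (intro mult_left_mono mean_square_covariation_error_le assms(1-3)) simp
  finally show "expectation (\<lambda>\<omega>. (Y \<omega>)\<^sup>2 * (covariation_error h i j l \<omega>)\<^sup>2) \<le>
      2 * h\<^sup>2 * mean_square Y"
    by (simp add: mult.commute)
qed (use assms adapted_covariation_error in auto)

subsection \<open>Mean square order of grid processes\<close>

definition grid_adapted :: "(real \<Rightarrow> nat \<Rightarrow> 'a \<Rightarrow> real) \<Rightarrow> bool" where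
  "grid_adapted X \<longleftrightarrow> (\<forall>h>0. \<forall>k. adapted (h * real k) (X h k))"

definition L2_order :: "real \<Rightarrow> nat \<Rightarrow> (real \<Rightarrow> nat \<Rightarrow> 'a \<Rightarrow> real) \<Rightarrow> bool" where
  "L2_order T p X \<longleftrightarrow>
     (\<exists>K\<ge>0. \<forall>h k. 0 < h \<longrightarrow> h \<le> T \<longrightarrow> h * real k \<le> T \<longrightarrow> mean_square (X h k) \<le> K * h ^ p)"

lemma L2_orderI:
  assumes "0 \<le> K" "\<And>h k. 0 < h \<Longrightarrow> h \<le> T \<Longrightarrow> h * real k \<le> T \<Longrightarrow> mean_square (X h k) \<le> K * h ^ p"
  shows "L2_order T p X"
  using assms by (auto simp: L2_order_def)

lemma L2_orderE:
  assumes "L2_order T p X"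
  obtains K where "0 \<le> K"
    "\<And>h k. 0 < h \<Longrightarrow> h \<le> T \<Longrightarrow> h * real k \<le> T \<Longrightarrow> mean_square (X h k) \<le> K * h ^ p"
  using assms by (auto simp: L2_order_def)

lemma grid_adaptedD: "grid_adapted X \<Longrightarrow> 0 < h \<Longrightarrow> adapted (h * real k) (X h k)"
  by (simp add: grid_adapted_def)

lemma grid_adapted_finite_moments: "grid_adapted X \<Longrightarrow> 0 < h \<Longrightarrow> finite_moments (X h k)"
  using grid_adaptedD adapted_finite_moments by blast

lemma grid_adapted_const: "grid_adapted (\<lambda>h k \<omega>. r)"
  by (simp add: grid_adapted_def adapted_const)

lemma grid_adapted_add:
  "grid_adapted X \<Longrightarrow> grid_adapted Y \<Longrightarrow> grid_adapted (\<lambda>h k \<omega>. X h k \<omega> + Y h k \<omega>)"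
  by (simp add: grid_adapted_def adapted_add)

lemma grid_adapted_diff:
  "grid_adapted X \<Longrightarrow> grid_adapted Y \<Longrightarrow> grid_adapted (\<lambda>h k \<omega>. X h k \<omega> - Y h k \<omega>)"
  by (simp add: grid_adapted_def adapted_diff)

lemma grid_adapted_mult:
  "grid_adapted X \<Longrightarrow> grid_adapted Y \<Longrightarrow> grid_adapted (\<lambda>h k \<omega>. X h k \<omega> * Y h k \<omega>)"
  by (simp add: grid_adapted_def adapted_mult)

lemma grid_adapted_ito_sum: "a \<le> d \<Longrightarrow> grid_adapted Z \<Longrightarrow> grid_adapted (\<lambda>h. ito_sum h a (Z h))"
  by (simp add: grid_adapted_def adapted_ito_sum)

lemma grid_adapted_pairing:
  assumes "lc_over A x" "\<And>w. set w \<subseteq> A \<Longrightarrow> grid_adapted (\<lambda>h. X h w)"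
  shows "grid_adapted (\<lambda>h k \<omega>. pairing (\<lambda>w. X h w k \<omega>) x)"
  using assms by (auto simp: grid_adapted_def intro!: adapted_pairing)

lemma grid_adapted_covariation_sum:
  assumes "a \<le> d" "b \<le> d" and Z: "grid_adapted Z"
  shows "grid_adapted (\<lambda>h k \<omega>. \<Sum>j<k. Z h j \<omega> * covariation_error h a b j \<omega>)"
  unfolding grid_adapted_def
proof (intro allI impI adapted_sum adapted_mult)
  fix h :: real and j k :: nat assume h: "0 < h" and "j \<in> {..<k}"
  then have "h * real j \<le> h * real k" "h * real (Suc j) \<le> h * real k" by auto
  then show "adapted (h * real k) (Z h j)" "adapted (h * real k) (covariation_error h a b j)"
    using adapted_mono grid_adaptedD[OF Z h] adapted_covariation_error[OF h assms(1,2)] by blast+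
qed

lemma grid_time_le:
  fixes h :: real
  assumes "0 < h" "h * real k \<le> T" "j \<le> k" shows "h * real j \<le> T"
proof -
  have "h * real j \<le> h * real k" using assms by simp
  then show ?thesis using assms(2) by linarith
qed

lemma L2_order_le_Suc: "L2_order T (Suc p) X \<Longrightarrow> L2_order T p X"
proof (elim L2_orderE)
  fix K assume K: "0 \<le> K"
    "\<And>h k. 0 < h \<Longrightarrow> h \<le> T \<Longrightarrow> h * real k \<le> T \<Longrightarrow> mean_square (X h k) \<le> K * h ^ Suc p"
  show "L2_order T p X"
  proof (rule L2_orderI[of "K * \<bar>T\<bar>"])
    fix h k assume h: "0 < h" "h \<le> T" "h * real k \<le> T"
    have "mean_square (X h k) \<le> K * h * h ^ p" using K(2)[OF h] by (simp add: mult_ac)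
    also have "\<dots> \<le> K * \<bar>T\<bar> * h ^ p" using K(1) h by (intro mult_right_mono mult_left_mono) auto
    finally show "mean_square (X h k) \<le> K * \<bar>T\<bar> * h ^ p" .
  qed (use K in auto)
qed

lemma L2_order_add:
  assumes adapted: "grid_adapted X" "grid_adapted Y" and "L2_order T p X" "L2_order T p Y"
  shows "L2_order T p (\<lambda>h k \<omega>. X h k \<omega> + Y h k \<omega>)"
proof -
  obtain K K' where K: "0 \<le> K" "0 \<le> K'"
    "\<And>h k. 0 < h \<Longrightarrow> h \<le> T \<Longrightarrow> h * real k \<le> T \<Longrightarrow> mean_square (X h k) \<le> K * h ^ p"
    "\<And>h k. 0 < h \<Longrightarrow> h \<le> T \<Longrightarrow> h * real k \<le> T \<Longrightarrow> mean_square (Y h k) \<le> K' * h ^ p"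
    using assms(3,4) by (metis L2_orderE)
  show ?thesis
  proof (rule L2_orderI[of "2 * K + 2 * K'"])
    fix h k assume h: "0 < h" "h \<le> T" "h * real k \<le> T"
    have "mean_square (\<lambda>\<omega>. X h k \<omega> + Y h k \<omega>) \<le> 2 * mean_square (X h k) + 2 * mean_square (Y h k)"
      by (intro mean_square_add_le grid_adapted_finite_moments adapted h)
    also have "\<dots> \<le> (2 * K + 2 * K') * h ^ p"
      using K(3)[OF h] K(4)[OF h] by (simp add: distrib_right)
    finally show "mean_square (\<lambda>\<omega>. X h k \<omega> + Y h k \<omega>) \<le> (2 * K + 2 * K') * h ^ p" .
  qed (use K in auto)
qed

lemma L2_order_cmult:
  assumes "L2_order T p X" shows "L2_order T p (\<lambda>h k \<omega>. r * X h k \<omega>)"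
  using assms
proof (elim L2_orderE)
  fix K assume K: "0 \<le> K"
    "\<And>h k. 0 < h \<Longrightarrow> h \<le> T \<Longrightarrow> h * real k \<le> T \<Longrightarrow> mean_square (X h k) \<le> K * h ^ p"
  show ?thesis
    by (rule L2_orderI[of "r\<^sup>2 * K"])
        (use K in \<open>auto simp: power_mult_distrib mult.assoc intro: mult_left_mono\<close>)
qed

lemma L2_order_pairing:
  assumes "lc_over A x"
    and "\<And>w. set w \<subseteq> A \<Longrightarrow> grid_adapted (\<lambda>h. X h w)" "\<And>w. set w \<subseteq> A \<Longrightarrow> L2_order T p (\<lambda>h. X h w)"
  shows "L2_order T p (\<lambda>h k \<omega>. pairing (\<lambda>w. X h w k \<omega>) x)"
  using assms(1)
proof (induction x)
  case Nil
  show ?case by (rule L2_orderI[of 0]) auto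
next
  case (Cons q x)
  obtain r w where q: "q = (r, w)" by (cases q)
  have "L2_order T p (\<lambda>h k \<omega>. r * X h w k \<omega> + pairing (\<lambda>w. X h w k \<omega>) x)"
    using Cons assms(2,3) unfolding q
    by (intro L2_order_add L2_order_cmult grid_adapted_mult grid_adapted_const
        grid_adapted_pairing[where A=A])
      auto
  then show ?case by (simp add: q)
qed

lemma L2_order_ito_sum:
  assumes "a \<le> d" and Z: "grid_adapted Z" "L2_order T p Z"
  shows "L2_order T p (\<lambda>h. ito_sum h a (Z h))"
  using Z(2)
proof (elim L2_orderE)
  fix K assume K: "0 \<le> K"
    "\<And>h k. 0 < h \<Longrightarrow> h \<le> T \<Longrightarrow> h * real k \<le> T \<Longrightarrow> mean_square (Z h k) \<le> K * h ^ p"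
  show ?thesis
  proof (rule L2_orderI[of "(1 + \<bar>T\<bar>) * \<bar>T\<bar> * K"])
    fix h k assume h: "0 < h" "h \<le> T" "h * real k \<le> T"
    have "mean_square (ito_sum h a (Z h) k) \<le> (1 + T) * T * (K * h ^ p)"
      using assms(1) h K grid_adaptedD[OF Z(1) h(1)] grid_time_le[OF h(1,3)]
      by (intro mean_square_ito_sum_uniform_le) auto
    then show "mean_square (ito_sum h a (Z h) k) \<le> (1 + \<bar>T\<bar>) * \<bar>T\<bar> * K * h ^ p"
      using h by (simp add: mult.assoc)
  qed (use K in auto)
qed

lemma L2_order_covariation_sum_time:
  assumes "b \<le> d" and Z: "grid_adapted Z" "L2_order T 0 Z"
  shows "L2_order T 1 (\<lambda>h k \<omega>. \<Sum>j<k. Z h j \<omega> * (h * step h b j \<omega>))"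
  using L2_order_ito_sum[OF assms]
proof (elim L2_orderE)
  fix K assume K: "0 \<le> K" "\<And>h k. 0 < h \<Longrightarrow> h \<le> T \<Longrightarrow> h * real k \<le> T \<Longrightarrow>
    mean_square (ito_sum h b (Z h) k) \<le> K * h ^ 0"
  show ?thesis
  proof (rule L2_orderI[of "\<bar>T\<bar> * K"])
    fix h k assume h: "0 < h" "h \<le> T" "h * real k \<le> T"
    have "(\<Sum>j<k. Z h j \<omega> * (h * step h b j \<omega>)) = h * ito_sum h b (Z h) k \<omega>" for \<omega>
      by (simp add: ito_sum_def sum_distrib_left mult_ac)
    then have "mean_square (\<lambda>\<omega>. \<Sum>j<k. Z h j \<omega> * (h * step h b j \<omega>)) =
        h * (h * mean_square (ito_sum h b (Z h) k))"
      by (simp add: power_mult_distrib power2_eq_square[of h])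
    also have "\<dots> \<le> h * (T * K)"
      using K(2)[OF h] K(1) h by (intro mult_left_mono mult_mono) auto
    finally show "mean_square (\<lambda>\<omega>. \<Sum>j<k. Z h j \<omega> * (h * step h b j \<omega>)) \<le> \<bar>T\<bar> * K * h ^ 1"
      using h by (simp add: mult_ac)
  qed (use K in auto)
qed

lemma L2_order_covariation_sum_brownian:
  assumes ij: "i \<in> {1..d}" "j \<in> {1..d}" and Z: "grid_adapted Z" "L2_order T 0 Z"
  shows "L2_order T 1 (\<lambda>h k \<omega>. \<Sum>l<k. Z h l \<omega> * covariation_error h i j l \<omega>)"
  using Z(2)
proof (elim L2_orderE)
  fix K assume K: "0 \<le> K"
    "\<And>h k. 0 < h \<Longrightarrow> h \<le> T \<Longrightarrow> h * real k \<le> T \<Longrightarrow> mean_square (Z h k) \<le> K * h ^ 0"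
  show ?thesis
  proof (rule L2_orderI[of "2 * \<bar>T\<bar> * K"])
    fix h k assume h: "0 < h" "h \<le> T" "h * real k \<le> T"
    have "mean_square (\<lambda>\<omega>. \<Sum>l<k. Z h l \<omega> * covariation_error h i j l \<omega>) \<le>
        2 * h\<^sup>2 * (\<Sum>l<k. mean_square (Z h l))"
      by (rule mean_square_covariation_sum_le[OF h(1) ij grid_adaptedD[OF Z(1) h(1)]])
    also have "\<dots> \<le> 2 * h\<^sup>2 * (\<Sum>l<k. K)"
      using K(2)[OF h(1,2) grid_time_le[OF h(1,3)]] by (intro mult_left_mono sum_mono) auto
    also have "\<dots> = 2 * (h * real k) * K * h" by (simp add: power2_eq_square)
    also have "\<dots> \<le> 2 * \<bar>T\<bar> * K * h" using h K by (intro mult_right_mono mult_left_mono) auto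
    finally show "mean_square (\<lambda>\<omega>. \<Sum>l<k. Z h l \<omega> * covariation_error h i j l \<omega>) \<le>
        2 * \<bar>T\<bar> * K * h ^ 1"
      by simp
  qed (use K in auto)
qed

lemma L2_order_covariation_sum:
  assumes "a \<le> d" "b \<le> d" and Z: "grid_adapted Z" "L2_order T 0 Z"
  shows "L2_order T 1 (\<lambda>h k \<omega>. \<Sum>j<k. Z h j \<omega> * covariation_error h a b j \<omega>)"
proof -
  consider (left_time) "a = 0" | (right_time) "b = 0" | (brownian) "a \<in> {1..d}" "b \<in> {1..d}"
    using assms(1,2) by fastforce
  then show ?thesis
  proof cases
    case left_time
    then have "covariation_error h a b j \<omega> = h * step h b j \<omega>" for h j \<omega>
      by (auto simp: covariation_error_def rho_def step_time)
    then show ?thesis using L2_order_covariation_sum_time[OF assms(2) Z] by simp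
  next
    case right_time
    then have "covariation_error h a b j \<omega> = h * step h a j \<omega>" for h j \<omega>
      by (auto simp: covariation_error_def rho_def step_time)
    then show ?thesis using L2_order_covariation_sum_time[OF assms(1) Z] by simp
  next
    case brownian
    then show ?thesis using Z by (rule L2_order_covariation_sum_brownian)
  qed
qed

end

subsection \<open>The signature of a grid\<close>

context brownian_motion begin

text \<open>Words are read in reverse here: the head of the list is the last letter of the word.\<close>

primrec grid_sig :: "real \<Rightarrow> nat list \<Rightarrow> nat \<Rightarrow> 'a \<Rightarrow> real" where
  "grid_sig h [] = (\<lambda>k \<omega>. 1)"
| "grid_sig h (a # w) = ito_sum h a (grid_sig h w)"

lemma grid_adapted_grid_sig: "set w \<subseteq> {0..d} \<Longrightarrow> grid_adapted (\<lambda>h. grid_sig h w)"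
  by (induction w) (simp_all add: grid_adapted_const grid_adapted_ito_sum)

lemma finite_moments_grid_sig: "0 < h \<Longrightarrow> set w \<subseteq> {0..d} \<Longrightarrow> finite_moments (grid_sig h w k)"
  using grid_adapted_finite_moments[OF grid_adapted_grid_sig] .

lemma L2_order_grid_sig: "set w \<subseteq> {0..d} \<Longrightarrow> L2_order T 0 (\<lambda>h. grid_sig h w)"
proof (induction w)
  case Nil
  show ?case by (rule L2_orderI[of 1]) (auto simp: prob_space)
qed (simp add: L2_order_ito_sum grid_adapted_grid_sig)

lemma mean_square_grid_sig_increment_le:
  assumes "set w \<subseteq> {0..d}" "0 \<le> T"
  shows "\<exists>K\<ge>0. \<forall>h k l. 0 < h \<longrightarrow> l \<le> k \<longrightarrow> h * real k \<le> T \<longrightarrow>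
    mean_square (\<lambda>\<omega>. grid_sig h w k \<omega> - grid_sig h w l \<omega>) \<le> K * h * real (k - l)"
proof (cases w)
  case Nil
  then show ?thesis by (auto intro!: exI[of _ 0])
next
  case (Cons a v)
  then have v: "set v \<subseteq> {0..d}" "a \<le> d" using assms by auto
  obtain K where K: "0 \<le> K"
    "\<And>h k. 0 < h \<Longrightarrow> h \<le> T \<Longrightarrow> h * real k \<le> T \<Longrightarrow> mean_square (grid_sig h v k) \<le> K * h ^ 0"
    using L2_order_grid_sig[OF v(1), of T] unfolding L2_order_def by blast
  show ?thesis
  proof (intro exI[of _ "(1 + T) * K"] conjI allI impI)
    fix h k l assume h: "0 < h" "h * real k \<le> T" and "l \<le> k"
    have "mean_square (grid_sig h v j) \<le> K" if "j < k" for j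
      using K(2)[OF h(1), of j] grid_time_le[OF h, of 1] grid_time_le[OF h, of j] that by simp
    then have "mean_square (\<lambda>\<omega>. grid_sig h w k \<omega> - grid_sig h w l \<omega>) \<le>
        (1 + h * real k) * h * (real (k - l) * K)"
      unfolding Cons grid_sig.simps
      by (intro mean_square_ito_sum_increment_le h v \<open>l \<le> k\<close>
          grid_adaptedD[OF grid_adapted_grid_sig])
    also have "\<dots> \<le> (1 + T) * h * (real (k - l) * K)"
      using h K(1) by (intro mult_right_mono) auto
    finally show "mean_square (\<lambda>\<omega>. grid_sig h w k \<omega> - grid_sig h w l \<omega>) \<le>
        (1 + T) * K * h * real (k - l)"
      by (simp add: mult_ac)
  qed (use K assms in auto)
qed

definition coarse_sum :: "real \<Rightarrow> nat \<Rightarrow> nat \<Rightarrow> nat list \<Rightarrow> nat \<Rightarrow> 'a \<Rightarrow> real" where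
  "coarse_sum h r a w = ito_sum h a (\<lambda>j. grid_sig (h / real r) w (j * r))"

lemma finite_moments_coarse_sum:
  assumes "0 < h" "0 < r" "a \<le> d" "set w \<subseteq> {0..d}" shows "finite_moments (coarse_sum h r a w k)"
  unfolding coarse_sum_def ito_sum_def[abs_def] using assms
  by (intro finite_moments_sum finite_moments_mult finite_moments_grid_sig
      adapted_finite_moments[OF adapted_step]) auto

lemma coarse_sum_minus_grid_sig:
  assumes "0 < r"
  shows "coarse_sum h r a w k \<omega> - grid_sig (h / real r) (a # w) (k * r) \<omega> =
    ito_sum (h / real r) a
      (\<lambda>i \<omega>. grid_sig (h / real r) w (i div r * r) \<omega> - grid_sig (h / real r) w i \<omega>) (k * r) \<omega>"
  unfolding coarse_sum_def grid_sig.simps ito_sum_refine[OF assms, of h] by (simp add: ito_sum_diff)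

lemma mean_square_coarse_sum_minus_grid_sig_le:
  assumes w: "set w \<subseteq> {0..d}" "a \<le> d" and "0 \<le> T"
  shows "\<exists>K\<ge>0. \<forall>h k r. 0 < h \<longrightarrow> h * real k \<le> T \<longrightarrow> 0 < r \<longrightarrow>
    mean_square (\<lambda>\<omega>. coarse_sum h r a w k \<omega> - grid_sig (h / real r) (a # w) (k * r) \<omega>) \<le> K * h"
proof -
  obtain K where K: "0 \<le> K" "\<And>h k l. 0 < h \<Longrightarrow> l \<le> k \<Longrightarrow> h * real k \<le> T \<Longrightarrow>
      mean_square (\<lambda>\<omega>. grid_sig h w k \<omega> - grid_sig h w l \<omega>) \<le> K * h * real (k - l)"
    using mean_square_grid_sig_increment_le[OF w(1) \<open>0 \<le> T\<close>] by blast
  show ?thesis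
  proof (intro exI[of _ "(1 + T) * T * K"] conjI allI impI)
    fix h k r assume h: "0 < h" "h * real k \<le> T" and r: "0 < (r::nat)"
    define g where "g = h / real r"
    have g: "0 < g" "g * real r = h" using h r by (auto simp: g_def)
    have gT: "g * real (k * r) \<le> T" using h(2) unfolding g(2)[symmetric] by (simp add: mult_ac)
    define Z where "Z i \<omega> = grid_sig g w (i div r * r) \<omega> - grid_sig g w i \<omega>" for i \<omega>
    have sig: "adapted (g * real k) (grid_sig g w k)" for k
      using grid_adaptedD[OF grid_adapted_grid_sig[OF w(1)] g(1)] .
    have adapted: "adapted (g * real i) (Z i)" for i
      unfolding Z_def[abs_def] using g(1)
      by (intro adapted_diff sig adapted_mono[OF sig]) (simp add: mult_left_mono del: of_nat_mult)
    have "mean_square (Z i) \<le> K * h" if "i < k * r" for i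
    proof -
      have block: "i div r * r \<le> i" "i - i div r * r \<le> r"
        using r by (auto simp: minus_div_mult_eq_mod less_imp_le)
      have "mean_square (Z i) = mean_square (\<lambda>\<omega>. grid_sig g w i \<omega> - grid_sig g w (i div r * r) \<omega>)"
        by (simp add: Z_def power2_commute)
      also have "\<dots> \<le> K * g * real (i - i div r * r)"
        using grid_time_le[OF g(1) gT, of i] that by (intro K(2) g block) simp
      also have "\<dots> \<le> K * g * real r"
        using block(2) K(1) g(1) by (intro mult_left_mono of_nat_mono) auto
      finally show ?thesis using g by (simp add: mult.assoc)
    qed
    then have "mean_square (ito_sum g a Z (k * r)) \<le> (1 + T) * T * (K * h)"
      using K(1) h(1) by (intro mean_square_ito_sum_uniform_le g w adapted gT) auto
    then show "mean_square (\<lambda>\<omega>. coarse_sum h r a w k \<omega> - grid_sig (h / real r) (a # w) (k * r) \<omega>)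
        \<le> (1 + T) * T * K * h"
      unfolding coarse_sum_minus_grid_sig[OF r] by (simp add: Z_def[abs_def] g_def mult.assoc)
  qed (use K \<open>0 \<le> T\<close> in auto)
qed

lemma mean_square_grid_sig_refine_Cons_le:
  assumes w: "set w \<subseteq> {0..d}" "a \<le> d" and h: "0 < h" "h * real k \<le> T" and r: "0 < r"
    and B: "0 \<le> B" "\<And>j. h * real j \<le> T \<Longrightarrow>
      mean_square (\<lambda>\<omega>. grid_sig h w j \<omega> - grid_sig (h / real r) w (j * r) \<omega>) \<le> B"
  shows "mean_square (\<lambda>\<omega>. grid_sig h (a # w) k \<omega> - grid_sig (h / real r) (a # w) (k * r) \<omega>) \<le>
    2 * ((1 + T) * T * B)
    + 2 * mean_square (\<lambda>\<omega>. coarse_sum h r a w k \<omega> - grid_sig (h / real r) (a # w) (k * r) \<omega>)"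
proof -
  define g where "g = h / real r"
  have g: "0 < g" "g * real (j * r) = h * real j" for j using h r by (auto simp: g_def)
  define Z where "Z j \<omega> = grid_sig h w j \<omega> - grid_sig g w (j * r) \<omega>" for j \<omega>
  define E where "E \<omega> = coarse_sum h r a w k \<omega> - grid_sig g (a # w) (k * r) \<omega>" for \<omega>
  have Z: "adapted (h * real j) (Z j)" for j
    unfolding Z_def[abs_def]
    using grid_adaptedD[OF grid_adapted_grid_sig[OF w(1)] h(1), of j]
      grid_adaptedD[OF grid_adapted_grid_sig[OF w(1)] g(1), of "j * r", unfolded g(2)]
    by (intro adapted_diff)
  have E: "finite_moments E"
    unfolding E_def[abs_def] using w
    by (intro finite_moments_diff finite_moments_coarse_sum finite_moments_grid_sig h r g) auto
  have "grid_sig h (a # w) k \<omega> - grid_sig g (a # w) (k * r) \<omega> = ito_sum h a Z k \<omega> + E \<omega>" for \<omega>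
    by (simp add: E_def Z_def[abs_def] coarse_sum_def g_def[symmetric] ito_sum_diff)
  then have "mean_square (\<lambda>\<omega>. grid_sig h (a # w) k \<omega> - grid_sig g (a # w) (k * r) \<omega>) \<le>
      2 * mean_square (ito_sum h a Z k) + 2 * mean_square E"
    using mean_square_add_le[OF adapted_finite_moments[OF adapted_ito_sum[OF h(1) w(2) Z, of k]] E]
    by simp
  moreover have "mean_square (ito_sum h a Z k) \<le> (1 + T) * T * B"
    using B grid_time_le[OF h]
    by (intro mean_square_ito_sum_uniform_le w Z h) (auto simp: Z_def g_def)
  ultimately show ?thesis by (simp add: E_def g_def)
qed

lemma mean_square_grid_sig_refine_le:
  assumes "set w \<subseteq> {0..d}" "0 \<le> T"
  shows "\<exists>K\<ge>0. \<forall>h k r. 0 < h \<longrightarrow> h * real k \<le> T \<longrightarrow> 0 < r \<longrightarrow>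
    mean_square (\<lambda>\<omega>. grid_sig h w k \<omega> - grid_sig (h / real r) w (k * r) \<omega>) \<le> K * h"
  using assms(1)
proof (induction w)
  case Nil
  then show ?case by (auto intro!: exI[of _ 0])
next
  case (Cons a w)
  then have w: "set w \<subseteq> {0..d}" "a \<le> d" by auto
  from Cons obtain K where K: "0 \<le> K" "\<And>h k r. 0 < h \<Longrightarrow> h * real k \<le> T \<Longrightarrow> 0 < r \<Longrightarrow>
      mean_square (\<lambda>\<omega>. grid_sig h w k \<omega> - grid_sig (h / real r) w (k * r) \<omega>) \<le> K * h"
    by auto
  obtain K' where K': "0 \<le> K'" "\<And>h k r. 0 < h \<Longrightarrow> h * real k \<le> T \<Longrightarrow> 0 < r \<Longrightarrow>
      mean_square (\<lambda>\<omega>. coarse_sum h r a w k \<omega> - grid_sig (h / real r) (a # w) (k * r) \<omega>) \<le> K' * h"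
    using mean_square_coarse_sum_minus_grid_sig_le[OF w assms(2)] by blast
  show ?case
  proof (intro exI[of _ "2 * ((1 + T) * T * K) + 2 * K'"] conjI allI impI)
    fix h k r assume h: "0 < h" "h * real k \<le> T" and r: "0 < (r::nat)"
    have "mean_square (\<lambda>\<omega>. grid_sig h (a # w) k \<omega> - grid_sig (h / real r) (a # w) (k * r) \<omega>) \<le>
        2 * ((1 + T) * T * (K * h)) + 2 * (K' * h)"
      using mean_square_grid_sig_refine_Cons_le[OF w h r, of "K * h"] K(1) K(2)[OF h(1) _ r]
          K'(2)[OF h r] h(1)
      by fastforce
    then show "mean_square (\<lambda>\<omega>. grid_sig h (a # w) k \<omega> - grid_sig (h / real r) (a # w) (k * r) \<omega>)
        \<le> (2 * ((1 + T) * T * K) + 2 * K') * h"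
      by (simp add: distrib_right mult.assoc)
  qed (use K K' assms in auto)
qed

lemma expectation_grid_sig:
  assumes "0 < h" "set w \<subseteq> {0..d}"
  shows "expectation (grid_sig h w k) =
    (if set w \<subseteq> {0} then h ^ length w * real (k choose length w) else 0)"
  using assms(2)
proof (induction w arbitrary: k)
  case Nil
  then show ?case by (simp add: prob_space)
next
  case (Cons a w)
  then have w: "set w \<subseteq> {0..d}" "a \<le> d" by auto
  have "expectation (grid_sig h (a # w) k) =
      (\<Sum>j<k. expectation (\<lambda>\<omega>. grid_sig h w j \<omega> * step h a j \<omega>))"
    unfolding grid_sig.simps ito_sum_def[abs_def]
    by (intro Bochner_Integration.integral_sum finite_moments_integrable finite_moments_mult
        finite_moments_grid_sig assms w adapted_finite_moments[OF adapted_step])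
  also have "\<dots> = (\<Sum>j<k. if a = 0 then h * expectation (grid_sig h w j) else 0)"
    by (intro sum.cong refl expectation_mult_step assms w grid_adaptedD[OF grid_adapted_grid_sig])
  also have "\<dots> = (if set (a # w) \<subseteq> {0}
      then h ^ Suc (length w) * (\<Sum>j<k. real (j choose length w)) else 0)"
    unfolding Cons.IH[OF w(1)]
    by (cases "set w \<subseteq> {0}"; cases "a = 0") (auto simp: sum_distrib_left mult.assoc)
  also have "(\<Sum>j<k. real (j choose n)) = real (k choose Suc n)" for n
    by (induction k) auto
  finally show ?case by simp
qed

subsection \<open>The product defect\<close>

definition product_defect :: "real \<Rightarrow> nat list \<Rightarrow> nat list \<Rightarrow> nat \<Rightarrow> 'a \<Rightarrow> real" where
  "product_defect h u v k \<omega> =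
     grid_sig h u k \<omega> * grid_sig h v k \<omega> - pairing (\<lambda>w. grid_sig h w k \<omega>) (rstar u v)"

lemma grid_adapted_product_defect:
  assumes "set u \<subseteq> {0..d}" "set v \<subseteq> {0..d}"
  shows "grid_adapted (\<lambda>h. product_defect h u v)"
  unfolding product_defect_def[abs_def]
  by (intro grid_adapted_diff grid_adapted_mult grid_adapted_pairing[where A="{0..d}"]
      grid_adapted_grid_sig lc_over_rstar assms) auto

lemma sum_mult_sum_by_parts:
  fixes x y :: "nat \<Rightarrow> 'b::comm_ring"
  shows "(\<Sum>l<k. x l) * (\<Sum>l<k. y l) =
    (\<Sum>l<k. x l * (\<Sum>m<l. y m)) + (\<Sum>l<k. (\<Sum>m<l. x m) * y l) + (\<Sum>l<k. x l * y l)"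
  by (induction k) (auto simp: algebra_simps)

lemma pairing_grid_sig_lprep:
  "pairing (\<lambda>w. grid_sig h w k \<omega>) (lprep a x) =
      ito_sum h a (\<lambda>j \<omega>. pairing (\<lambda>w. grid_sig h w j \<omega>) x) k \<omega>"
  unfolding pairing_lprep
  by (induction x) (auto simp: ito_sum_def sum.distrib algebra_simps sum_distrib_left)

lemma product_defect_Cons_Cons:
  "product_defect h (i # I) (j # J) k \<omega> =
    ito_sum h i (product_defect h I (j # J)) k \<omega> + ito_sum h j (product_defect h (i # I) J) k \<omega>
    + of_bool (rho i j) * ito_sum h 0 (product_defect h I J) k \<omega>
    + (\<Sum>l<k. (grid_sig h I l \<omega> * grid_sig h J l \<omega>) * covariation_error h i j l \<omega>)"
proof -
  have product: "grid_sig h (i # I) k \<omega> * grid_sig h (j # J) k \<omega> =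
      (\<Sum>l<k. (grid_sig h I l \<omega> * grid_sig h (j # J) l \<omega>) * step h i l \<omega>)
      + (\<Sum>l<k. (grid_sig h (i # I) l \<omega> * grid_sig h J l \<omega>) * step h j l \<omega>)
      + (\<Sum>l<k. (grid_sig h I l \<omega> * grid_sig h J l \<omega>) * (step h i l \<omega> * step h j l \<omega>))"
    using sum_mult_sum_by_parts[of "\<lambda>l. grid_sig h I l \<omega> * step h i l \<omega>" k
        "\<lambda>l. grid_sig h J l \<omega> * step h j l \<omega>"]
    by (simp add: ito_sum_def mult_ac)
  have star: "pairing (\<lambda>w. grid_sig h w k \<omega>) (rstar (i # I) (j # J)) =
      ito_sum h i (\<lambda>l \<omega>. pairing (\<lambda>w. grid_sig h w l \<omega>) (rstar I (j # J))) k \<omega>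
      + ito_sum h j (\<lambda>l \<omega>. pairing (\<lambda>w. grid_sig h w l \<omega>) (rstar (i # I) J)) k \<omega>
      + of_bool (rho i j) * ito_sum h 0 (\<lambda>l \<omega>. pairing (\<lambda>w. grid_sig h w l \<omega>) (rstar I J)) k \<omega>"
    by (simp add: pairing_grid_sig_lprep)
  show ?thesis
    unfolding product_defect_def[abs_def] product star ito_sum_diff covariation_error_def
    by (simp add: ito_sum_def sum.distrib sum_subtractf algebra_simps step_time
        del: rstar.simps grid_sig.simps)
qed

lemma L2_order_product:
  assumes "set u \<subseteq> {0..d}" "set v \<subseteq> {0..d}" "L2_order T 1 (\<lambda>h. product_defect h u v)"
  shows "L2_order T 0 (\<lambda>h k \<omega>. grid_sig h u k \<omega> * grid_sig h v k \<omega>)"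
proof -
  have over: "lc_over {0..d} (rstar u v)" by (intro lc_over_rstar assms) auto
  have "L2_order T 0
      (\<lambda>h k \<omega>. product_defect h u v k \<omega> + pairing (\<lambda>w. grid_sig h w k \<omega>) (rstar u v))"
    using assms(3)[unfolded One_nat_def, THEN L2_order_le_Suc]
    by (intro L2_order_add L2_order_pairing[OF over] grid_adapted_pairing[OF over] L2_order_grid_sig
        grid_adapted_product_defect grid_adapted_grid_sig assms)
  then show ?thesis by (simp add: product_defect_def)
qed

lemma L2_order_product_defect:
  assumes "set u \<subseteq> {0..d}" "set v \<subseteq> {0..d}"
  shows "L2_order T 1 (\<lambda>h. product_defect h u v)"
  using assms
proof (induction "length u + length v" arbitrary: u v rule: less_induct)
  case less
  show ?case
  proof (cases "u = [] \<or> v = []")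
    case True
    then have "product_defect h u v k \<omega> = 0" for h k \<omega> by (auto simp: product_defect_def)
    then show ?thesis by (intro L2_orderI[of 0]) auto
  next
    case False
    then obtain i I j J where uv: "u = i # I" "v = j # J" by (meson list.exhaust)
    have words: "i \<le> d" "j \<le> d" "set I \<subseteq> {0..d}" "set J \<subseteq> {0..d}"
        "set (i # I) \<subseteq> {0..d}" "set (j # J) \<subseteq> {0..d}"
      using less.prems uv by auto
    have IH: "L2_order T 1 (\<lambda>h. product_defect h I (j # J))"
        "L2_order T 1 (\<lambda>h. product_defect h (i # I) J)" "L2_order T 1 (\<lambda>h. product_defect h I J)"
      using less.hyps words uv by auto
    have "L2_order T 1 (\<lambda>h k \<omega>. ito_sum h i (product_defect h I (j # J)) k \<omega>
        + ito_sum h j (product_defect h (i # I) J) k \<omega>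
        + of_bool (rho i j) * ito_sum h 0 (product_defect h I J) k \<omega>
        + (\<Sum>l<k. (grid_sig h I l \<omega> * grid_sig h J l \<omega>) * covariation_error h i j l \<omega>))"
      by (intro L2_order_add L2_order_cmult L2_order_ito_sum L2_order_covariation_sum
          L2_order_product grid_adapted_add grid_adapted_mult grid_adapted_const
          grid_adapted_ito_sum grid_adapted_covariation_sum grid_adapted_grid_sig
          grid_adapted_product_defect IH words) auto
    then show ?thesis unfolding uv product_defect_Cons_Cons .
  qed
qed

end

subsection \<open>Convergence of the grid signature\<close>

locale ito_signature = brownian_motion M F d W
  for M :: "'a measure" and F :: "real \<Rightarrow> 'a measure" and d :: nat
    and W :: "nat \<Rightarrow> real \<Rightarrow> 'a \<Rightarrow> real" +
  fixes S :: "nat list \<Rightarrow> real \<Rightarrow> 'a \<Rightarrow> real"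
  assumes signature: "is_signature M d W S"
begin

lemma S_Nil: "S [] t \<omega> = 1"
  using signature by (simp add: is_signature_def)

lemma S_measurable: "set I \<subseteq> {0..d} \<Longrightarrow> 0 \<le> t \<Longrightarrow> S I t \<in> borel_measurable M"
  using signature unfolding is_signature_def by blast

abbreviation rsig :: "nat list \<Rightarrow> real \<Rightarrow> 'a \<Rightarrow> real" where
  "rsig w t \<equiv> S (rev w) t"

definition dyadic_riemann_sum :: "real \<Rightarrow> nat \<Rightarrow> nat list \<Rightarrow> nat \<Rightarrow> 'a \<Rightarrow> real" where
  "dyadic_riemann_sum t a w n = ito_sum (t / 2 ^ n) a (\<lambda>j. rsig w (t / 2 ^ n * real j)) (2 ^ n)"

lemma dyadic_riemann_sum_measurable:
  assumes "set w \<subseteq> {0..d}" "a \<le> d" "0 \<le> t"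
  shows "dyadic_riemann_sum t a w n \<in> borel_measurable M"
proof -
  have "step (t / 2 ^ n) a j \<in> borel_measurable M" for j
    unfolding step_def using assms
    by (intro measurable_F[OF increment_measurable] mult_left_mono) auto
  then show ?thesis
    unfolding dyadic_riemann_sum_def ito_sum_def[abs_def] using assms
    by (intro borel_measurable_sum borel_measurable_times S_measurable) auto
qed

lemma dyadic_riemann_sum_conv_in_prob:
  assumes "set w \<subseteq> {0..d}" "a \<le> d" "0 \<le> t"
  shows "conv_in_prob M (dyadic_riemann_sum t a w) (rsig (a # w) t)"
proof -
  have "\<forall>I a t. set I \<subseteq> {0..d} \<longrightarrow> a \<le> d \<longrightarrow> 0 \<le> t \<longrightarrow>
      conv_in_prob M
        (\<lambda>n \<omega>. \<Sum>k<2^n. S I (t * real k / 2^n) \<omega> *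
          (hatW W a (t * real (Suc k) / 2^n) \<omega> - hatW W a (t * real k / 2^n) \<omega>))
        (S (I @ [a]) t)"
    using signature unfolding is_signature_def by blast
  then show ?thesis
    using assms
    by (simp add: dyadic_riemann_sum_def[abs_def] ito_sum_def[abs_def] step_def increment_def)
qed

definition grid_sig_approximates :: "real \<Rightarrow> real \<Rightarrow> nat list \<Rightarrow> bool" where
  "grid_sig_approximates T K w \<longleftrightarrow> (\<forall>h k. 0 < h \<longrightarrow> h * real k \<le> T \<longrightarrow>
     integrable M (\<lambda>\<omega>. (grid_sig h w k \<omega> - rsig w (h * real k) \<omega>)\<^sup>2) \<and>
     mean_square (\<lambda>\<omega>. grid_sig h w k \<omega> - rsig w (h * real k) \<omega>) \<le> K * h)"

text \<open>The integrands \<^term>\<open>rsig w\<close> of the Riemann sums are not known to be adapted, so the isometry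
  does not apply to them. They are replaced by grid sums on a grid refined by \<open>r \<ge> 4\<^sup>n\<close>, which is
  fine enough for the \<open>L\<^sup>1\<close> bound to absorb the number of summands.\<close>

lemma
  assumes w: "set w \<subseteq> {0..d}" "a \<le> d" and K: "0 \<le> K" "grid_sig_approximates t K w"
    and t: "0 < t" and r: "4 ^ n \<le> r"
  shows integrable_dyadic_riemann_sum_minus_coarse_sum:
      "integrable M (\<lambda>\<omega>. dyadic_riemann_sum t a w n \<omega> - coarse_sum (t / 2 ^ n) r a w (2 ^ n) \<omega>)"
    and expectation_abs_dyadic_riemann_sum_minus_coarse_sum_le:
      "expectation (\<lambda>\<omega>. \<bar>dyadic_riemann_sum t a w n \<omega> - coarse_sum (t / 2 ^ n) r a w (2 ^ n) \<omega>\<bar>)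
        \<le> (K + 1 + t) * t * (1/2) ^ n"
proof -
  define h where "h = t / 2 ^ n"
  define Z where "Z j \<omega> = rsig w (h * real j) \<omega> - grid_sig (h / real r) w (j * r) \<omega>" for j \<omega>
  have diff: "dyadic_riemann_sum t a w n \<omega> - coarse_sum (t / 2 ^ n) r a w (2 ^ n) \<omega> =
      ito_sum h a Z (2 ^ n) \<omega>" for \<omega>
    by (simp add: dyadic_riemann_sum_def coarse_sum_def Z_def[abs_def] h_def ito_sum_diff)
  have pos: "0 < r" using less_le_trans[OF _ r] by simp
  have h: "0 < h" "h \<le> t" "h * real (2 ^ n) \<le> t" "0 < h / real r"
      "h / real r * real (j * r) = h * real j" for j
    using t pos by (auto simp: h_def divide_le_eq)
  have Z_measurable: "Z j \<in> borel_measurable M" for j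
    unfolding Z_def[abs_def] using h w
    by (intro borel_measurable_diff S_measurable
        finite_moments_measurable[OF finite_moments_grid_sig]) auto
  have Z: "integrable M (\<lambda>\<omega>. (Z j \<omega>)\<^sup>2)" "mean_square (Z j) \<le> K * (h / real r)"
    if "j < 2 ^ n" for j
    using K(2)[unfolded grid_sig_approximates_def, rule_format, OF h(4), of "j * r",
        unfolded h(5)]
      grid_time_le[OF h(1,3), of j] that
    by (auto simp: Z_def power2_commute[of "rsig w _ _"])
  have "0 < (2 ^ n :: real)" by simp
  note ito = h(1) w(2) this Z_measurable Z
  show "integrable M (\<lambda>\<omega>. dyadic_riemann_sum t a w n \<omega> - coarse_sum (t / 2 ^ n) r a w (2 ^ n) \<omega>)"
    unfolding diff using integrable_ito_sum[OF ito] by simp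
  have "expectation (\<lambda>\<omega>. \<bar>ito_sum h a Z (2 ^ n) \<omega>\<bar>) \<le>
      real (2 ^ n) * (2 ^ n * (K * (h / real r)) + (1 + h) * h / 2 ^ n)"
    by (rule expectation_abs_ito_sum_le[OF ito])
  also have "\<dots> = K * h * (4 ^ n / real r) + (1 + h) * h"
    using power_mult_distrib[of "2::real" 2 n] by (simp add: field_simps)
  also have "\<dots> \<le> K * h * 1 + (1 + t) * h"
    using of_nat_mono[OF r, where 'a=real] pos h K(1)
    by (intro add_mono mult_left_mono mult_right_mono) (auto simp: divide_le_eq)
  also have "\<dots> = (K + 1 + t) * t * (1/2) ^ n" by (simp add: h_def field_simps power_one_over)
  finally show "expectation (\<lambda>\<omega>. \<bar>dyadic_riemann_sum t a w n \<omega>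
      - coarse_sum (t / 2 ^ n) r a w (2 ^ n) \<omega>\<bar>) \<le> (K + 1 + t) * t * (1/2) ^ n"
    unfolding diff .
qed

lemma AE_dyadic_riemann_sum_minus_coarse_sum_tendsto_0:
  assumes "set w \<subseteq> {0..d}" "a \<le> d" "0 \<le> K" "grid_sig_approximates t K w" "0 < t"
    and "\<And>n. 4 ^ n \<le> r n"
  shows "AE \<omega> in M.
    (\<lambda>n. dyadic_riemann_sum t a w n \<omega> - coarse_sum (t / 2 ^ n) (r n) a w (2 ^ n) \<omega>) \<longlonglongrightarrow> 0"
  by (rule AE_tendsto_0_if_summable_integral[OF
        integrable_dyadic_riemann_sum_minus_coarse_sum[OF assms]
        expectation_abs_dyadic_riemann_sum_minus_coarse_sum_le[OF assms]])
    (intro summable_mult summable_geometric, simp)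

lemma AE_coarse_sum_minus_grid_sig_tendsto_0:
  assumes w: "set w \<subseteq> {0..d}" "a \<le> d" and t: "0 < t" and r: "\<And>n. 0 < r n"
  shows "AE \<omega> in M. (\<lambda>n. coarse_sum (t / 2 ^ n) (r n) a w (2 ^ n) \<omega>
    - grid_sig (t / 2 ^ n / real (r n)) (a # w) (2 ^ n * r n) \<omega>) \<longlonglongrightarrow> 0"
proof -
  obtain K where K: "\<And>h k r. 0 < h \<Longrightarrow> h * real k \<le> t \<Longrightarrow> 0 < r \<Longrightarrow>
      mean_square (\<lambda>\<omega>. coarse_sum h r a w k \<omega> - grid_sig (h / real r) (a # w) (k * r) \<omega>) \<le> K * h"
    using mean_square_coarse_sum_minus_grid_sig_le[OF w less_imp_le[OF t]] by auto
  show ?thesis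
  proof (rule AE_tendsto_0_if_summable_integral_square)
    fix n
    have h: "0 < t / 2 ^ n" "0 < t / 2 ^ n / real (r n)" using t r by auto
    have "set (a # w) \<subseteq> {0..d}" using w by simp
    then show "integrable M (\<lambda>\<omega>. (coarse_sum (t / 2 ^ n) (r n) a w (2 ^ n) \<omega>
        - grid_sig (t / 2 ^ n / real (r n)) (a # w) (2 ^ n * r n) \<omega>)\<^sup>2)"
      by (intro finite_moments_square_integrable finite_moments_diff finite_moments_coarse_sum
          finite_moments_grid_sig h r w)
    show "mean_square (\<lambda>\<omega>. coarse_sum (t / 2 ^ n) (r n) a w (2 ^ n) \<omega>
        - grid_sig (t / 2 ^ n / real (r n)) (a # w) (2 ^ n * r n) \<omega>) \<le> K * t * (1/2) ^ n"
      using K[OF h(1) _ r, of "2 ^ n" n] t by (simp add: power_one_over field_simps)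
  qed (intro summable_mult summable_geometric, simp)
qed

lemma AE_dyadic_riemann_sum_minus_refinement_tendsto_0:
  assumes w: "set w \<subseteq> {0..d}" "a \<le> d" and K: "0 \<le> K" "grid_sig_approximates T K w"
    and h: "0 < h" "h * real k \<le> T"
  shows "AE \<omega> in M. (\<lambda>n. dyadic_riemann_sum (h * real k) a w n \<omega>
    - grid_sig (h / real (8 ^ n)) (a # w) (k * 8 ^ n) \<omega>) \<longlonglongrightarrow> 0"
proof (cases "k = 0")
  case True
  then show ?thesis by (simp add: dyadic_riemann_sum_def ito_sum_def step_def increment_def)
next
  case False
  define t where "t = h * real k"
  define r where "r n = k * 4 ^ n" for n :: nat
  have r: "4 ^ n \<le> r n" "0 < r n" for n using False by (simp_all add: r_def)
  have t: "0 < t" "grid_sig_approximates t K w"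
    using False h K(2) by (auto simp: t_def grid_sig_approximates_def)
  have grids: "t / 2 ^ n / real (r n) = h / real (8 ^ n)" "2 ^ n * r n = k * 8 ^ n" for n
    using False power_mult_distrib[of "2::real" 4 n] power_mult_distrib[of "2::nat" 4 n]
    by (simp_all add: t_def r_def)
  from AE_dyadic_riemann_sum_minus_coarse_sum_tendsto_0[where r=r, OF w K(1) t(2,1) r(1)]
    AE_coarse_sum_minus_grid_sig_tendsto_0[where r=r, OF w t(1) r(2)]
  show ?thesis
  proof eventually_elim
    case (elim \<omega>)
    from tendsto_add[OF elim] show ?case unfolding grids t_def[symmetric] by simp
  qed
qed

lemma grid_sig_refinements_tendsto_rsig:
  assumes w: "set w \<subseteq> {0..d}" "a \<le> d" and K: "0 \<le> K" "grid_sig_approximates T K w"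
    and h: "0 < h" "h * real k \<le> T"
  shows "\<exists>\<rho>. AE \<omega> in M. (\<lambda>n. grid_sig (h / real (8 ^ \<rho> n)) (a # w) (k * 8 ^ \<rho> n) \<omega>)
    \<longlonglongrightarrow> rsig (a # w) (h * real k) \<omega>"
proof -
  have t: "0 \<le> h * real k" using h by simp
  have "rsig (a # w) (h * real k) \<in> borel_measurable M" using w t by (intro S_measurable) auto
  then obtain \<rho> where \<rho>: "strict_mono \<rho>"
    "AE \<omega> in M. (\<lambda>n. dyadic_riemann_sum (h * real k) a w (\<rho> n) \<omega>) \<longlonglongrightarrow> rsig (a # w) (h * real k) \<omega>"
    using conv_in_prob_imp_AE_subseq[OF dyadic_riemann_sum_measurable[OF w t] _
        dyadic_riemann_sum_conv_in_prob[OF w t]] by blast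
  from \<rho>(2) AE_dyadic_riemann_sum_minus_refinement_tendsto_0[OF w K h]
  have "AE \<omega> in M. (\<lambda>n. grid_sig (h / real (8 ^ \<rho> n)) (a # w) (k * 8 ^ \<rho> n) \<omega>)
      \<longlonglongrightarrow> rsig (a # w) (h * real k) \<omega>"
  proof eventually_elim
    case (elim \<omega>)
    from tendsto_diff[OF elim(1) LIMSEQ_subseq_LIMSEQ[OF elim(2) \<rho>(1)]] show ?case
      by (simp add: comp_def)
  qed
  then show ?thesis by blast
qed

lemma ex_grid_sig_approximates:
  assumes "set w \<subseteq> {0..d}" "0 \<le> T"
  shows "\<exists>K\<ge>0. grid_sig_approximates T K w"
  using assms(1)
proof (induction w)
  case Nil
  then show ?case by (auto simp: grid_sig_approximates_def S_Nil intro!: exI[of _ 0])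
next
  case (Cons a w)
  then have w: "set w \<subseteq> {0..d}" "a \<le> d" "set (a # w) \<subseteq> {0..d}" by auto
  from Cons obtain K where K: "0 \<le> K" "grid_sig_approximates T K w" by auto
  obtain K' where K': "0 \<le> K'" "\<And>h k r. 0 < h \<Longrightarrow> h * real k \<le> T \<Longrightarrow> 0 < r \<Longrightarrow>
      mean_square (\<lambda>\<omega>. grid_sig h (a # w) k \<omega> - grid_sig (h / real r) (a # w) (k * r) \<omega>) \<le> K' * h"
    using mean_square_grid_sig_refine_le[OF w(3) assms(2)] by blast
  have "grid_sig_approximates T K' (a # w)"
    unfolding grid_sig_approximates_def
  proof (intro allI impI)
    fix h k assume h: "0 < h" "h * real k \<le> T"
    obtain \<rho> where lim: "AE \<omega> in M. (\<lambda>n. grid_sig (h / real (8 ^ \<rho> n)) (a # w) (k * 8 ^ \<rho> n) \<omega>)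
        \<longlonglongrightarrow> rsig (a # w) (h * real k) \<omega>"
      using grid_sig_refinements_tendsto_rsig[OF w(1,2) K h] by blast
    let ?f = "\<lambda>n \<omega>. (grid_sig h (a # w) k \<omega>
        - grid_sig (h / real (8 ^ \<rho> n)) (a # w) (k * 8 ^ \<rho> n) \<omega>)\<^sup>2"
    let ?g = "\<lambda>\<omega>. (grid_sig h (a # w) k \<omega> - rsig (a # w) (h * real k) \<omega>)\<^sup>2"
    have "integrable M (?f n)" for n
      using h
      by (intro finite_moments_square_integrable finite_moments_diff finite_moments_grid_sig w) auto
    moreover have "expectation (?f n) \<le> K' * h" for n
      by (intro K'(2) h) simp
    moreover have "?g \<in> borel_measurable M"
      using h w by (intro borel_measurable_power borel_measurable_diff S_measurable
          finite_moments_measurable[OF finite_moments_grid_sig]) auto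
    moreover have "AE \<omega> in M. (\<lambda>n. ?f n \<omega>) \<longlonglongrightarrow> ?g \<omega>"
      using lim by eventually_elim (intro tendsto_intros)
    ultimately show "integrable M ?g \<and> expectation ?g \<le> K' * h"
      using integrable_limit_of_bounded_integrals[of M ?f "K' * h" ?g]
        integral_limit_le_of_bounded_integrals[of M ?f "K' * h" ?g] by auto
  qed
  then show ?case using K'(1) by blast
qed

end

subsection \<open>The signature at a fixed time is a character with finite moments\<close>

context brownian_motion begin

definition dyadic_sig :: "real \<Rightarrow> nat \<Rightarrow> nat list \<Rightarrow> 'a \<Rightarrow> real" where
  "dyadic_sig t n I = grid_sig (t / 2 ^ n) (rev I) (2 ^ n)"

lemma finite_moments_dyadic_sig: "0 < t \<Longrightarrow> set I \<subseteq> {0..d} \<Longrightarrow> finite_moments (dyadic_sig t n I)"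
  unfolding dyadic_sig_def by (rule finite_moments_grid_sig) auto

lemma AE_dyadic_sig_product_defect_tendsto_0:
  assumes t: "0 < t" and words: "set u \<subseteq> {0..d}" "set v \<subseteq> {0..d}"
  shows "AE \<omega> in M. (\<lambda>n. dyadic_sig t n u \<omega> * dyadic_sig t n v \<omega>
    - pairing (\<lambda>w. dyadic_sig t n w \<omega>) (wstar u v)) \<longlonglongrightarrow> 0"
proof -
  define Q where "Q n = product_defect (t / 2 ^ n) (rev u) (rev v) (2 ^ n)" for n
  have rev_words: "set (rev u) \<subseteq> {0..d}" "set (rev v) \<subseteq> {0..d}" using words by auto
  obtain K where "0 \<le> K" and K: "\<And>h k. 0 < h \<Longrightarrow> h \<le> t \<Longrightarrow> h * real k \<le> t \<Longrightarrow>
      mean_square (product_defect h (rev u) (rev v) k) \<le> K * h ^ 1"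
    using L2_order_product_defect[OF rev_words, of t] unfolding L2_order_def by blast
  have "AE \<omega> in M. (\<lambda>n. Q n \<omega>) \<longlonglongrightarrow> 0"
  proof (rule AE_tendsto_0_if_summable_integral_square)
    fix n
    show "integrable M (\<lambda>\<omega>. (Q n \<omega>)\<^sup>2)"
      unfolding Q_def using t
      by (intro finite_moments_square_integrable grid_adapted_finite_moments
          grid_adapted_product_defect rev_words) simp
    show "mean_square (Q n) \<le> K * t * (1/2) ^ n"
      using K[of "t / 2 ^ n" "2 ^ n"] t by (simp add: Q_def power_one_over divide_le_eq field_simps)
  qed (intro summable_mult summable_geometric, simp)
  then show ?thesis
    by (simp add: Q_def product_defect_def dyadic_sig_def wstar_def pairing_map)
qed

end

context ito_signature begin

lemma
  assumes "0 < t" "set I \<subseteq> {0..d}"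
  shows dyadic_sig_diff_S_square_integrable: "integrable M (\<lambda>\<omega>. (dyadic_sig t n I \<omega> - S I t \<omega>)\<^sup>2)"
    and mean_square_dyadic_sig_diff_S_le:
      "\<exists>K. \<forall>n. mean_square (\<lambda>\<omega>. dyadic_sig t n I \<omega> - S I t \<omega>) \<le> K * (1/2) ^ n"
proof -
  obtain K where K: "grid_sig_approximates t K (rev I)"
    using ex_grid_sig_approximates[of "rev I" t] assms by auto
  have bounds: "integrable M (\<lambda>\<omega>. (dyadic_sig t n I \<omega> - S I t \<omega>)\<^sup>2)"
      "mean_square (\<lambda>\<omega>. dyadic_sig t n I \<omega> - S I t \<omega>) \<le> K * t * (1/2) ^ n" for n
    using K[unfolded grid_sig_approximates_def, rule_format, of "t / 2 ^ n" "2 ^ n"] assms(1)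
    by (simp_all add: dyadic_sig_def power_one_over)
  show "integrable M (\<lambda>\<omega>. (dyadic_sig t n I \<omega> - S I t \<omega>)\<^sup>2)" by (rule bounds(1))
  show "\<exists>K. \<forall>n. mean_square (\<lambda>\<omega>. dyadic_sig t n I \<omega> - S I t \<omega>) \<le> K * (1/2) ^ n"
    using bounds(2) by blast
qed

lemma AE_dyadic_sig_tendsto_S:
  assumes "0 < t"
  shows "AE \<omega> in M. \<forall>I. set I \<subseteq> {0..d} \<longrightarrow> (\<lambda>n. dyadic_sig t n I \<omega>) \<longlonglongrightarrow> S I t \<omega>"
proof (subst AE_all_countable, intro allI)
  fix I :: "nat list"
  show "AE \<omega> in M. set I \<subseteq> {0..d} \<longrightarrow> (\<lambda>n. dyadic_sig t n I \<omega>) \<longlonglongrightarrow> S I t \<omega>"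
  proof (cases "set I \<subseteq> {0..d}")
    case True
    obtain K where K: "\<And>n. mean_square (\<lambda>\<omega>. dyadic_sig t n I \<omega> - S I t \<omega>) \<le> K * (1/2) ^ n"
      using mean_square_dyadic_sig_diff_S_le[OF assms True] by blast
    have "AE \<omega> in M. (\<lambda>n. dyadic_sig t n I \<omega> - S I t \<omega>) \<longlonglongrightarrow> 0"
      using dyadic_sig_diff_S_square_integrable[OF assms True] K
      by (rule AE_tendsto_0_if_summable_integral_square)
          (intro summable_mult summable_geometric, simp)
    then show ?thesis by eventually_elim (auto intro: LIM_zero_cancel)
  qed simp
qed

lemma AE_star_character_S:
  assumes "0 < t" shows "AE \<omega> in M. star_character d (\<lambda>w. S w t \<omega>)"
proof -
  have "AE \<omega> in M. set u \<subseteq> {0..d} \<longrightarrow> set v \<subseteq> {0..d} \<longrightarrow>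
      pairing (\<lambda>w. S w t \<omega>) (wstar u v) = S u t \<omega> * S v t \<omega>" for u v
  proof (cases "set u \<subseteq> {0..d} \<and> set v \<subseteq> {0..d}")
    case True
    then have words: "set u \<subseteq> {0..d}" "set v \<subseteq> {0..d}" by auto
    from AE_dyadic_sig_tendsto_S[OF assms] AE_dyadic_sig_product_defect_tendsto_0[OF assms words]
    show ?thesis
    proof eventually_elim
      case (elim \<omega>)
      have "(\<lambda>n. dyadic_sig t n u \<omega> * dyadic_sig t n v \<omega>
          - pairing (\<lambda>w. dyadic_sig t n w \<omega>) (wstar u v))
          \<longlonglongrightarrow> S u t \<omega> * S v t \<omega> - pairing (\<lambda>w. S w t \<omega>) (wstar u v)"
        using elim(1) words
        by (intro tendsto_diff tendsto_mult tendsto_pairing[where A="{0..d}"] lc_over_wstar) auto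
      from LIMSEQ_unique[OF this elim(2)] show ?case by simp
    qed
  qed auto
  then show ?thesis unfolding star_character_def S_Nil by (simp add: AE_all_countable)
qed

lemma S_square_integrable:
  assumes "0 < t" "set I \<subseteq> {0..d}"
  shows "integrable M (\<lambda>\<omega>. (S I t \<omega>)\<^sup>2)"
proof -
  have D: "finite_moments (dyadic_sig t 0 I)" by (rule finite_moments_dyadic_sig[OF assms])
  have "integrable M (\<lambda>\<omega>. (dyadic_sig t 0 I \<omega> + (S I t \<omega> - dyadic_sig t 0 I \<omega>))\<^sup>2)"
    using dyadic_sig_diff_S_square_integrable[OF assms, of 0] finite_moments_measurable[OF D] assms
    by (intro integrable_square_add finite_moments_square_integrable[OF D] borel_measurable_diff
        S_measurable)
      (auto simp: power2_commute)
  then show ?thesis by simp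
qed

lemma
  assumes "0 < t" "lc_over {0..d} x"
  shows pairing_S_measurable: "(\<lambda>\<omega>. pairing (\<lambda>w. S w t \<omega>) x) \<in> borel_measurable M"
    and pairing_S_square_integrable: "integrable M (\<lambda>\<omega>. (pairing (\<lambda>w. S w t \<omega>) x)\<^sup>2)"
proof -
  have "(\<lambda>\<omega>. pairing (\<lambda>w. S w t \<omega>) x) \<in> borel_measurable M
      \<and> integrable M (\<lambda>\<omega>. (pairing (\<lambda>w. S w t \<omega>) x)\<^sup>2)"
    using assms(2)
  proof (induction x)
    case (Cons p x)
    obtain r w where p: "p = (r, w)" by (cases p)
    have w: "set w \<subseteq> {0..d}" "lc_over {0..d} x" using Cons.prems p by auto
    have "(\<lambda>\<omega>. r * S w t \<omega>) \<in> borel_measurable M" "integrable M (\<lambda>\<omega>. (r * S w t \<omega>)\<^sup>2)"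
      using S_measurable[OF w(1), of t] S_square_integrable[OF assms(1) w(1)] assms(1)
      by (auto simp: power_mult_distrib)
    then show ?case using Cons.IH[OF w(2)] by (auto simp: p intro: integrable_square_add)
  qed simp
  then show "(\<lambda>\<omega>. pairing (\<lambda>w. S w t \<omega>) x) \<in> borel_measurable M"
    and "integrable M (\<lambda>\<omega>. (pairing (\<lambda>w. S w t \<omega>) x)\<^sup>2)" by auto
qed

text \<open>Powers of a character are again linear in it, so square integrability yields all moments.\<close>

lemma finite_moments_S:
  assumes t: "0 < t" and I: "set I \<subseteq> {0..d}"
  shows "finite_moments (S I t)"
proof (rule finite_moments_if_even_powers_integrable)
  show [measurable]: "S I t \<in> borel_measurable M" using S_measurable[OF I] t by simp
  fix n
  let ?x = "star_power_mult [(1, I)] n [(1, [])]"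
  have x: "lc_over {0..d} ?x" using I by (intro lc_over_star_power_mult) auto
  show "integrable M (\<lambda>\<omega>. S I t \<omega> ^ (2 * n))"
  proof (rule integrable_cong_AE_imp[OF pairing_S_square_integrable[OF t x]])
    show "AE \<omega> in M. (pairing (\<lambda>w. S w t \<omega>) ?x)\<^sup>2 = S I t \<omega> ^ (2 * n)"
      using AE_star_character_S[OF t]
      by eventually_elim
          (simp add: pairing_star_power_mult I S_Nil power_mult[symmetric] mult.commute)
  qed measurable
qed

lemma finite_moments_pairing_S:
  assumes "0 < t" "lc_over {0..d} x"
  shows "finite_moments (\<lambda>\<omega>. pairing (\<lambda>w. S w t \<omega>) x)"
proof -
  have "finite_moments (\<lambda>\<omega>. fst p * S (snd p) t \<omega>)" if "p \<in> set x" for p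
    using that assms unfolding lc_over_def case_prod_unfold
    by (intro finite_moments_mult finite_moments_const finite_moments_S) blast+
  then show ?thesis
    unfolding pairing_def case_prod_unfold by (rule finite_moments_sum_list)
qed

subsection \<open>Expectation of the signature\<close>

lemma expectation_dyadic_sig_tendsto:
  assumes "0 < t" "set I \<subseteq> {0..d}"
  shows "(\<lambda>n. expectation (dyadic_sig t n I)) \<longlonglongrightarrow> expectation (S I t)"
proof -
  obtain K where K: "\<And>n. mean_square (\<lambda>\<omega>. dyadic_sig t n I \<omega> - S I t \<omega>) \<le> K * (1/2) ^ n"
    using mean_square_dyadic_sig_diff_S_le[OF assms] by blast
  have fm: "finite_moments (dyadic_sig t n I)" "finite_moments (S I t)" for n
    using finite_moments_dyadic_sig finite_moments_S assms by auto
  have bound: "(expectation (dyadic_sig t n I) - expectation (S I t))\<^sup>2 \<le> K * (1/2) ^ n" for n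
  proof -
    note diff = finite_moments_diff[OF fm]
    have diff_expectation: "expectation (dyadic_sig t n I) - expectation (S I t) =
        expectation (\<lambda>\<omega>. dyadic_sig t n I \<omega> - S I t \<omega>)"
      using fm[THEN finite_moments_integrable] by simp
    show ?thesis
      unfolding diff_expectation
      by (rule order_trans[OF expectation_power2_le K]; intro finite_moments_measurable
          finite_moments_square_integrable diff)
  qed
  have null: "(\<lambda>n. K * (1/2) ^ n) \<longlonglongrightarrow> 0"
    by (intro tendsto_mult_right_zero LIMSEQ_realpow_zero) auto
  have "(\<lambda>n. (expectation (dyadic_sig t n I) - expectation (S I t))\<^sup>2) \<longlonglongrightarrow> 0"
    by (rule tendsto_sandwich[OF _ _ tendsto_const null])
      (intro always_eventually allI bound zero_le_power2)+
  then have "(\<lambda>n. expectation (dyadic_sig t n I) - expectation (S I t)) \<longlonglongrightarrow> 0"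
    by (auto dest!: tendsto_real_sqrt simp: tendsto_rabs_zero_iff)
  then show ?thesis by (rule LIM_zero_cancel)
qed

end

lemma binomial_over_power_tendsto: "(\<lambda>k. real (k choose n) / real k ^ n) \<longlonglongrightarrow> 1 / fact n"
proof -
  have "(\<lambda>k. (\<Prod>i<n. 1 - real i / real k) / fact n) \<longlonglongrightarrow> (\<Prod>i<n. 1 - 0) / fact n"
    by (intro tendsto_intros lim_const_over_n) auto
  moreover have "\<forall>\<^sub>F k in sequentially. (\<Prod>i<n. 1 - real i / real k) / fact n =
      real (k choose n) / real k ^ n"
    using eventually_gt_at_top[of 0]
  proof eventually_elim
    case (elim k)
    then have "(\<Prod>i<n. 1 - real i / real k) = (\<Prod>i<n. (real k - real i) / real k)"
      by (intro prod.cong) (auto simp: diff_divide_distrib)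
    also have "\<dots> = (\<Prod>i<n. real k - real i) / real k ^ n" by (simp add: prod_dividef)
    finally show ?case
      by (simp add: binomial_gbinomial gbinomial_prod_rev lessThan_atLeast0)
  qed
  ultimately show ?thesis by (simp add: tendsto_cong)
qed

context ito_signature begin

lemma expectation_S:
  assumes t: "0 < t" and I: "set I \<subseteq> {0..d}"
  shows "expectation (S I t) = (if set I \<subseteq> {0} then t ^ length I / fact (length I) else 0)"
proof -
  let ?n = "length I"
  have dyadic: "expectation (dyadic_sig t n I) =
      (if set I \<subseteq> {0} then t ^ ?n * (real (2 ^ n choose ?n) / real (2 ^ n) ^ ?n) else 0)" for n
    using expectation_grid_sig[of "t / 2 ^ n" "rev I" "2 ^ n"] t I
    by (simp add: dyadic_sig_def power_divide)
  have "(\<lambda>n. t ^ ?n * (real (2 ^ n choose ?n) / real (2 ^ n) ^ ?n)) \<longlonglongrightarrow> t ^ ?n * (1 / fact ?n)"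
    by (intro tendsto_mult tendsto_const filterlim_compose[OF binomial_over_power_tendsto]
        filterlim_subseq strict_monoI_Suc) auto
  then have "(\<lambda>n. expectation (dyadic_sig t n I)) \<longlonglongrightarrow> (if set I \<subseteq> {0} then t ^ ?n / fact ?n else 0)"
    unfolding dyadic by simp
  with expectation_dyadic_sig_tendsto[OF t I] show ?thesis by (rule LIMSEQ_unique)
qed

lemma expectation_pairing_S:
  assumes "0 < t" "lc_over {0..d} x"
  shows "expectation (\<lambda>\<omega>. pairing (\<lambda>w. S w t \<omega>) x) = poly (mean_poly x) t"
  unfolding poly_mean_poly using assms(2)
proof (induction x)
  case (Cons p x)
  obtain r w where p: "p = (r, w)" by (cases p)
  have w: "set w \<subseteq> {0..d}" "lc_over {0..d} x" using Cons.prems p by auto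
  have "integrable M (S w t)" "integrable M (\<lambda>\<omega>. pairing (\<lambda>w. S w t \<omega>) x)"
    using finite_moments_S finite_moments_pairing_S assms(1) w
    by (auto intro: finite_moments_integrable)
  then show ?case using Cons.IH w expectation_S[OF assms(1) w(1)] by (simp add: p)
qed simp

text \<open>An algebraic fact with a probabilistic proof: almost surely the signature is a character,
  so the two linear combinations have the same expected signature at every time.\<close>

lemma mean_poly_cong:
  assumes x: "lc_over {0..d} x" and y: "lc_over {0..d} y"
    and eq: "\<And>s. star_character d s \<Longrightarrow> pairing s x = pairing s y"
  shows "mean_poly x = mean_poly y"
proof -
  have "poly (mean_poly x) t = poly (mean_poly y) t" if t: "0 < t" for t
  proof -
    have "AE \<omega> in M. pairing (\<lambda>w. S w t \<omega>) x = pairing (\<lambda>w. S w t \<omega>) y"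
      using AE_star_character_S[OF t] by eventually_elim (rule eq)
    then have "expectation (\<lambda>\<omega>. pairing (\<lambda>w. S w t \<omega>) x) =
        expectation (\<lambda>\<omega>. pairing (\<lambda>w. S w t \<omega>) y)"
      by (intro integral_cong_AE pairing_S_measurable t x y)
    then show ?thesis by (simp add: expectation_pairing_S t x y)
  qed
  then have "{0<..} \<subseteq> {t. poly (mean_poly x - mean_poly y) t = 0}" by auto
  then have "infinite {t. poly (mean_poly x - mean_poly y) t = 0}"
    using infinite_Ioi[of "0::real"] finite_subset by blast
  then have "mean_poly x - mean_poly y = 0" using poly_roots_finite by blast
  then show ?thesis by simp
qed

end

subsection \<open>Moments of the centred signature\<close>

definition index_seqs :: "nat \<Rightarrow> nat list set" where
  "index_seqs n = {ks. length ks = n \<and> set ks \<subseteq> {0..2}}"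

lemma finite_index_seqs: "finite (index_seqs n)"
  unfolding index_seqs_def using finite_lists_length_eq[of "{0..2::nat}" n]
  by (simp add: conj_commute)

lemma index_seqs_0: "index_seqs 0 = {[]}"
  by (auto simp: index_seqs_def)

lemma sum_index_seqs_Suc:
  "(\<Sum>ks\<in>index_seqs (Suc n). g ks) =
    (\<Sum>ks\<in>index_seqs n. g (0 # ks)) + (\<Sum>ks\<in>index_seqs n. g (1 # ks))
      + (\<Sum>ks\<in>index_seqs n. g (2 # ks))"
  for g :: "nat list \<Rightarrow> 'b::comm_monoid_add"
proof -
  have "{0..2::nat} = {0, 1, 2}" by auto
  then have eq: "index_seqs (Suc n) = (Cons 0 ` index_seqs n \<union> Cons 1 ` index_seqs n)
      \<union> Cons 2 ` index_seqs n"
    by (auto simp: index_seqs_def length_Suc_conv image_iff)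
  show ?thesis
    unfolding eq by (subst sum.union_disjoint, (auto simp: finite_index_seqs)[3])+
        (simp add: sum.reindex)
qed

lemma sum_list_index_seqs_le: "ks \<in> index_seqs n \<Longrightarrow> sum_list ks \<le> 2 * n"
  using sum_list_mono[of ks "\<lambda>x. x" "\<lambda>_. 2"] by (auto simp: index_seqs_def sum_list_triv subset_iff)

definition expansion_coeff :: "nat \<Rightarrow> nat \<Rightarrow> (nat list \<Rightarrow> real) \<Rightarrow> nat \<Rightarrow> nat \<Rightarrow> lc \<Rightarrow> real" where
  "expansion_coeff d L cf n m x =
     (\<Sum>ks\<in>index_seqs n. of_bool (sum_list ks = m) * emptycoef (Gseq d L cf ks x))"

lemma expansion_coeff_eq_0: "2 * n < m \<Longrightarrow> expansion_coeff d L cf n m x = 0"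
  unfolding expansion_coeff_def by (intro sum.neutral) (use sum_list_index_seqs_le in fastforce)

lemma expansion_coeff_0: "expansion_coeff d L cf 0 m x = of_bool (m = 0) * emptycoef x"
  by (simp add: expansion_coeff_def index_seqs_0 Gseq_def)

lemma fact_mult_expansion_coeff_Suc:
  "fact m * expansion_coeff d L cf (Suc n) m x =
    fact m * expansion_coeff d L cf n m (G0 x)
    + real m * (fact (m - 1) * expansion_coeff d L cf n (m - 1) (G1 d L cf x))
    + real m * real (m - 1) * (fact (m - 2) * expansion_coeff d L cf n (m - 2) (G2 d L cf x))"
proof -
  have one: "fact m * of_bool (1 + q = m) = real m * (fact (m - 1) * of_bool (q = m - 1))" for q
    by (cases m) auto
  have two: "fact m * of_bool (2 + q = m) =
      real m * real (m - 1) * (fact (m - 2) * of_bool (q = m - 2))" for q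
  proof (cases m)
    case (Suc k)
    then show ?thesis by (cases k) (auto simp: algebra_simps)
  qed simp
  have "fact m * expansion_coeff d L cf (Suc n) m x =
      (\<Sum>ks\<in>index_seqs n. fact m * of_bool (sum_list ks = m) * emptycoef (Gseq d L cf ks (G0 x)))
      + (\<Sum>ks\<in>index_seqs n. fact m * of_bool (1 + sum_list ks = m)
          * emptycoef (Gseq d L cf ks (G1 d L cf x)))
      + (\<Sum>ks\<in>index_seqs n. fact m * of_bool (2 + sum_list ks = m)
          * emptycoef (Gseq d L cf ks (G2 d L cf x)))"
    unfolding expansion_coeff_def sum_index_seqs_Suc
    by (simp add: Gseq_def Gk_def distrib_left sum_distrib_left mult.assoc)
  then show ?thesis
    unfolding one two by (simp add: expansion_coeff_def sum_distrib_left mult.assoc)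
qed

context ito_signature begin

definition moment_poly :: "nat \<Rightarrow> (nat list \<Rightarrow> real) \<Rightarrow> nat \<Rightarrow> lc \<Rightarrow> real poly" where
  "moment_poly L cf m x = mean_poly (star_power_mult (centred_lc d L cf) m x)"

lemma lc_over_star_power_mult_centred_lc:
  "lc_over {0..d} x \<Longrightarrow> lc_over {0..d} (star_power_mult (centred_lc d L cf) m x)"
  by (intro lc_over_star_power_mult lc_over_centred_lc) auto

text \<open>This is Dynkin's formula for the expectation of \<open>\<langle>c - c\<^sub>\<emptyset>, W\<rangle>\<^sup>m \<langle>x, W\<rangle>\<close>.\<close>

lemma pderiv_moment_poly:
  assumes x: "lc_over {0..d} x"
  shows "pderiv (moment_poly L cf m x) =
    moment_poly L cf m (G0 x)
    + Polynomial.smult (real m) (moment_poly L cf (m - 1) (G1 d L cf x))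
    + Polynomial.smult (real m * real (m - 1)) (moment_poly L cf (m - 2) (G2 d L cf x))"
proof -
  let ?P = "star_power_mult (centred_lc d L cf)"
  note over = lc_over_G0[OF x] lc_over_G1[OF x] lc_over_G2[OF x]
  have "mean_poly (G0 (?P m x)) =
      mean_poly (?P m (G0 x) @ lscale (real m) (?P (m - 1) (G1 d L cf x))
      @ lscale (real m * real (m - 1)) (?P (m - 2) (G2 d L cf x)))"
  proof (rule mean_poly_cong)
    show "lc_over {0..d} (G0 (?P m x))"
      by (intro lc_over_G0 lc_over_star_power_mult_centred_lc x)
    show "lc_over {0..d} (?P m (G0 x) @ lscale (real m) (?P (m - 1) (G1 d L cf x))
        @ lscale (real m * real (m - 1)) (?P (m - 2) (G2 d L cf x)))"
      by (simp add: lc_over_lscale lc_over_star_power_mult_centred_lc over)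
    fix s assume s: "star_character d s"
    show "pairing s (G0 (?P m x)) =
        pairing s (?P m (G0 x) @ lscale (real m) (?P (m - 1) (G1 d L cf x))
        @ lscale (real m * real (m - 1)) (?P (m - 2) (G2 d L cf x)))"
      unfolding pairing_G0_star_power_mult_centred_lc[OF s x]
      by (simp add: pairing_lscale pairing_star_power_mult[OF s _ lc_over_centred_lc] over)
  qed
  then show ?thesis
    by (simp add: moment_poly_def pderiv_mean_poly mean_poly_append mean_poly_lscale add.assoc)
qed

lemma poly_moment_poly_0:
  assumes "lc_over {0..d} x" shows "poly (moment_poly L cf m x) 0 = of_bool (m = 0) * emptycoef x"
  unfolding moment_poly_def poly_mean_poly_0 emptycoef_eq_pairing
    pairing_star_power_mult[OF star_character_emptycoef assms lc_over_centred_lc]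
  unfolding emptycoef_eq_pairing[symmetric] emptycoef_centred_lc by (simp add: power_0_left)

lemma higher_pderiv_moment_poly_0:
  assumes "lc_over {0..d} x"
  shows "poly ((pderiv ^^ n) (moment_poly L cf m x)) 0 = fact m * expansion_coeff d L cf n m x"
  using assms
proof (induction n arbitrary: m x)
  case 0
  then show ?case by (cases "m = 0") (simp_all add: poly_moment_poly_0 expansion_coeff_0)
next
  case (Suc n)
  note IH = Suc.IH[OF lc_over_G0[OF Suc.prems]] Suc.IH[OF lc_over_G1[OF Suc.prems]]
    Suc.IH[OF lc_over_G2[OF Suc.prems]]
  have "(pderiv ^^ Suc n) (moment_poly L cf m x) = (pderiv ^^ n) (pderiv (moment_poly L cf m x))"
    by (simp only: funpow_Suc_right comp_def)
  then show ?case
    unfolding pderiv_moment_poly[OF Suc.prems] fact_mult_expansion_coeff_Suc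
    by (simp add: higher_pderiv_add higher_pderiv_smult IH)
qed

lemma coeff_moment_poly:
  "Polynomial.coeff (moment_poly L cf m [(1, [])]) n =
      fact m / fact n * expansion_coeff d L cf n m [(1, [])]"
  using higher_pderiv_moment_poly_0[of "[(1, [])]" n L cf m]
  by (simp add: poly_0_coeff_0 coeff_higher_pderiv pochhammer_fact[symmetric] field_simps)

definition centred_sig :: "nat \<Rightarrow> (nat list \<Rightarrow> real) \<Rightarrow> real \<Rightarrow> 'a \<Rightarrow> real" where
  "centred_sig L cf t \<omega> = pairing (\<lambda>w. S w t \<omega>) (centred_lc d L cf)"

lemma sum_words_eq_centred_sig: "(\<Sum>I\<leftarrow>words d L. cf I * S I t \<omega>) = cf [] + centred_sig L cf t \<omega>"
  by (simp add: centred_sig_def pairing_centred_lc pairing_coeff_lc S_Nil)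

lemma finite_moments_centred_sig: "0 < t \<Longrightarrow> finite_moments (centred_sig L cf t)"
  unfolding centred_sig_def[abs_def] by (intro finite_moments_pairing_S lc_over_centred_lc)

lemma expectation_centred_sig_power:
  assumes t: "0 < t"
  shows "expectation (\<lambda>\<omega>. centred_sig L cf t \<omega> ^ m) = poly (moment_poly L cf m [(1, [])]) t"
proof -
  let ?x = "star_power_mult (centred_lc d L cf) m [(1, [])]"
  have x: "lc_over {0..d} ?x" by (intro lc_over_star_power_mult_centred_lc) simp
  have "AE \<omega> in M. centred_sig L cf t \<omega> ^ m = pairing (\<lambda>w. S w t \<omega>) ?x"
    using AE_star_character_S[OF t]
    by eventually_elim (simp add: centred_sig_def pairing_star_power_mult lc_over_centred_lc S_Nil)
  then have "expectation (\<lambda>\<omega>. centred_sig L cf t \<omega> ^ m) =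
      expectation (\<lambda>\<omega>. pairing (\<lambda>w. S w t \<omega>) ?x)"
    by (intro integral_cong_AE pairing_S_measurable t x finite_moments_measurable
        finite_moments_power finite_moments_centred_sig)
  then show ?thesis unfolding expectation_pairing_S[OF t x] moment_poly_def .
qed

end

subsection \<open>Asymptotics of polynomials at the origin\<close>

lemma smallo_const_mult: "f \<in> o[F](g) \<Longrightarrow> (\<lambda>x. c * f x) \<in> o[F](g)" for f :: "_ \<Rightarrow> real"
  by (cases "c = 0") simp_all

lemma power_smallo_at_right_0: "N < n \<Longrightarrow> (\<lambda>t::real. t ^ n) \<in> o[at_right 0](\<lambda>t. t ^ N)"
proof (rule smalloI_tendsto)
  assume "N < n"
  have "((\<lambda>t::real. t ^ (n - N)) \<longlongrightarrow> 0 ^ (n - N)) (at_right 0)" by (intro tendsto_intros)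
  then have "((\<lambda>t::real. t ^ (n - N)) \<longlongrightarrow> 0) (at_right 0)" using \<open>N < n\<close> by (simp add: power_0_left)
  moreover have "\<forall>\<^sub>F t::real in at_right 0. t ^ (n - N) = t ^ n / t ^ N"
    using eventually_at_right_less[of "0::real"]
    by eventually_elim (use \<open>N < n\<close> in \<open>simp add: power_diff\<close>)
  ultimately show "((\<lambda>t::real. t ^ n / t ^ N) \<longlongrightarrow> 0) (at_right 0)" by (rule Lim_transform_eventually)
  show "\<forall>\<^sub>F t::real in at_right 0. t ^ N \<noteq> 0"
    using eventually_at_right_less[of "0::real"] by eventually_elim simp
qed

lemma power_bigo_at_right_0: "N \<le> n \<Longrightarrow> (\<lambda>t::real. t ^ n) \<in> O[at_right 0](\<lambda>t. t ^ N)"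
  using power_smallo_at_right_0[of N n] by (cases "N = n") (auto intro: landau_o.small_imp_big)

lemma poly_minus_truncation_smallo:
  fixes p :: "real poly"
  shows "(\<lambda>t. poly p t - (\<Sum>n\<le>N. Polynomial.coeff p n * t ^ n)) \<in> o[at_right 0](\<lambda>t. t ^ N)"
proof -
  define B where "B = max N (Polynomial.degree p)"
  have "poly p t - (\<Sum>n\<le>N. Polynomial.coeff p n * t ^ n) =
      (\<Sum>n\<in>{N<..B}. Polynomial.coeff p n * t ^ n)" for t
  proof -
    have "poly p t = (\<Sum>n\<le>B. Polynomial.coeff p n * t ^ n)"
      unfolding poly_altdef by (rule sum.mono_neutral_left) (auto simp: B_def coeff_eq_0)
    moreover have "{..B} = {..N} \<union> {N<..B}" by (auto simp: B_def)
    moreover have "(\<Sum>n\<in>{..N} \<union> {N<..B}. Polynomial.coeff p n * t ^ n) =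
        (\<Sum>n\<le>N. Polynomial.coeff p n * t ^ n) + (\<Sum>n\<in>{N<..B}. Polynomial.coeff p n * t ^ n)"
      by (rule sum.union_disjoint) auto
    ultimately show ?thesis by simp
  qed
  moreover have "(\<lambda>t. Polynomial.coeff p n * t ^ n) \<in> o[at_right 0](\<lambda>t. t ^ N)"
    if "n \<in> {N<..B}" for n
    using that by (intro smallo_const_mult power_smallo_at_right_0) simp
  ultimately show ?thesis by (simp only: big_sum_in_smallo)
qed

lemma poly_bigo_if_low_coeffs_0:
  fixes p :: "real poly"
  assumes "\<And>n. n < m \<Longrightarrow> Polynomial.coeff p n = 0"
  shows "poly p \<in> O[at_right 0](\<lambda>t. t ^ m)"
proof -
  have "(\<lambda>t. Polynomial.coeff p n * t ^ n) \<in> O[at_right 0](\<lambda>t. t ^ m)" for n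
    using assms[of n] power_bigo_at_right_0[of m n] by (cases "n < m") auto
  then show ?thesis
    unfolding poly_altdef[abs_def] by (intro big_sum_in_bigo)
qed

lemma (in ito_signature) even_moment_centred_sig_bigo:
  "(\<lambda>t. expectation (\<lambda>\<omega>. centred_sig L cf t \<omega> ^ (2 * m))) \<in> O[at_right 0](\<lambda>t. t ^ m)"
proof -
  have "poly (moment_poly L cf (2 * m) [(1, [])]) \<in> O[at_right 0](\<lambda>t. t ^ m)"
    by (intro poly_bigo_if_low_coeffs_0) (simp add: coeff_moment_poly expansion_coeff_eq_0)
  moreover have "\<forall>\<^sub>F t in at_right 0. expectation (\<lambda>\<omega>. centred_sig L cf t \<omega> ^ (2 * m)) =
      poly (moment_poly L cf (2 * m) [(1, [])]) t"
    using eventually_at_right_less[of "0::real"]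
    by eventually_elim (rule expectation_centred_sig_power)
  ultimately show ?thesis by (subst landau_o.big.in_cong) auto
qed

subsection \<open>Taylor expansion in expectation\<close>

lemma Ckp_continuous:
  assumes "Ckp k f" "j \<le> k" shows "continuous_on UNIV ((deriv ^^ j) f)"
proof (cases "j = k")
  case False
  with assms have "((deriv ^^ j) f has_real_derivative (deriv ^^ Suc j) f x) (at x)" for x
    unfolding Ckp_def by simp
  then have "isCont ((deriv ^^ j) f) x" for x by (rule DERIV_isCont)
  then show ?thesis by (simp add: continuous_on_eq_continuous_at)
qed (use assms in \<open>auto simp: Ckp_def\<close>)

lemma Ckp_measurable: "Ckp k f \<Longrightarrow> f \<in> borel_measurable borel"
  using Ckp_continuous[of k f 0] by (intro borel_measurable_continuous_onI) simp

lemma Ckp_growth: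
  "Ckp k f \<Longrightarrow> j \<le> k \<Longrightarrow> \<exists>C>0. \<exists>p. \<forall>x. \<bar>(deriv ^^ j) f x\<bar> \<le> C * (1 + \<bar>x\<bar> ^ p)"
  unfolding Ckp_def by blast

lemma Ckp_Taylor:
  assumes "Ckp k f"
  shows "\<exists>\<xi>. \<bar>\<xi> - x\<bar> \<le> \<bar>y\<bar> \<and> f (x + y) = (\<Sum>m\<le>k. (deriv ^^ m) f x / fact m * y ^ m)
    + ((deriv ^^ k) f \<xi> - (deriv ^^ k) f x) / fact k * y ^ k"
proof (cases "k = 0 \<or> y = 0")
  case True
  have "(\<Sum>m\<le>k. (deriv ^^ m) f x / fact m * 0 ^ m) = f x"
    using sum.remove[of "{..k}" 0 "\<lambda>m. (deriv ^^ m) f x / fact m * 0 ^ m"]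
    by (simp add: power_0_left)
  then show ?thesis using True by (intro exI[of _ "x + y"]) auto
next
  case False
  have "\<exists>t. (if x + y < x then x + y < t \<and> t < x else x < t \<and> t < x + y) \<and>
      f (x + y) = (\<Sum>m<k. (deriv ^^ m) f x / fact m * (x + y - x) ^ m)
        + (deriv ^^ k) f t / fact k * (x + y - x) ^ k"
    by (rule Taylor[where a="x - \<bar>y\<bar>" and b="x + \<bar>y\<bar>"])
      (use False assms in \<open>auto simp: Ckp_def abs_if split: if_splits\<close>)
  then obtain \<xi> where \<xi>: "if x + y < x then x + y < \<xi> \<and> \<xi> < x else x < \<xi> \<and> \<xi> < x + y"
    "f (x + y) = (\<Sum>m<k. (deriv ^^ m) f x / fact m * y ^ m) + (deriv ^^ k) f \<xi> / fact k * y ^ k"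
    by auto
  have "(\<Sum>m\<le>k. (deriv ^^ m) f x / fact m * y ^ m) =
      (\<Sum>m<k. (deriv ^^ m) f x / fact m * y ^ m) + (deriv ^^ k) f x / fact k * y ^ k"
    by (simp add: lessThan_Suc_atMost[symmetric])
  then show ?thesis using \<xi> by (intro exI[of _ \<xi>]) (auto simp: field_simps split: if_splits)
qed

lemma polynomial_growth_increment_le:
  fixes g :: "real \<Rightarrow> real"
  assumes "0 < C" and growth: "\<And>z. \<bar>g z\<bar> \<le> C * (1 + \<bar>z\<bar> ^ p)"
  shows "\<exists>K\<ge>0. \<forall>\<xi> y. \<bar>\<xi> - x\<bar> \<le> \<bar>y\<bar> \<longrightarrow> \<bar>g \<xi> - g x\<bar> \<le> K * (1 + y ^ (2 * p))"
proof (intro exI[of _ "2 * C * (1 + 2 ^ p * (\<bar>x\<bar> ^ p + 1))"] conjI allI impI)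
  fix \<xi> y :: real assume \<xi>: "\<bar>\<xi> - x\<bar> \<le> \<bar>y\<bar>"
  let ?B = "1 + 2 ^ p * (\<bar>x\<bar> ^ p + 1)"
  have even_power: "0 \<le> y ^ (2 * p)" by (rule zero_le_even_power) simp
  have bound: "\<bar>g z\<bar> \<le> C * (?B * (1 + y ^ (2 * p)))" if z: "\<bar>z - x\<bar> \<le> \<bar>y\<bar>" for z
  proof -
    have "\<bar>z\<bar> ^ p \<le> 2 ^ p * (\<bar>x\<bar> ^ p + \<bar>z - x\<bar> ^ p)"
      using abs_add_power_le[of x "z - x" p] by simp
    also have "\<dots> \<le> 2 ^ p * (\<bar>x\<bar> ^ p + (1 + y ^ (2 * p)))"
      using power_mono[OF z, of p] abs_power_le_one_plus_even_power[of y p]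
      by (intro mult_left_mono add_left_mono) auto
    also have "\<dots> \<le> 2 ^ p * ((\<bar>x\<bar> ^ p + 1) * (1 + y ^ (2 * p)))"
      using even_power by (intro mult_left_mono) (auto simp: algebra_simps)
    finally have "1 + \<bar>z\<bar> ^ p \<le> ?B * (1 + y ^ (2 * p))"
      using even_power by (simp add: algebra_simps)
    then show ?thesis
      using order_trans[OF growth[of z] mult_left_mono[OF _ less_imp_le[OF \<open>0 < C\<close>]]] by blast
  qed
  have "\<bar>g \<xi> - g x\<bar> \<le> \<bar>g \<xi>\<bar> + \<bar>g x\<bar>" by (rule abs_triangle_ineq4)
  also have "\<dots> \<le> 2 * (C * (?B * (1 + y ^ (2 * p))))"
    using bound[OF \<xi>] bound[of x] by simp
  finally show "\<bar>g \<xi> - g x\<bar> \<le> 2 * C * ?B * (1 + y ^ (2 * p))" by (simp only: mult.assoc)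
qed (use \<open>0 < C\<close> in simp)

lemma continuous_polynomial_growth_increment_le:
  fixes g :: "real \<Rightarrow> real"
  assumes "isCont g x" "0 < C" "\<And>z. \<bar>g z\<bar> \<le> C * (1 + \<bar>z\<bar> ^ p)" "0 < \<epsilon>"
  shows "\<exists>K\<ge>0. \<forall>\<xi> y. \<bar>\<xi> - x\<bar> \<le> \<bar>y\<bar> \<longrightarrow> \<bar>g \<xi> - g x\<bar> \<le> \<epsilon> + K * (y ^ 2 + y ^ (2 * (1 + p)))"
proof -
  obtain \<delta> where \<delta>: "0 < \<delta>" "\<And>z. \<bar>z - x\<bar> < \<delta> \<Longrightarrow> \<bar>g z - g x\<bar> < \<epsilon>"
    using assms(1,4) by (force simp: continuous_at_eps_delta dist_real_def)
  obtain K where K: "0 \<le> K" "\<And>\<xi> y. \<bar>\<xi> - x\<bar> \<le> \<bar>y\<bar> \<Longrightarrow> \<bar>g \<xi> - g x\<bar> \<le> K * (1 + y ^ (2 * p))"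
    using polynomial_growth_increment_le[OF assms(2,3)] by blast
  show ?thesis
  proof (intro exI[of _ "K / \<delta>\<^sup>2"] conjI allI impI)
    fix \<xi> y assume \<xi>: "\<bar>\<xi> - x\<bar> \<le> \<bar>y\<bar>"
    have nonneg: "0 \<le> K / \<delta>\<^sup>2 * (y ^ 2 + y ^ (2 * (1 + p)))"
      using K(1) by (intro mult_nonneg_nonneg add_nonneg_nonneg zero_le_even_power) auto
    show "\<bar>g \<xi> - g x\<bar> \<le> \<epsilon> + K / \<delta>\<^sup>2 * (y ^ 2 + y ^ (2 * (1 + p)))"
    proof (cases "\<bar>y\<bar> < \<delta>")
      case True
      then show ?thesis using \<delta>(2)[of \<xi>] \<xi> nonneg by linarith
    next
      case False
      have "\<delta>\<^sup>2 \<le> \<bar>y\<bar>\<^sup>2" using False \<delta>(1) by (intro power_mono) auto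
      then have "1 \<le> y\<^sup>2 / \<delta>\<^sup>2" using \<delta>(1) by simp
      moreover have "0 \<le> K * (1 + y ^ (2 * p))" using K(1) zero_le_even_power[of "2 * p" y] by simp
      ultimately have "K * (1 + y ^ (2 * p)) \<le> K * (1 + y ^ (2 * p)) * (y\<^sup>2 / \<delta>\<^sup>2)"
        using mult_left_mono by fastforce
      also have "\<dots> = K / \<delta>\<^sup>2 * (y ^ 2 + y ^ (2 * (1 + p)))"
        by (simp add: algebra_simps power_add power2_eq_square add_divide_distrib)
      finally show ?thesis using K(2)[OF \<xi>] assms(4) by linarith
    qed
  qed (use K(1) in simp)
qed

lemma Ckp_Taylor_remainder_le:
  assumes f: "Ckp (2 * N) f" and "0 < \<epsilon>"
  shows "\<exists>K\<ge>0. \<exists>p. \<forall>y. \<bar>f (x + y) - (\<Sum>m\<le>2*N. (deriv ^^ m) f x / fact m * y ^ m)\<bar>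
     \<le> \<epsilon> * y ^ (2 * N) + K * (y ^ (2 * (N + 1)) + y ^ (2 * (N + 1 + p)))"
proof -
  let ?g = "(deriv ^^ (2 * N)) f"
  obtain C p where C: "0 < C" "\<And>z. \<bar>?g z\<bar> \<le> C * (1 + \<bar>z\<bar> ^ p)"
    using Ckp_growth[OF f order_refl] by blast
  have "isCont ?g x"
    using Ckp_continuous[OF f order_refl] by (simp add: continuous_on_eq_continuous_at)
  then obtain K where K: "0 \<le> K"
    "\<And>\<xi> y. \<bar>\<xi> - x\<bar> \<le> \<bar>y\<bar> \<Longrightarrow> \<bar>?g \<xi> - ?g x\<bar> \<le> \<epsilon> + K * (y ^ 2 + y ^ (2 * (1 + p)))"
    using continuous_polynomial_growth_increment_le[OF _ C \<open>0 < \<epsilon>\<close>] by blast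
  have "\<bar>f (x + y) - (\<Sum>m\<le>2*N. (deriv ^^ m) f x / fact m * y ^ m)\<bar>
      \<le> \<epsilon> * y ^ (2 * N) + K * (y ^ (2 * (N + 1)) + y ^ (2 * (N + 1 + p)))" for y
  proof -
    obtain \<xi> where \<xi>: "\<bar>\<xi> - x\<bar> \<le> \<bar>y\<bar>"
      "f (x + y) = (\<Sum>m\<le>2*N. (deriv ^^ m) f x / fact m * y ^ m)
          + (?g \<xi> - ?g x) / fact (2 * N) * y ^ (2 * N)"
      using Ckp_Taylor[OF f] by blast
    have even_power: "0 \<le> y ^ (2 * N)" by (simp add: power_mult)
    have "\<bar>f (x + y) - (\<Sum>m\<le>2*N. (deriv ^^ m) f x / fact m * y ^ m)\<bar> =
        \<bar>?g \<xi> - ?g x\<bar> / fact (2 * N) * y ^ (2 * N)"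
      unfolding \<xi>(2) using even_power by (simp add: abs_mult)
    also have "\<dots> \<le> \<bar>?g \<xi> - ?g x\<bar> / 1 * y ^ (2 * N)"
      using even_power by (intro mult_right_mono divide_left_mono) (auto simp: fact_ge_1)
    also have "\<dots> \<le> (\<epsilon> + K * (y ^ 2 + y ^ (2 * (1 + p)))) * y ^ (2 * N)"
      using K(2)[OF \<xi>(1)] even_power by (intro mult_right_mono) auto
    also have "\<dots> = \<epsilon> * y ^ (2 * N) + K * (y ^ (2 * (N + 1)) + y ^ (2 * (N + 1 + p)))"
      by (simp add: algebra_simps power_add power2_eq_square)
    finally show ?thesis .
  qed
  then show ?thesis using K(1) by blast
qed

lemma abs_integral_diff_le:
  fixes f g h :: "'a \<Rightarrow> real"
  assumes "integrable M f" "integrable M g" "integrable M h" "\<And>x. \<bar>f x - g x\<bar> \<le> h x"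
  shows "\<bar>integral\<^sup>L M f - integral\<^sup>L M g\<bar> \<le> integral\<^sup>L M h"
proof -
  have "\<bar>integral\<^sup>L M f - integral\<^sup>L M g\<bar> = \<bar>\<integral>x. f x - g x \<partial>M\<bar>" using assms by simp
  also have "\<dots> \<le> (\<integral>x. \<bar>f x - g x\<bar> \<partial>M)" by (rule integral_abs_bound)
  also have "\<dots> \<le> integral\<^sup>L M h" using assms by (intro integral_mono) auto
  finally show ?thesis .
qed

lemma (in prob_space) expectation_Taylor_remainder_le:
  assumes f: "Ckp (2 * N) f" and "0 < \<epsilon>"
  shows "\<exists>K\<ge>0. \<exists>p. \<forall>Y. finite_moments Y \<longrightarrow>
    \<bar>expectation (\<lambda>\<omega>. f (x + Y \<omega>))
      - (\<Sum>m\<le>2*N. (deriv ^^ m) f x / fact m * expectation (\<lambda>\<omega>. Y \<omega> ^ m))\<bar>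
    \<le> \<epsilon> * expectation (\<lambda>\<omega>. Y \<omega> ^ (2 * N))
      + K * (expectation (\<lambda>\<omega>. Y \<omega> ^ (2 * (N + 1))) + expectation (\<lambda>\<omega>. Y \<omega> ^ (2 * (N + 1 + p))))"
proof -
  obtain K p where K: "0 \<le> K" "\<And>y. \<bar>f (x + y) - (\<Sum>m\<le>2*N. (deriv ^^ m) f x / fact m * y ^ m)\<bar>
     \<le> \<epsilon> * y ^ (2 * N) + K * (y ^ (2 * (N + 1)) + y ^ (2 * (N + 1 + p)))"
    using Ckp_Taylor_remainder_le[OF assms] by blast
  obtain C q where growth: "\<And>z. \<bar>f z\<bar> \<le> C * (1 + \<bar>z\<bar> ^ q)"
    using Ckp_growth[OF f le0] by auto
  have "\<bar>expectation (\<lambda>\<omega>. f (x + Y \<omega>))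
      - (\<Sum>m\<le>2*N. (deriv ^^ m) f x / fact m * expectation (\<lambda>\<omega>. Y \<omega> ^ m))\<bar>
      \<le> \<epsilon> * expectation (\<lambda>\<omega>. Y \<omega> ^ (2 * N))
        + K * (expectation (\<lambda>\<omega>. Y \<omega> ^ (2 * (N + 1))) + expectation (\<lambda>\<omega>. Y \<omega> ^ (2 * (N + 1 + p))))"
    if Y: "finite_moments Y" for Y
  proof -
    let ?P = "\<lambda>\<omega>. \<Sum>m\<le>2*N. (deriv ^^ m) f x / fact m * Y \<omega> ^ m"
    have power: "integrable M (\<lambda>\<omega>. Y \<omega> ^ m)" for m
      by (intro finite_moments_integrable finite_moments_power Y)
    have "integrable M (\<lambda>\<omega>. f (x + Y \<omega>))"
      by (rule integrable_if_polynomial_growth[OF finite_moments_add[OF finite_moments_const Y]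
            Ckp_measurable[OF f] growth])
    then have "\<bar>expectation (\<lambda>\<omega>. f (x + Y \<omega>)) - expectation ?P\<bar>
        \<le> expectation (\<lambda>\<omega>. \<epsilon> * Y \<omega> ^ (2 * N) + K * (Y \<omega> ^ (2 * (N + 1)) + Y \<omega> ^ (2 * (N + 1 + p))))"
      by (rule abs_integral_diff_le) (intro Bochner_Integration.integrable_sum
          Bochner_Integration.integrable_add integrable_mult_right power K(2))+
    then show ?thesis
      by (simp only: power Bochner_Integration.integral_sum Bochner_Integration.integral_add
          Bochner_Integration.integrable_add integrable_mult_right integral_mult_right_zero)
  qed
  then show ?thesis using K(1) by blast
qed

lemma (in prob_space) expectation_Taylor_smallo:
  assumes f: "Ckp (2 * N) f" and Y: "\<And>t::real. 0 < t \<Longrightarrow> finite_moments (Y t)"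
    and moments: "\<And>m. (\<lambda>t. expectation (\<lambda>\<omega>. Y t \<omega> ^ (2 * m))) \<in> O[at_right 0](\<lambda>t. t ^ m)"
  shows "(\<lambda>t. expectation (\<lambda>\<omega>. f (x + Y t \<omega>))
      - (\<Sum>m\<le>2*N. (deriv ^^ m) f x / fact m * expectation (\<lambda>\<omega>. Y t \<omega> ^ m)))
    \<in> o[at_right 0](\<lambda>t. t ^ N)"
proof (rule landau_o.smallI)
  fix c :: real assume c: "0 < c"
  let ?E = "\<lambda>t m. expectation (\<lambda>\<omega>. Y t \<omega> ^ m)"
  obtain C where C: "0 < C" "\<forall>\<^sub>F t in at_right 0. norm (?E t (2 * N)) \<le> C * norm (t ^ N)"
    using landau_o.bigE[OF moments[of N]] by blast
  obtain K p where K: "\<And>Y. finite_moments Y \<Longrightarrow>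
      \<bar>expectation (\<lambda>\<omega>. f (x + Y \<omega>))
        - (\<Sum>m\<le>2*N. (deriv ^^ m) f x / fact m * expectation (\<lambda>\<omega>. Y \<omega> ^ m))\<bar>
      \<le> c / (2 * C) * expectation (\<lambda>\<omega>. Y \<omega> ^ (2 * N))
        + K * (expectation (\<lambda>\<omega>. Y \<omega> ^ (2 * (N + 1))) + expectation (\<lambda>\<omega>. Y \<omega> ^ (2 * (N + 1 + p))))"
    using expectation_Taylor_remainder_le[OF f, of "c / (2 * C)" x] c C(1) by auto
  define tail where "tail t = K * (?E t (2 * (N + 1)) + ?E t (2 * (N + 1 + p)))" for t
  have higher: "(\<lambda>t. ?E t (2 * n)) \<in> o[at_right 0](\<lambda>t. t ^ N)" if "N < n" for n
    using moments power_smallo_at_right_0[OF that] by (rule landau_o.big_small_trans)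
  have "tail \<in> o[at_right 0](\<lambda>t. t ^ N)"
    unfolding tail_def[abs_def] by (intro smallo_const_mult sum_in_smallo(1) higher) auto
  then have "\<forall>\<^sub>F t in at_right 0. norm (tail t) \<le> c / 2 * norm (t ^ N)"
    using c by (intro landau_o.smallD) auto
  with C(2) eventually_at_right_less[of 0]
  show "\<forall>\<^sub>F t in at_right 0. norm (expectation (\<lambda>\<omega>. f (x + Y t \<omega>))
      - (\<Sum>m\<le>2*N. (deriv ^^ m) f x / fact m * ?E t m)) \<le> c * norm (t ^ N)"
  proof eventually_elim
    case (elim t)
    have "c / (2 * C) * ?E t (2 * N) \<le> c / (2 * C) * (C * norm (t ^ N))"
      using elim(1) c C(1) by (intro mult_left_mono) auto
    also have "\<dots> = c / 2 * norm (t ^ N)" using C(1) by simp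
    finally show ?case
      using K[OF Y[OF elim(2)]] elim(3) unfolding tail_def real_norm_def by argo
  qed
qed

context ito_signature begin

lemma expansion_eq_sum_coeff_moment_poly:
  "expansion d L N f cf t = (\<Sum>m\<le>2*N. (deriv ^^ m) f (cf []) / fact m
     * (\<Sum>n\<le>N. Polynomial.coeff (moment_poly L cf m [(1, [])]) n * t ^ n))"
proof -
  let ?a = "\<lambda>n m. expansion_coeff d L cf n m [(1, [])]"
  let ?g = "\<lambda>ks. emptycoef (Gseq d L cf ks [(1, [])])"
  have regroup: "(\<Sum>m\<le>2*N. (deriv ^^ m) f (cf []) * ?a n m) =
      (\<Sum>ks\<in>index_seqs n. (deriv ^^ sum_list ks) f (cf []) * ?g ks)" if "n \<le> N" for n
  proof -
    have "(\<Sum>m\<le>2*N. (deriv ^^ m) f (cf []) * ?a n m) =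
        (\<Sum>ks\<in>index_seqs n. \<Sum>m\<le>2*N. if sum_list ks = m then (deriv ^^ m) f (cf []) * ?g ks else 0)"
      unfolding expansion_coeff_def sum_distrib_left
      by (subst sum.swap) (intro sum.cong; simp)
    also have "\<dots> = (\<Sum>ks\<in>index_seqs n. (deriv ^^ sum_list ks) f (cf []) * ?g ks)"
    proof (intro sum.cong refl)
      fix ks assume "ks \<in> index_seqs n"
      then have "sum_list ks \<le> 2 * N" using sum_list_index_seqs_le[of ks n] that by simp
      then show "(\<Sum>m\<le>2*N. if sum_list ks = m then (deriv ^^ m) f (cf []) * ?g ks else 0) =
          (deriv ^^ sum_list ks) f (cf []) * ?g ks" by simp
    qed
    finally show ?thesis .
  qed
  have "(\<Sum>m\<le>2*N. (deriv ^^ m) f (cf []) / fact m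
      * (\<Sum>n\<le>N. Polynomial.coeff (moment_poly L cf m [(1, [])]) n * t ^ n)) =
      (\<Sum>m\<le>2*N. \<Sum>n\<le>N. t ^ n / fact n * ((deriv ^^ m) f (cf []) * ?a n m))"
    unfolding coeff_moment_poly sum_distrib_left by (intro sum.cong) auto
  also have "\<dots> = (\<Sum>n\<le>N. t ^ n / fact n * (\<Sum>m\<le>2*N. (deriv ^^ m) f (cf []) * ?a n m))"
    unfolding sum_distrib_left by (rule sum.swap)
  also have "\<dots> =
      (\<Sum>n\<le>N. t ^ n / fact n * (\<Sum>ks\<in>index_seqs n. (deriv ^^ sum_list ks) f (cf []) * ?g ks))"
    by (intro sum.cong) (auto simp: regroup)
  also have "\<dots> = f (cf [])
      + (\<Sum>n=1..N. t ^ n / fact n * (\<Sum>ks\<in>index_seqs n. (deriv ^^ sum_list ks) f (cf []) * ?g ks))"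
    by (simp add: atMost_atLeast0 sum.atLeast_Suc_atMost index_seqs_0 Gseq_def emptycoef_def)
  also have "\<dots> = expansion d L N f cf t"
    unfolding expansion_def index_seqs_def by (simp add: mult_ac)
  finally show ?thesis ..
qed

theorem expectation_minus_expansion_smallo:
  assumes f: "Ckp (2 * N) f"
  shows "(\<lambda>t. expectation (\<lambda>\<omega>. f (\<Sum>I\<leftarrow>words d L. cf I * S I t \<omega>)) - expansion d L N f cf t)
    \<in> o[at_right 0](\<lambda>t. t ^ N)"
proof -
  let ?E = "\<lambda>t m. expectation (\<lambda>\<omega>. centred_sig L cf t \<omega> ^ m)"
  let ?p = "\<lambda>m. moment_poly L cf m [(1, [])]"
  let ?f = "\<lambda>m. (deriv ^^ m) f (cf []) / fact m"
  have "(\<lambda>t. \<Sum>m\<le>2*N. ?f m * (poly (?p m) t - (\<Sum>n\<le>N. Polynomial.coeff (?p m) n * t ^ n)))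
      \<in> o[at_right 0](\<lambda>t. t ^ N)"
    by (intro big_sum_in_smallo smallo_const_mult poly_minus_truncation_smallo)
  with expectation_Taylor_smallo[OF f finite_moments_centred_sig even_moment_centred_sig_bigo]
  have "(\<lambda>t. (expectation (\<lambda>\<omega>. f (cf [] + centred_sig L cf t \<omega>)) - (\<Sum>m\<le>2*N. ?f m * ?E t m))
      + (\<Sum>m\<le>2*N. ?f m * (poly (?p m) t - (\<Sum>n\<le>N. Polynomial.coeff (?p m) n * t ^ n))))
      \<in> o[at_right 0](\<lambda>t. t ^ N)"
    by (rule sum_in_smallo)
  moreover have "\<forall>\<^sub>F t in at_right 0.
      (expectation (\<lambda>\<omega>. f (cf [] + centred_sig L cf t \<omega>)) - (\<Sum>m\<le>2*N. ?f m * ?E t m))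
      + (\<Sum>m\<le>2*N. ?f m * (poly (?p m) t - (\<Sum>n\<le>N. Polynomial.coeff (?p m) n * t ^ n)))
      = expectation (\<lambda>\<omega>. f (\<Sum>I\<leftarrow>words d L. cf I * S I t \<omega>)) - expansion d L N f cf t"
    using eventually_at_right_less[of "0::real"]
  proof eventually_elim
    case (elim t)
    show ?case
      unfolding expectation_centred_sig_power[OF elim] expansion_eq_sum_coeff_moment_poly
          sum_words_eq_centred_sig
      by (simp add: right_diff_distrib sum_subtractf)
  qed
  ultimately show ?thesis by (simp only: landau_o.small.in_cong)
qed

end

subsection \<open>Conditional expectation given an independent algebra\<close>

context prob_space begin

lemma borel_measurable_frozen_expectation:
  assumes G: "subalgebra M G" and v: "v \<in> measurable M N"
    and \<Phi>: "case_prod \<Phi> \<in> borel_measurable (G \<Otimes>\<^sub>M N)"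
  shows "(\<lambda>\<omega>. expectation (\<lambda>\<omega>'. \<Phi> \<omega> (v \<omega>') :: real)) \<in> borel_measurable G"
proof -
  interpret law: prob_space "distr M N v" by (rule prob_space_distr[OF v])
  have "(\<lambda>\<omega>. \<integral>y. \<Phi> \<omega> y \<partial>distr M N v) \<in> borel_measurable G"
    by (rule law.borel_measurable_lebesgue_integral) (use \<Phi> in \<open>simp cong: measurable_cong_sets\<close>)
  moreover have "(\<integral>y. \<Phi> \<omega> y \<partial>distr M N v) = expectation (\<lambda>\<omega>'. \<Phi> \<omega> (v \<omega>'))" if "\<omega> \<in> space G" for \<omega>
    using measurable_Pair2[OF \<Phi> that] by (intro integral_distr v) simp
  ultimately show ?thesis by (simp cong: measurable_cong)
qed

definition independent_of :: "'a measure \<Rightarrow> 'b measure \<Rightarrow> ('a \<Rightarrow> 'b) \<Rightarrow> bool" where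
  "independent_of G N v \<longleftrightarrow> v \<in> measurable M N \<and>
     (\<forall>A\<in>sets G. \<forall>B\<in>sets N. prob (A \<inter> (v -` B \<inter> space M)) = prob A * prob (v -` B \<inter> space M))"

lemma independent_of_measurable: "independent_of G N v \<Longrightarrow> v \<in> measurable M N"
  by (simp add: independent_of_def)

lemma independent_of_if_indep_set:
  assumes indep: "indep_set (sets G) (sets H)" and H: "space H = space M"
    and v: "v \<in> measurable H N"
  shows "independent_of G N v"
  unfolding independent_of_def
proof (intro conjI ballI)
  have "sets H \<subseteq> events" by (rule indep_setD_ev2[OF indep])
  then show "v \<in> measurable M N" using v H unfolding measurable_def by auto
  fix A B assume "A \<in> sets G" "B \<in> sets N"
  then show "prob (A \<inter> (v -` B \<inter> space M)) = prob A * prob (v -` B \<inter> space M)"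
    using indep_setD[OF indep, of A "v -` B \<inter> space M"] measurable_sets[OF v, of B] H by simp
qed

lemma independent_of_cong_AE:
  assumes G: "subalgebra M G" and indep: "independent_of G N v"
    and v': "v' \<in> measurable M N" and eq: "AE \<omega> in M. v \<omega> = v' \<omega>"
  shows "independent_of G N v'"
  unfolding independent_of_def
proof (intro conjI ballI v')
  fix A B assume A: "A \<in> sets G" and B: "B \<in> sets N"
  note v = independent_of_measurable[OF indep]
  have same: "prob (A' \<inter> (v' -` B \<inter> space M)) = prob (A' \<inter> (v -` B \<inter> space M))"
    if "A' \<in> events" for A'
    using eq that measurable_sets[OF v B] measurable_sets[OF v' B]
    by (intro finite_measure_eq_AE) auto
  have "A \<in> events" using A G by (auto simp: subalgebra_def)
  moreover have "space M \<inter> (u -` B \<inter> space M) = u -` B \<inter> space M" for u :: "'a \<Rightarrow> 'b" by auto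
  ultimately show "prob (A \<inter> (v' -` B \<inter> space M)) = prob A * prob (v' -` B \<inter> space M)"
    using same[of A] same[of "space M"] indep A B by (simp add: independent_of_def)
qed

lemma id_measurable_subalgebra:
  assumes "subalgebra M G" shows "(\<lambda>\<omega>. \<omega>) \<in> measurable M G"
  using measurable_from_subalg[OF assms measurable_ident] by (simp add: id_def)

lemma distr_pair_independent_of:
  assumes G: "subalgebra M G" and indep: "independent_of G N v"
  shows "distr M G (\<lambda>\<omega>. \<omega>) \<Otimes>\<^sub>M distr M N v = distr M (G \<Otimes>\<^sub>M N) (\<lambda>\<omega>. (\<omega>, v \<omega>))"
proof (rule pair_measure_eqI)
  note id = id_measurable_subalgebra[OF G] and v = independent_of_measurable[OF indep]
  interpret G: prob_space "distr M G (\<lambda>\<omega>. \<omega>)" by (rule prob_space_distr[OF id])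
  interpret N: prob_space "distr M N v" by (rule prob_space_distr[OF v])
  show "sigma_finite_measure (distr M G (\<lambda>\<omega>. \<omega>))" "sigma_finite_measure (distr M N v)"
    by unfold_locales
  show "sets (distr M G (\<lambda>\<omega>. \<omega>) \<Otimes>\<^sub>M distr M N v) = sets (distr M (G \<Otimes>\<^sub>M N) (\<lambda>\<omega>. (\<omega>, v \<omega>)))"
    by (simp cong: sets_pair_measure_cong)
  fix A B assume "A \<in> sets (distr M G (\<lambda>\<omega>. \<omega>))" "B \<in> sets (distr M N v)"
  then have A: "A \<in> sets G" and B: "B \<in> sets N" by auto
  have "A \<subseteq> space M" using sets.sets_into_space[OF A] G by (simp add: subalgebra_def)
  then have "emeasure (distr M G (\<lambda>\<omega>. \<omega>)) A * emeasure (distr M N v) B =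
      emeasure M A * emeasure M (v -` B \<inter> space M)"
    using A B id v by (simp add: emeasure_distr Int_absorb2)
  also have "\<dots> = emeasure M (A \<inter> (v -` B \<inter> space M))"
    using indep A B by (simp add: independent_of_def emeasure_eq_measure ennreal_mult)
  also have "A \<inter> (v -` B \<inter> space M) = (\<lambda>\<omega>. (\<omega>, v \<omega>)) -` (A \<times> B) \<inter> space M" by auto
  also have "emeasure M \<dots> = emeasure (distr M (G \<Otimes>\<^sub>M N) (\<lambda>\<omega>. (\<omega>, v \<omega>))) (A \<times> B)"
    using A B id v by (subst emeasure_distr) auto
  finally show "emeasure (distr M G (\<lambda>\<omega>. \<omega>)) A * emeasure (distr M N v) B =
      emeasure (distr M (G \<Otimes>\<^sub>M N) (\<lambda>\<omega>. (\<omega>, v \<omega>))) (A \<times> B)" .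
qed

lemma
  assumes G: "subalgebra M G" and indep: "independent_of G N v"
    and \<Phi>: "case_prod \<Phi> \<in> borel_measurable (G \<Otimes>\<^sub>M N)"
    and int: "integrable M (\<lambda>\<omega>. \<Phi> \<omega> (v \<omega>))"
  shows integrable_frozen_expectation: "integrable M (\<lambda>\<omega>. expectation (\<lambda>\<omega>'. \<Phi> \<omega> (v \<omega>') :: real))"
    and expectation_frozen_expectation:
      "expectation (\<lambda>\<omega>. expectation (\<lambda>\<omega>'. \<Phi> \<omega> (v \<omega>'))) = expectation (\<lambda>\<omega>. \<Phi> \<omega> (v \<omega>))"
proof -
  let ?G = "distr M G (\<lambda>\<omega>. \<omega>)" and ?N = "distr M N v"
  note id = id_measurable_subalgebra[OF G] and v = independent_of_measurable[OF indep]
  have pair: "(\<lambda>\<omega>. (\<omega>, v \<omega>)) \<in> measurable M (G \<Otimes>\<^sub>M N)" using id v by measurable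
  note product = distr_pair_independent_of[OF G indep]
  interpret G: prob_space ?G by (rule prob_space_distr[OF id])
  interpret N: prob_space ?N by (rule prob_space_distr[OF v])
  interpret GN: pair_sigma_finite ?G ?N ..
  have frozen: "(\<integral>y. \<Phi> \<omega> y \<partial>?N) = expectation (\<lambda>\<omega>'. \<Phi> \<omega> (v \<omega>'))" if "\<omega> \<in> space M" for \<omega>
    using measurable_Pair2[OF \<Phi>, of \<omega>] that G by (intro integral_distr v) (simp add: subalgebra_def)
  have int_product: "integrable (?G \<Otimes>\<^sub>M ?N) (case_prod \<Phi>)"
    unfolding product using integrable_distr_eq[OF pair \<Phi>] int by simp
  have frozen_measurable: "(\<lambda>\<omega>. \<integral>y. \<Phi> \<omega> y \<partial>?N) \<in> borel_measurable G"
    by (rule N.borel_measurable_lebesgue_integral) (use \<Phi> in \<open>simp cong: measurable_cong_sets\<close>)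
  have "integrable ?G (\<lambda>\<omega>. \<integral>y. \<Phi> \<omega> y \<partial>?N)" using GN.integrable_fst'[OF int_product] by simp
  then have "integrable M (\<lambda>\<omega>. \<integral>y. \<Phi> \<omega> y \<partial>?N)"
    using integrable_distr_eq[OF id frozen_measurable] by simp
  then show "integrable M (\<lambda>\<omega>. expectation (\<lambda>\<omega>'. \<Phi> \<omega> (v \<omega>')))"
    by (subst (asm) Bochner_Integration.integrable_cong[OF refl frozen])
  have "expectation (\<lambda>\<omega>. \<Phi> \<omega> (v \<omega>)) = (\<integral>z. case_prod \<Phi> z \<partial>(?G \<Otimes>\<^sub>M ?N))"
    unfolding product using integral_distr[OF pair \<Phi>] by simp
  also have "\<dots> = (\<integral>\<omega>. (\<integral>y. \<Phi> \<omega> y \<partial>?N) \<partial>?G)" using GN.integral_fst'[OF int_product] by simp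
  also have "\<dots> = expectation (\<lambda>\<omega>. \<integral>y. \<Phi> \<omega> y \<partial>?N)" by (rule integral_distr[OF id frozen_measurable])
  also have "\<dots> = expectation (\<lambda>\<omega>. expectation (\<lambda>\<omega>'. \<Phi> \<omega> (v \<omega>')))"
    by (intro Bochner_Integration.integral_cong refl frozen)
  finally show "expectation (\<lambda>\<omega>. expectation (\<lambda>\<omega>'. \<Phi> \<omega> (v \<omega>'))) = expectation (\<lambda>\<omega>. \<Phi> \<omega> (v \<omega>))" ..
qed

lemma is_cond_exp_frozen_expectation:
  assumes G: "subalgebra M G" and indep: "independent_of G N v"
    and \<Phi>: "case_prod \<Phi> \<in> borel_measurable (G \<Otimes>\<^sub>M N)"
    and A: "\<And>n. A n \<in> sets G" "incseq A" "(\<Union>n. A n) = space M"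
    and int: "\<And>n. integrable M (\<lambda>\<omega>. indicator (A n) \<omega> * \<Phi> \<omega> (v \<omega>))"
  shows "is_cond_exp M G (\<lambda>\<omega>. \<Phi> \<omega> (v \<omega>)) (\<lambda>\<omega>. expectation (\<lambda>\<omega>'. \<Phi> \<omega> (v \<omega>')))"
proof -
  have localized: "integrable M (\<lambda>\<omega>. indicator (A n \<inter> B) \<omega> * expectation (\<lambda>\<omega>'. \<Phi> \<omega> (v \<omega>')))
      \<and> expectation (\<lambda>\<omega>. indicator (A n \<inter> B) \<omega> * \<Phi> \<omega> (v \<omega>)) =
        expectation (\<lambda>\<omega>. indicator (A n \<inter> B) \<omega> * expectation (\<lambda>\<omega>'. \<Phi> \<omega> (v \<omega>')))"
    if B: "B \<in> sets G" for n B
  proof -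
    define \<Psi> where "\<Psi> \<omega> y = indicator (A n \<inter> B) \<omega> * \<Phi> \<omega> y" for \<omega> y
    have "case_prod \<Psi> = (\<lambda>z. indicator (A n \<inter> B) (fst z) * case_prod \<Phi> z)"
      by (simp add: fun_eq_iff \<Psi>_def)
    moreover have "\<dots> \<in> borel_measurable (G \<Otimes>\<^sub>M N)"
      using A(1) B by (intro borel_measurable_times \<Phi> measurable_compose[OF measurable_fst]
          borel_measurable_indicator) auto
    ultimately have \<Psi>: "case_prod \<Psi> \<in> borel_measurable (G \<Otimes>\<^sub>M N)" by simp
    have "B \<in> events" using B G by (auto simp: subalgebra_def)
    from integrable_mult_indicator[OF this int[of n]] have "integrable M (\<lambda>\<omega>. \<Psi> \<omega> (v \<omega>))"
      by (simp add: \<Psi>_def indicator_inter_arith mult_ac)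
    from integrable_frozen_expectation[OF G indep \<Psi> this]
        expectation_frozen_expectation[OF G indep \<Psi> this]
    show ?thesis by (simp add: \<Psi>_def)
  qed
  have "integrable M (\<lambda>\<omega>. indicator (A n) \<omega> * expectation (\<lambda>\<omega>'. \<Phi> \<omega> (v \<omega>')))" for n
    using localized[of "A n" n] A(1) by simp
  then show ?thesis
    unfolding is_cond_exp_def
    using localized A int borel_measurable_frozen_expectation[OF G
        independent_of_measurable[OF indep] \<Phi>] by blast
qed

end

subsection \<open>Independence of the signature from the initial algebra\<close>

context brownian_motion begin

definition increment_box :: "real \<Rightarrow> nat \<Rightarrow> (nat \<Rightarrow> nat \<Rightarrow> real set) \<Rightarrow> 'a set" where
  "increment_box h k B = {\<omega>\<in>space M. \<forall>j<k. \<forall>i\<in>{1..d}. step h i j \<omega> \<in> B j i}"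

lemma step_box_measurable:
  assumes "0 < h" "\<And>i. B i \<in> sets borel"
  shows "{\<omega>\<in>space M. \<forall>i\<in>{1..d}. step h i j \<omega> \<in> B i} \<in> sets (F (h * real (Suc j)))"
proof -
  let ?F = "F (h * real (Suc j))"
  have "{\<omega>\<in>space ?F. \<forall>i\<in>{1..d}. step h i j \<omega> \<in> B i} \<in> sets ?F"
  proof (rule sets.sets_Collect_finite_All)
    fix i assume "i \<in> {1..d}"
    then have "step h i j \<in> borel_measurable ?F" using adapted_step[OF assms(1)]
      by (simp add: adapted_def)
    from measurable_sets[OF this assms(2)[of i]] show "{\<omega>\<in>space ?F. step h i j \<omega> \<in> B i} \<in> sets ?F"
      by (simp add: vimage_def Int_def conj_commute)
  qed simp
  then show ?thesis by (simp only: space_F)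
qed

lemma
  assumes "0 < h" "A \<in> sets (F 0)" "\<And>j i. B j i \<in> sets borel"
  shows Int_increment_box_measurable: "A \<inter> increment_box h k B \<in> sets (F (h * real k))"
    and prob_Int_increment_box: "prob (A \<inter> increment_box h k B) =
      prob A * (\<Prod>j<k. \<Prod>i=1..d. measure (increment_law h) (B j i))"
proof -
  have "A \<inter> increment_box h k B \<in> sets (F (h * real k)) \<and> prob (A \<inter> increment_box h k B) =
      prob A * (\<Prod>j<k. \<Prod>i=1..d. measure (increment_law h) (B j i))"
  proof (induction k)
    case 0
    have "A \<inter> increment_box h 0 B = A"
      using sets.sets_into_space[OF assms(2)] by (auto simp: increment_box_def space_F)
    then show ?case using assms by simp
  next
    case (Suc k)
    let ?s = "h * real k" and ?t = "h * real (Suc k)"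
    let ?D = "{\<omega>\<in>space M. \<forall>i\<in>{1..d}. step h i k \<omega> \<in> B k i}"
    have time: "0 \<le> ?s" "?s < ?t" "?t - ?s = h" using assms(1) by (auto simp: algebra_simps)
    have split: "A \<inter> increment_box h (Suc k) B = (A \<inter> increment_box h k B) \<inter> ?D"
      by (auto simp: increment_box_def less_Suc_eq)
    have "A \<inter> increment_box h k B \<in> sets (F ?t)"
      using Suc sets_F_mono[OF less_imp_le[OF time(2)]] by blast
    then have "A \<inter> increment_box h (Suc k) B \<in> sets (F ?t)"
      unfolding split by (rule sets.Int) (rule step_box_measurable[OF assms(1,3)])
    moreover have "prob (A \<inter> increment_box h (Suc k) B) =
        prob (A \<inter> increment_box h k B) * (\<Prod>i=1..d. measure (increment_law h) (B k i))"
      unfolding split using prob_Int_increments[OF time(1,2) conjunct1[OF Suc], of "B k"] assms(3)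
      by (simp only: step_def time(3))
    ultimately show ?case using Suc by simp
  qed
  then show "A \<inter> increment_box h k B \<in> sets (F (h * real k))"
    and "prob (A \<inter> increment_box h k B) =
        prob A * (\<Prod>j<k. \<Prod>i=1..d. measure (increment_law h) (B j i))"
    by auto
qed

definition dyadic_boxes :: "real \<Rightarrow> nat \<Rightarrow> 'a set set" where
  "dyadic_boxes t n = {increment_box (t / 2 ^ n) (2 ^ n) B |B. \<forall>j i. B j i \<in> sets borel}"

definition dyadic_algebra :: "real \<Rightarrow> nat \<Rightarrow> 'a measure" where
  "dyadic_algebra t n = sigma (space M) (dyadic_boxes t n)"

lemma space_dyadic_algebra: "space (dyadic_algebra t n) = space M"
  unfolding dyadic_algebra_def
  by (rule space_measure_of) (auto simp: dyadic_boxes_def increment_box_def)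

lemma sets_dyadic_algebra: "sets (dyadic_algebra t n) = sigma_sets (space M) (dyadic_boxes t n)"
  unfolding dyadic_algebra_def
  by (rule sets_measure_of) (auto simp: dyadic_boxes_def increment_box_def)

lemma Int_stable_dyadic_boxes: "Int_stable (dyadic_boxes t n)"
proof (rule Int_stableI)
  fix X Y assume "X \<in> dyadic_boxes t n" "Y \<in> dyadic_boxes t n"
  then obtain B C where "X = increment_box (t / 2 ^ n) (2 ^ n) B" "\<And>j i. B j i \<in> sets borel"
    "Y = increment_box (t / 2 ^ n) (2 ^ n) C" "\<And>j i. C j i \<in> sets borel"
    by (auto simp: dyadic_boxes_def)
  then show "X \<inter> Y \<in> dyadic_boxes t n"
    unfolding dyadic_boxes_def
    by (intro CollectI exI[of _ "\<lambda>j i. B j i \<inter> C j i"]) (auto simp: increment_box_def)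
qed

lemma indep_set_dyadic_algebra:
  assumes "0 < t" shows "indep_set (sets (F 0)) (sets (dyadic_algebra t n))"
proof -
  have top: "space M \<in> sets (F 0)" using sets.top[of "F 0"] by (simp add: space_F)
  have h: "0 < t / 2 ^ n" using assms by simp
  have "indep_set (sets (F 0)) (dyadic_boxes t n)"
  proof (rule indep_setI)
    show "sets (F 0) \<subseteq> events" by (rule sets_F_subset)
    have box: "X \<in> events \<and> (\<forall>A\<in>sets (F 0). prob (A \<inter> X) = prob A * prob X)"
      if X_box: "X \<in> dyadic_boxes t n" for X
    proof -
      obtain B where X: "X = increment_box (t / 2 ^ n) (2 ^ n) B" and B: "\<And>j i. B j i \<in> sets borel"
        using X_box by (auto simp: dyadic_boxes_def)
      have X_M: "space M \<inter> X = X" unfolding X increment_box_def by blast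
      have "space M \<inter> X \<in> events"
        unfolding X using Int_increment_box_measurable[where B=B, OF h top B] sets_F_subset by blast
      moreover have "prob (A \<inter> X) = prob A * prob (space M \<inter> X)" if "A \<in> sets (F 0)" for A
        using prob_Int_increment_box[where B=B, OF h that B]
            prob_Int_increment_box[where B=B, OF h top B]
        by (simp add: X prob_space)
      ultimately show ?thesis unfolding X_M by blast
    qed
    then show "dyadic_boxes t n \<subseteq> events"
      and "\<And>A X. A \<in> sets (F 0) \<Longrightarrow> X \<in> dyadic_boxes t n \<Longrightarrow> prob (A \<inter> X) = prob A * prob X" by auto
  qed
  from indep_set_sigma_sets[OF this _ Int_stable_dyadic_boxes] show ?thesis
    using sets.Int_stable[of "F 0"] sets.sigma_sets_eq[of "F 0"]
    by (simp add: sets_dyadic_algebra space_F)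
qed

lemma step_measurable_dyadic_algebra:
  assumes "j < 2 ^ n" "a \<le> d"
  shows "step (t / 2 ^ n) a j \<in> borel_measurable (dyadic_algebra t n)"
proof (cases "a = 0")
  case True
  then have "step (t / 2 ^ n) a j = (\<lambda>\<omega>. t / 2 ^ n)" by (simp add: fun_eq_iff step_time)
  then show ?thesis by simp
next
  case False
  show ?thesis
  proof (rule measurableI)
    fix X :: "real set" assume X: "X \<in> sets borel"
    let ?B = "\<lambda>j' i'. if j' = j \<and> i' = a then X else UNIV"
    have "step (t / 2 ^ n) a j -` X \<inter> space (dyadic_algebra t n) =
        increment_box (t / 2 ^ n) (2 ^ n) ?B"
      using assms False by (auto simp: increment_box_def space_dyadic_algebra)
    also have "\<dots> \<in> dyadic_boxes t n"
      unfolding dyadic_boxes_def using X by (intro CollectI exI[of _ ?B]) auto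
    finally show "step (t / 2 ^ n) a j -` X \<inter> space (dyadic_algebra t n)
        \<in> sets (dyadic_algebra t n)"
      unfolding sets_dyadic_algebra by (rule sigma_sets.Basic)
  qed simp
qed

lemma step_measurable_dyadic_algebra_Suc:
  assumes "j < 2 ^ n" "a \<le> d"
  shows "step (t / 2 ^ n) a j \<in> borel_measurable (dyadic_algebra t (Suc n))"
proof -
  have "step (t / 2 ^ n) a j = (\<lambda>\<omega>. \<Sum>l<2. step (t / 2 ^ Suc n) a (j * 2 + l) \<omega>)"
    using step_refine[of 2 "t / 2 ^ n" a j] by (simp add: fun_eq_iff mult.commute)
  also have "\<dots> \<in> borel_measurable (dyadic_algebra t (Suc n))"
    using assms by (intro borel_measurable_sum step_measurable_dyadic_algebra) auto
  finally show ?thesis .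
qed

lemma sets_dyadic_algebra_Suc: "sets (dyadic_algebra t n) \<subseteq> sets (dyadic_algebra t (Suc n))"
proof -
  have "dyadic_boxes t n \<subseteq> sets (dyadic_algebra t (Suc n))"
  proof
    fix X assume "X \<in> dyadic_boxes t n"
    then obtain B where X: "X = increment_box (t / 2 ^ n) (2 ^ n) B"
      and B: "\<And>j i. B j i \<in> sets borel"
      by (auto simp: dyadic_boxes_def)
    have "X = {\<omega>\<in>space (dyadic_algebra t (Suc n)).
        \<forall>j\<in>{..<2^n}. \<forall>i\<in>{1..d}. step (t / 2 ^ n) i j \<omega> \<in> B j i}"
      by (auto simp: X increment_box_def space_dyadic_algebra)
    also have "\<dots> \<in> sets (dyadic_algebra t (Suc n))"
    proof (intro sets.sets_Collect_finite_All finite_lessThan finite_atLeastAtMost)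
      fix j i assume "j \<in> {..<(2::nat) ^ n}" "i \<in> {1..d}"
      then have "step (t / 2 ^ n) i j \<in> borel_measurable (dyadic_algebra t (Suc n))"
        by (intro step_measurable_dyadic_algebra_Suc) auto
      from measurable_sets[OF this B]
      show "{\<omega>\<in>space (dyadic_algebra t (Suc n)). step (t / 2 ^ n) i j \<omega> \<in> B j i}
          \<in> sets (dyadic_algebra t (Suc n))"
        by (simp add: vimage_def Int_def conj_commute)
    qed
    finally show "X \<in> sets (dyadic_algebra t (Suc n))" .
  qed
  then show ?thesis
    using sets.sigma_sets_subset[of "dyadic_boxes t n" "dyadic_algebra t (Suc n)"]
    by (simp add: sets_dyadic_algebra[of t n] space_dyadic_algebra)
qed

lemma sets_dyadic_algebra_mono: "n \<le> m \<Longrightarrow> sets (dyadic_algebra t n) \<subseteq> sets (dyadic_algebra t m)"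
  using sets_dyadic_algebra_Suc by (rule lift_Suc_mono_le)

lemma dyadic_sig_measurable_dyadic_algebra:
  assumes "set I \<subseteq> {0..d}" shows "dyadic_sig t n I \<in> borel_measurable (dyadic_algebra t n)"
proof -
  have "grid_sig (t / 2 ^ n) w k \<in> borel_measurable (dyadic_algebra t n)"
    if "set w \<subseteq> {0..d}" "k \<le> 2 ^ n" for w k
    using that
  proof (induction w arbitrary: k)
    case (Cons a w)
    then show ?case
      unfolding grid_sig.simps ito_sum_def[abs_def]
      by (intro borel_measurable_sum borel_measurable_times Cons.IH step_measurable_dyadic_algebra)
          auto
  qed simp
  then show ?thesis using assms by (simp add: dyadic_sig_def)
qed

definition path_algebra :: "real \<Rightarrow> 'a measure" where
  "path_algebra t = sigma (space M) (\<Union>n. sets (dyadic_algebra t n))"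

lemma dyadic_algebras_Pow: "(\<Union>n. sets (dyadic_algebra t n)) \<subseteq> Pow (space M)"
  using sets.sets_into_space space_dyadic_algebra by blast

lemma space_path_algebra: "space (path_algebra t) = space M"
  unfolding path_algebra_def by (rule space_measure_of[OF dyadic_algebras_Pow])

lemma sets_path_algebra:
  "sets (path_algebra t) = sigma_sets (space M) (\<Union>n. sets (dyadic_algebra t n))"
  unfolding path_algebra_def by (rule sets_measure_of[OF dyadic_algebras_Pow])

lemma measurable_path_algebra:
  "X \<in> measurable (dyadic_algebra t n) N \<Longrightarrow> X \<in> measurable (path_algebra t) N"
  unfolding measurable_def space_dyadic_algebra space_path_algebra sets_path_algebra
  by (blast intro: sigma_sets.Basic)

lemma indep_set_path_algebra:
  assumes "0 < t" shows "indep_set (sets (F 0)) (sets (path_algebra t))"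
proof -
  let ?H = "\<Union>n. sets (dyadic_algebra t n)"
  note indep = indep_set_dyadic_algebra[OF assms]
  have "indep_set (sets (F 0)) ?H"
  proof (rule indep_setI)
    show "sets (F 0) \<subseteq> events" by (rule sets_F_subset)
    show "?H \<subseteq> events" using indep_setD_ev2[OF indep] by blast
    show "prob (A \<inter> X) = prob A * prob X" if "A \<in> sets (F 0)" "X \<in> ?H" for A X
      using that indep_setD[OF indep] by blast
  qed
  moreover have "Int_stable ?H"
  proof (rule Int_stableI)
    fix X Y assume "X \<in> ?H" "Y \<in> ?H"
    then obtain n m where "X \<in> sets (dyadic_algebra t n)" "Y \<in> sets (dyadic_algebra t m)" by blast
    then have "X \<in> sets (dyadic_algebra t (max n m))" "Y \<in> sets (dyadic_algebra t (max n m))"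
      using sets_dyadic_algebra_mono[of n "max n m" t] sets_dyadic_algebra_mono[of m "max n m" t]
      by auto
    then show "X \<inter> Y \<in> ?H" by blast
  qed
  ultimately show ?thesis
    using indep_set_sigma_sets sets.Int_stable[of "F 0"] sets.sigma_sets_eq[of "F 0"]
    by (fastforce simp: sets_path_algebra space_F)
qed

lemma subalgebra_F: "subalgebra M (F s)"
  using filtration by (simp add: is_filtration_def)

end

lemma (in ito_signature) independent_of_signature:
  assumes t: "0 < t" and words: "\<And>I. I \<in> J \<Longrightarrow> set I \<subseteq> {0..d}"
  shows "independent_of (F 0) (PiM J (\<lambda>_. borel)) (\<lambda>\<omega>. \<lambda>I\<in>J. S I t \<omega>)"
proof (rule independent_of_cong_AE[OF subalgebra_F])
  let ?lim = "\<lambda>\<omega>. \<lambda>I\<in>J. lim (\<lambda>n. dyadic_sig t n I \<omega>)"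
  have "?lim \<in> measurable (path_algebra t) (PiM J (\<lambda>_. borel))"
    by (intro measurable_restrict borel_measurable_lim_metric words
        measurable_path_algebra[OF dyadic_sig_measurable_dyadic_algebra])
  then show "independent_of (F 0) (PiM J (\<lambda>_. borel)) ?lim"
    by (rule independent_of_if_indep_set[OF indep_set_path_algebra[OF t] space_path_algebra])
  show "(\<lambda>\<omega>. \<lambda>I\<in>J. S I t \<omega>) \<in> measurable M (PiM J (\<lambda>_. borel))"
    using t words by (intro measurable_restrict S_measurable) auto
  show "AE \<omega> in M. ?lim \<omega> = (\<lambda>I\<in>J. S I t \<omega>)"
    using AE_dyadic_sig_tendsto_S[OF t]
  proof eventually_elim
    case (elim \<omega>)
    then show ?case using words by (intro restrict_ext) (auto intro: limI)
  qed
qed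

subsection \<open>The expansion\<close>

lemma abs_sum_list_mult_le:
  fixes a b :: "'i \<Rightarrow> real"
  assumes "\<And>i. i \<in> set is \<Longrightarrow> \<bar>a i\<bar> \<le> r"
  shows "\<bar>\<Sum>i\<leftarrow>is. a i * b i\<bar> \<le> r * (\<Sum>i\<leftarrow>is. \<bar>b i\<bar>)"
  using assms
proof (induction "is")
  case (Cons i "is")
  have "\<bar>a i * b i\<bar> \<le> r * \<bar>b i\<bar>" unfolding abs_mult using Cons.prems by (intro mult_right_mono) auto
  then show ?case using Cons by (simp add: distrib_left)
qed simp

lemma borel_measurable_sum_list:
  fixes X :: "'i \<Rightarrow> 'a \<Rightarrow> real"
  shows "(\<And>i. i \<in> set is \<Longrightarrow> X i \<in> borel_measurable M) \<Longrightarrow> (\<lambda>\<omega>. \<Sum>i\<leftarrow>is. X i \<omega>) \<in> borel_measurable M"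
  by (induction "is") simp_all

lemma borel_measurable_compose_sum_list:
  fixes c :: "'i \<Rightarrow> 'a \<Rightarrow> real"
  assumes c: "\<And>i. i \<in> set is \<Longrightarrow> c i \<in> borel_measurable G" and f: "f \<in> borel_measurable borel"
  shows "(\<lambda>(\<omega>, y). f (\<Sum>i\<leftarrow>is. c i \<omega> * y i) :: real)
    \<in> borel_measurable (G \<Otimes>\<^sub>M PiM (set is) (\<lambda>_. borel))"
proof -
  have "(\<lambda>z. c i (fst z)) \<in> borel_measurable (G \<Otimes>\<^sub>M PiM (set is) (\<lambda>_. borel :: real measure))"
    "(\<lambda>z. snd z i) \<in> borel_measurable (G \<Otimes>\<^sub>M PiM (set is) (\<lambda>_. borel :: real measure))"
    if "i \<in> set is" for i
    using c that
    by (auto intro: measurable_compose[OF measurable_fst] measurable_compose[OF measurable_snd])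
  then have "(\<lambda>z. \<Sum>i\<leftarrow>is. c i (fst z) * snd z i)
      \<in> borel_measurable (G \<Otimes>\<^sub>M PiM (set is) (\<lambda>_. borel))"
    by (intro borel_measurable_sum_list borel_measurable_times) auto
  from measurable_compose[OF this f] show ?thesis by (simp add: case_prod_unfold)
qed

lemma sublevel_sets_exhaust:
  fixes c :: "'i \<Rightarrow> 'a \<Rightarrow> real"
  assumes "finite J" and c: "\<And>i. i \<in> J \<Longrightarrow> c i \<in> borel_measurable G"
  defines "A \<equiv> \<lambda>n. {\<omega>\<in>space G. \<forall>i\<in>J. \<bar>c i \<omega>\<bar> \<le> real n}"
  shows "A n \<in> sets G" "incseq A" "(\<Union>n. A n) = space G"
proof -
  show "A n \<in> sets G"
    unfolding A_def using \<open>finite J\<close>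
  proof (intro sets.sets_Collect_finite_All)
    fix i assume "i \<in> J"
    then have [measurable]: "c i \<in> borel_measurable G" by (rule c)
    show "{\<omega>\<in>space G. \<bar>c i \<omega>\<bar> \<le> real n} \<in> sets G" by measurable
  qed
  show "incseq A" by (auto simp: incseq_def A_def intro: order_trans)
  have "\<omega> \<in> (\<Union>n. A n)" if "\<omega> \<in> space G" for \<omega>
  proof -
    obtain n :: nat where n: "(\<Sum>i\<in>J. \<bar>c i \<omega>\<bar>) \<le> real n" using real_arch_simple by blast
    have "\<bar>c i \<omega>\<bar> \<le> real n" if "i \<in> J" for i
      using member_le_sum[of i J "\<lambda>i. \<bar>c i \<omega>\<bar>"] that n \<open>finite J\<close> by simp
    then show ?thesis using that by (auto simp: A_def)
  qed
  then show "(\<Union>n. A n) = space G" by (auto simp: A_def)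
qed

context ito_signature begin

lemma integrable_sigval_if_coeffs_bounded:
  assumes t: "0 < t" and c: "\<And>I. I \<in> set (words d L) \<Longrightarrow> c I \<in> borel_measurable M" and f: "Ckp k f"
    and A: "A \<in> events" "\<And>\<omega> I. \<omega> \<in> A \<Longrightarrow> I \<in> set (words d L) \<Longrightarrow> \<bar>c I \<omega>\<bar> \<le> r"
  shows "integrable M (\<lambda>\<omega>. indicator A \<omega> * f (sigval d L c S t \<omega>))"
proof -
  obtain C p where C: "0 < C" and growth: "\<And>x. \<bar>f x\<bar> \<le> C * (1 + \<bar>x\<bar> ^ p)"
    using Ckp_growth[OF f le0] by auto
  define R where "R \<omega> = r * (\<Sum>I\<leftarrow>words d L. \<bar>S I t \<omega>\<bar>)" for \<omega>
  have "finite_moments R"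
    unfolding R_def[abs_def]
    by (intro finite_moments_mult finite_moments_const finite_moments_sum_list finite_moments_abs
        finite_moments_S t set_words_subset)
  then have dominating: "integrable M (\<lambda>\<omega>. C * (1 + \<bar>R \<omega>\<bar> ^ p))" by (auto simp: finite_moments_def)
  have sigval: "(\<lambda>\<omega>. sigval d L c S t \<omega>) \<in> borel_measurable M"
    unfolding sigval_def using t set_words_subset
    by (intro borel_measurable_sum_list borel_measurable_times c S_measurable) auto
  have "\<bar>indicator A \<omega> * f (sigval d L c S t \<omega>)\<bar> \<le> C * (1 + \<bar>R \<omega>\<bar> ^ p)" for \<omega>
  proof (cases "\<omega> \<in> A")
    case True
    have "\<bar>sigval d L c S t \<omega>\<bar> \<le> \<bar>R \<omega>\<bar>"
      unfolding sigval_def R_def using A(2)[OF True]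
      by (intro order_trans[OF abs_sum_list_mult_le abs_ge_self])
    then have "C * (1 + \<bar>sigval d L c S t \<omega>\<bar> ^ p) \<le> C * (1 + \<bar>R \<omega>\<bar> ^ p)"
      using C by (intro mult_left_mono add_left_mono power_mono) auto
    then show ?thesis using True growth[of "sigval d L c S t \<omega>"] by simp
  qed (use C in simp)
  then show ?thesis
    using A(1) measurable_compose[OF sigval Ckp_measurable[OF f]]
    by (intro Bochner_Integration.integrable_bound[OF dominating] borel_measurable_times
        borel_measurable_indicator) (auto intro!: AE_I2 order_trans[OF _ abs_ge_self])
qed

theorem is_cond_exp_sigval:
  assumes t: "0 < t" and c: "\<forall>I\<in>set (words d L). c I \<in> borel_measurable (F 0)" and f: "Ckp k f"
  shows "is_cond_exp M (F 0) (\<lambda>\<omega>. f (sigval d L c S t \<omega>))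
    (\<lambda>\<omega>. expectation (\<lambda>\<omega>'. f (\<Sum>I\<leftarrow>words d L. c I \<omega> * S I t \<omega>')))"
proof -
  let ?J = "set (words d L)"
  define \<Phi> where "\<Phi> \<omega> y = f (\<Sum>I\<leftarrow>words d L. c I \<omega> * y I)" for \<omega> and y :: "nat list \<Rightarrow> real"
  define A where "A n = {\<omega>\<in>space (F 0). \<forall>I\<in>?J. \<bar>c I \<omega>\<bar> \<le> real n}" for n :: nat
  have \<Phi>_S: "\<Phi> \<omega> (\<lambda>I\<in>?J. S I t \<omega>') = f (\<Sum>I\<leftarrow>words d L. c I \<omega> * S I t \<omega>')" for \<omega> \<omega>'
    unfolding \<Phi>_def by (intro arg_cong[of _ _ f] sum_list_map_cong) simp
  have \<Phi>: "case_prod \<Phi> \<in> borel_measurable (F 0 \<Otimes>\<^sub>M PiM ?J (\<lambda>_. borel))"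
    unfolding \<Phi>_def using c Ckp_measurable[OF f] by (intro borel_measurable_compose_sum_list) auto
  have A: "A n \<in> sets (F 0)" "incseq A" "(\<Union>n. A n) = space M" for n
    unfolding A_def using sublevel_sets_exhaust[OF finite_set, of "words d L" c "F 0"] c
    by (simp_all add: space_F)
  have "integrable M (\<lambda>\<omega>. indicator (A n) \<omega> * f (sigval d L c S t \<omega>))" for n
    using A(1)[of n] sets_F_subset c
    by (intro integrable_sigval_if_coeffs_bounded[OF t measurable_F f, where r="real n"])
        (auto simp: A_def)
  then have int: "integrable M (\<lambda>\<omega>. indicator (A n) \<omega> * \<Phi> \<omega> (\<lambda>I\<in>?J. S I t \<omega>))" for n
    by (simp only: \<Phi>_S sigval_def)
  have "independent_of (F 0) (PiM ?J (\<lambda>_. borel)) (\<lambda>\<omega>. \<lambda>I\<in>?J. S I t \<omega>)"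
    by (rule independent_of_signature[OF t set_words_subset])
  then have "is_cond_exp M (F 0) (\<lambda>\<omega>. \<Phi> \<omega> (\<lambda>I\<in>?J. S I t \<omega>))
      (\<lambda>\<omega>. expectation (\<lambda>\<omega>'. \<Phi> \<omega> (\<lambda>I\<in>?J. S I t \<omega>')))"
    by (rule is_cond_exp_frozen_expectation[OF subalgebra_F _ \<Phi> A]) (rule int)
  then show ?thesis by (simp only: \<Phi>_S sigval_def)
qed

end

theorem theorem1:
  fixes M :: "'a measure" and F :: "real \<Rightarrow> 'a measure"
    and d L N :: nat and W :: "nat \<Rightarrow> real \<Rightarrow> 'a \<Rightarrow> real"
    and S :: "nat list \<Rightarrow> real \<Rightarrow> 'a \<Rightarrow> real"
    and c :: "nat list \<Rightarrow> 'a \<Rightarrow> real" and f :: "real \<Rightarrow> real"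
  assumes "prob_space M"
    and "is_filtration M F"
    and "is_std_BM M F d W"
    and "is_signature M d W S"
    and "\<forall>I\<in>set (words d L). c I \<in> borel_measurable (F 0)"
    and "Ckp (2 * N) f"
  shows "\<exists>Y :: real \<Rightarrow> 'a \<Rightarrow> real.
           (\<forall>t>0. is_cond_exp M (F 0) (\<lambda>\<omega>. f (sigval d L c S t \<omega>)) (Y t)) \<and>
           (AE \<omega> in M. ((\<lambda>t. (Y t \<omega> - expansion d L N f (\<lambda>I. c I \<omega>) t) / t ^ N)
                          \<longlongrightarrow> 0) (at_right 0))"
proof -
  interpret prob_space M by fact
  interpret ito_signature M F d W S by unfold_locales fact+
  define Y where "Y t \<omega> = expectation (\<lambda>\<omega>'. f (\<Sum>I\<leftarrow>words d L. c I \<omega> * S I t \<omega>'))" for t \<omega>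
  have "is_cond_exp M (F 0) (\<lambda>\<omega>. f (sigval d L c S t \<omega>)) (Y t)" if "0 < t" for t
    unfolding Y_def using that assms(5,6) by (rule is_cond_exp_sigval)
  moreover have "((\<lambda>t. (Y t \<omega> - expansion d L N f (\<lambda>I. c I \<omega>) t) / t ^ N) \<longlongrightarrow> 0) (at_right 0)" for \<omega>
    unfolding Y_def using assms(6) by (intro smalloD_tendsto expectation_minus_expansion_smallo)
  ultimately show ?thesis by (intro exI[of _ Y]) auto
qed

end
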